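(* For every fixed integer $d$, Local-Backbone restricted to CNF formulas in which each variable occurs at most $d$ times is fixed-parameter linear (parameterized by $k$), i.e., solvable in time $f(k)\cdot n$ for a computable function $f$, where $n$ is the instance size.
   Context: A clause is a finite set of literals not containing both $x$ and $\neg x$; a CNF formula is a finite set of clauses, $|\varphi|$ its number of clauses. $\mathrm{VO}_d$ is the class of CNF formulas in which every variable occurs in at most $d$ clauses (positively or negatively). $\varphi\models\psi$ means every assignment satisfying $\varphi$ satisfies $\psi$. A variable $x$ is a $k$-backbone of $\varphi$ if there is $\varphi'\subseteq\varphi$ with $|\varphi'|\le k$ and $\varphi'\models x$ or $\varphi'\models\neg x$. Local-Backbone$[\mathcal{C}]$: given $\varphi\in\mathcal{C}$, a variable $x$ of $\varphi$, and $k\ge1$ (the parameter), decide whether $x$ is a $k$-backbone of $\varphi$. *)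

theory Defs
  imports Main
begin

section \<open>Random access machines\<close>

text \<open>
  Running times refer to a uniform-cost random access machine over the natural numbers with
  addition, truncated subtraction and indirect addressing. A program mentions only finitely
  many registers, because it is a finite list; the memory is unbounded.
\<close>

datatype instr =
    Const nat nat
  | Add nat nat nat
  | Sub nat nat nat
  | Load nat nat
  | Store nat nat
  | JumpZero nat nat

type_synonym program = "instr list"

record config =
  pc :: nat
  reg :: "nat \<Rightarrow> nat"
  mem :: "nat \<Rightarrow> nat"

fun exec :: "instr \<Rightarrow> config \<Rightarrow> config" where
  "exec (Const r c) s = s\<lparr>pc := Suc (pc s), reg := (reg s)(r := c)\<rparr>"
| "exec (Add r a b) s = s\<lparr>pc := Suc (pc s), reg := (reg s)(r := reg s a + reg s b)\<rparr>"
| "exec (Sub r a b) s = s\<lparr>pc := Suc (pc s), reg := (reg s)(r := reg s a - reg s b)\<rparr>"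
| "exec (Load r a) s = s\<lparr>pc := Suc (pc s), reg := (reg s)(r := mem s (reg s a))\<rparr>"
| "exec (Store a r) s = s\<lparr>pc := Suc (pc s), mem := (mem s)(reg s a := reg s r)\<rparr>"
| "exec (JumpZero r l) s = s\<lparr>pc := (if reg s r = 0 then l else Suc (pc s))\<rparr>"

text \<open>A machine halts by leaving the program text; its configuration then no longer changes.\<close>

definition halted :: "program \<Rightarrow> config \<Rightarrow> bool" where
  "halted P s \<longleftrightarrow> length P \<le> pc s"

definition step :: "program \<Rightarrow> config \<Rightarrow> config" where
  "step P s = (if halted P s then s else exec (P ! pc s) s)"

text \<open>
  The input word occupies the memory cells \<open>0, ..., n - 1\<close> and its length \<open>n\<close> is in register 0.
  All other registers and cells are 0. The output is read off register 0.
\<close>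

definition initial :: "nat list \<Rightarrow> config" where
  "initial w = \<lparr>pc = 0,
     reg = (\<lambda>r. if r = 0 then length w else 0),
     mem = (\<lambda>a. if a < length w then w ! a else 0)\<rparr>"

definition run :: "program \<Rightarrow> nat list \<Rightarrow> nat \<Rightarrow> config" where
  "run P w t = (step P ^^ t) (initial w)"

definition computes_within :: "program \<Rightarrow> nat list \<Rightarrow> nat \<Rightarrow> nat \<Rightarrow> bool" where
  "computes_within P w T v \<longleftrightarrow> (\<exists>t\<le>T. halted P (run P w t) \<and> reg (run P w t) 0 = v)"

definition values_bounded :: "program \<Rightarrow> nat list \<Rightarrow> nat \<Rightarrow> bool" where
  "values_bounded P w B \<longleftrightarrow> (\<forall>t i. reg (run P w t) i \<le> B \<and> mem (run P w t) i \<le> B)"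

definition computable :: "(nat \<Rightarrow> nat) \<Rightarrow> bool" where
  "computable f \<longleftrightarrow> (\<exists>P. \<forall>k. \<exists>T. computes_within P [k] T (f k))"


section \<open>Fixed-parameter linear problems\<close>

text \<open>
  A parameterized problem may be restricted to a class of instances, on which alone
  algorithms are required to work. An instance may have several encodings (for example, the
  elements of a finite set can be listed in different orders); an algorithm has to work on
  all of them.
\<close>

record 'i parameterized_problem =
  instances :: "'i set"
  yes :: "'i \<Rightarrow> bool"
  parameter :: "'i \<Rightarrow> nat"
  encodings :: "'i \<Rightarrow> nat list set"

text \<open>
  The size of an instance is the number of machine words of its encoding. The uniform cost
  measure is only realistic if words stay short, so all numbers held by the machine, addresses
  included, are required to be at most \<open>f(k) N\<^sup>c\<close>, where \<open>N\<close> is the length of the input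
  plus its largest entry: a word then has \<open>O(log f(k) + log N)\<close> bits.
\<close>

definition magnitude :: "nat list \<Rightarrow> nat" where
  "magnitude w = length w + Max (insert 0 (set w))"

definition fixed_parameter_linear :: "'i parameterized_problem \<Rightarrow> bool" where
  "fixed_parameter_linear Q \<longleftrightarrow>
    (\<exists>P f c. computable f \<and>
      (\<forall>I \<in> instances Q. \<forall>w \<in> encodings Q I.
        computes_within P w (f (parameter Q I) * length w) (if yes Q I then 1 else 0) \<and>
        values_bounded P w (f (parameter Q I) * magnitude w ^ c)))"


section \<open>Local backbones\<close>

datatype literal = Pos (var_of: nat) | Neg (var_of: nat)

type_synonym clause = "literal set"
type_synonym cnf = "clause set"

definition is_clause :: "clause \<Rightarrow> bool" where
  "is_clause C \<longleftrightarrow> finite C \<and> \<not> (\<exists>x. Pos x \<in> C \<and> Neg x \<in> C)"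

definition is_cnf :: "cnf \<Rightarrow> bool" where
  "is_cnf \<phi> \<longleftrightarrow> finite \<phi> \<and> (\<forall>C\<in>\<phi>. is_clause C)"

definition vars :: "cnf \<Rightarrow> nat set" where
  "vars \<phi> = (\<Union>C\<in>\<phi>. var_of ` C)"

definition VO :: "int \<Rightarrow> cnf set" where
  "VO d = {\<phi>. is_cnf \<phi> \<and> (\<forall>x\<in>vars \<phi>. int (card {C\<in>\<phi>. x \<in> var_of ` C}) \<le> d)}"

fun satisfies_literal :: "(nat \<Rightarrow> bool) \<Rightarrow> literal \<Rightarrow> bool" where
  "satisfies_literal \<tau> (Pos x) \<longleftrightarrow> \<tau> x"
| "satisfies_literal \<tau> (Neg x) \<longleftrightarrow> \<not> \<tau> x"

definition satisfies :: "(nat \<Rightarrow> bool) \<Rightarrow> cnf \<Rightarrow> bool" where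
  "satisfies \<tau> \<phi> \<longleftrightarrow> (\<forall>C\<in>\<phi>. \<exists>l\<in>C. satisfies_literal \<tau> l)"

definition entails :: "cnf \<Rightarrow> cnf \<Rightarrow> bool" where
  "entails \<phi> \<psi> \<longleftrightarrow> (\<forall>\<tau>. satisfies \<tau> \<phi> \<longrightarrow> satisfies \<tau> \<psi>)"

definition is_backbone :: "nat \<Rightarrow> cnf \<Rightarrow> nat \<Rightarrow> bool" where
  "is_backbone k \<phi> x \<longleftrightarrow>
    (\<exists>\<phi>'\<subseteq>\<phi>. card \<phi>' \<le> k \<and> (entails \<phi>' {{Pos x}} \<or> entails \<phi>' {{Neg x}}))"


fun encode_literal :: "literal \<Rightarrow> nat list" where
  "encode_literal (Pos x) = [1, x]"
| "encode_literal (Neg x) = [0, x]"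

definition encode_clause :: "literal list \<Rightarrow> nat list" where
  "encode_clause ls = length ls # concat (map encode_literal ls)"

text \<open>A formula is given by listing each of its clauses, and each literal of a clause, once.\<close>

definition clause_listing :: "cnf \<Rightarrow> literal list list \<Rightarrow> bool" where
  "clause_listing \<phi> cs \<longleftrightarrow>
    set (map set cs) = \<phi> \<and> distinct (map set cs) \<and> (\<forall>ls\<in>set cs. distinct ls)"

definition Local_Backbone :: "cnf set \<Rightarrow> (cnf \<times> nat \<times> nat) parameterized_problem" where
  "Local_Backbone \<C> = \<lparr>
     instances = {(\<phi>, x, k). \<phi> \<in> \<C> \<and> x \<in> vars \<phi> \<and> 1 \<le> k},
     yes = (\<lambda>(\<phi>, x, k). is_backbone k \<phi> x),
     parameter = (\<lambda>(\<phi>, x, k). k),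
     encodings = (\<lambda>(\<phi>, x, k).
       {[k, x, length cs] @ concat (map encode_clause cs) | cs. clause_listing \<phi> cs})\<rparr>"

end

theory Submission imports Defs begin

text \<open>
  Proof idea. A variable \<open>x\<close> is a \<open>k\<close>-backbone of \<open>\<phi>\<close> iff some \<open>\<phi>' \<subseteq> \<phi>\<close> with at most \<open>k\<close> clauses
  becomes unsatisfiable when a unit clause on \<open>x\<close> is added. A minimal unsatisfiable
  subset \<open>U\<close> of \<open>\<phi>'\<close> together with that unit clause is connected (consecutive clauses can be chosen to
  share a variable with earlier ones), and each of its clauses has fewer literals than \<open>U\<close> has
  clauses. If \<open>U\<close> avoids the unit clause, it need not contain \<open>x\<close> at all, so every clause of
  \<open>\<phi>\<close> has to be tried as a starting point, besides the two unit clauses. After one linear pass that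
  lists the at most \<open>d\<close> occurrences of each variable, the clause sets grown from a starting point are
  enumerated by the digits of a number \<open>g < N\<close>, and each of them is refuted by trying all choices of one
  literal per clause, given by the digits of \<open>h < N\<close>; here \<open>N\<close> depends on \<open>d\<close> and \<open>k\<close> only.

  The algorithm is written in a small while-language compiled to the random access machine. In this
  language values only grow by increments, so that bounds on values follow from the running time.
\<close>

section \<open>A while-language for the random access machine\<close>

text \<open>Linear time rules out sorting and any clearing pass, while names of variables may be far
  larger than the length of the input. Row \<open>v\<close> of the table of occurrences therefore
  lies directly at offset \<open>m * v\<close>, where \<open>m = nat d\<close>, and relies on the
  memory being 0 initially: only rows of occurring variables are ever written. Such addresses are
  affordable because \<open>magnitude\<close> counts the largest entry of the input. The enumerated
  numbers stay below \<open>N = search_size m k\<close>, so slow arithmetic by repeated increments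
  costs only a factor in \<open>k\<close>. The base \<open>D\<close> of the digits exceeds the
  length of the encoding of \<open>k + 1\<close> clauses with at most \<open>k\<close> literals
  each, so that one digit can address each of its cells, and it is at least \<open>m\<close>. Digits
  may select nonsense, such as a cell holding a sign or a column beyond the row. This is harmless,
  since every nonzero table entry is the position of a clause of the formula: soundness asks nothing
  of the digits, and completeness asks for one good number only. The machine part and the
  combinatorial part meet in \<open>accepts\<close>.\<close>

type_synonym store = "nat \<Rightarrow> nat"

text \<open>There is no addition of two registers: repeated doubling would make values exponential
  in the running time. Sums for addresses occur only inside \<open>FetchAt\<close> and
  \<open>SaveAt\<close>, whose factor \<open>m\<close> is a constant of the program text and is
  realised by \<open>m\<close> additions.\<close>

datatype basic =
    Skip
  | Put nat nat
  | Copy nat nat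
  | Incr nat
  | Decr nat
  | Minus nat nat nat
  | Fetch nat nat
  | Save nat nat
  | FetchAt nat nat nat nat nat
  | SaveAt nat nat nat nat nat

datatype com =
    Do basic
  | Seq com com  (infixr \<open>;;\<close> 60)
  | IfLess nat nat com com
  | WhileLess nat nat com

fun regs_after :: "basic \<Rightarrow> store \<Rightarrow> store \<Rightarrow> store" where
  "regs_after (Put r c) R M = R(r := c)"
| "regs_after (Copy r a) R M = R(r := R a)"
| "regs_after (Incr r) R M = R(r := Suc (R r))"
| "regs_after (Decr r) R M = R(r := R r - 1)"
| "regs_after (Minus r a b) R M = R(r := R a - R b)"
| "regs_after (Fetch r a) R M = R(r := M (R a))"
| "regs_after (FetchAt m r b v i) R M = R(r := M (R b + m * R v + R i))"
| "regs_after _ R M = R"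

fun mem_after :: "basic \<Rightarrow> store \<Rightarrow> store \<Rightarrow> store" where
  "mem_after (Save a r) R M = M(R a := R r)"
| "mem_after (SaveAt m b v i r) R M = M(R b + m * R v + R i := R r)"
| "mem_after _ R M = M"

text \<open>
  Register \<open>r\<close> of the language is register \<open>r + 5\<close> of the machine. Machine registers 1 and 2 hold the
  constants 0 and 1, register 3 the result of comparisons, and register 4 is used for addresses.
\<close>

fun code :: "basic \<Rightarrow> instr list" where
  "code Skip = []"
| "code (Put r c) = [Const (r + 5) c]"
| "code (Copy r a) = [Add (r + 5) (a + 5) 1]"
| "code (Incr r) = [Add (r + 5) (r + 5) 2]"
| "code (Decr r) = [Sub (r + 5) (r + 5) 2]"
| "code (Minus r a b) = [Sub (r + 5) (a + 5) (b + 5)]"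
| "code (Fetch r a) = [Load (r + 5) (a + 5)]"
| "code (Save a r) = [Store (a + 5) (r + 5)]"
| "code (FetchAt m r b v i) =
     Add 4 (b + 5) (i + 5) # replicate m (Add 4 4 (v + 5)) @ [Load (r + 5) 4]"
| "code (SaveAt m b v i r) =
     Add 4 (b + 5) (i + 5) # replicate m (Add 4 4 (v + 5)) @ [Store 4 (r + 5)]"

text \<open>The time component is the exact number of machine steps. A test is a subtraction and a
  conditional jump; the third step counted by \<open>IfTrue\<close> and \<open>WhileTrue\<close> is
  the jump past the other branch or back to the test.\<close>

inductive ev :: "com \<Rightarrow> store \<Rightarrow> store \<Rightarrow> nat \<Rightarrow> store \<Rightarrow> store \<Rightarrow> bool" where
  Do: "ev (Do b) R M (length (code b)) (regs_after b R M) (mem_after b R M)"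
| Seq: "ev c1 R M t1 R1 M1 \<Longrightarrow> ev c2 R1 M1 t2 R2 M2 \<Longrightarrow> ev (c1 ;; c2) R M (t1 + t2) R2 M2"
| IfTrue: "R a < R b \<Longrightarrow> ev c1 R M t R' M' \<Longrightarrow> ev (IfLess a b c1 c2) R M (t + 3) R' M'"
| IfFalse: "\<not> R a < R b \<Longrightarrow> ev c2 R M t R' M' \<Longrightarrow> ev (IfLess a b c1 c2) R M (t + 2) R' M'"
| WhileFalse: "\<not> R a < R b \<Longrightarrow> ev (WhileLess a b c) R M 2 R M"
| WhileTrue: "R a < R b \<Longrightarrow> ev c R M t1 R1 M1 \<Longrightarrow> ev (WhileLess a b c) R1 M1 t2 R2 M2 \<Longrightarrow>
    ev (WhileLess a b c) R M (t1 + 3 + t2) R2 M2"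

inductive_cases ev_DoE: "ev (Do b) R M t R' M'"
inductive_cases ev_SeqE: "ev (c1 ;; c2) R M t R' M'"
inductive_cases ev_IfE: "ev (IfLess a b c1 c2) R M t R' M'"

text \<open>Jump targets are absolute, hence the argument \<open>l\<close>, the address at which the
  code is placed. \<open>JumpZero 1\<close> always jumps, as machine register 1 holds 0.\<close>

fun compile :: "nat \<Rightarrow> com \<Rightarrow> program" where
  "compile l (Do b) = code b"
| "compile l (c1 ;; c2) = (let C1 = compile l c1 in C1 @ compile (l + length C1) c2)"
| "compile l (IfLess a b c1 c2) =
    (let C1 = compile (l + 2) c1; l2 = l + 3 + length C1; C2 = compile l2 c2
     in [Sub 3 (b + 5) (a + 5), JumpZero 3 l2] @ C1 @ [JumpZero 1 (l2 + length C2)] @ C2)"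
| "compile l (WhileLess a b c) =
    (let C = compile (l + 2) c
     in [Sub 3 (b + 5) (a + 5), JumpZero 3 (l + 3 + length C)] @ C @ [JumpZero 1 l])"

section \<open>Simulation of the while-language by its compiled code\<close>

definition represents :: "config \<Rightarrow> store \<Rightarrow> store \<Rightarrow> bool" where
  "represents s R M \<longleftrightarrow> reg s 1 = 0 \<and> reg s 2 = 1 \<and> (\<forall>r. reg s (r + 5) = R r) \<and> mem s = M"

definition reaches :: "program \<Rightarrow> config \<Rightarrow> nat \<Rightarrow> config \<Rightarrow> bool" where
  "reaches P s t s' \<longleftrightarrow> (step P ^^ t) s = s'"

lemma reaches_refl: "reaches P s 0 s"
  by (simp add: reaches_def)

lemma reaches_trans: "reaches P s t1 s1 \<Longrightarrow> reaches P s1 t2 s2 \<Longrightarrow> reaches P s (t1 + t2) s2"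
  by (auto simp: reaches_def funpow_add add.commute[of t1])

lemma reaches_step:
  assumes "P = pre @ i # post" "pc s = length pre"
  shows "reaches P s 1 (exec i s)"
  using assms by (simp add: reaches_def step_def halted_def)

fun is_jump :: "instr \<Rightarrow> bool" where
  "is_jump (JumpZero _ _) = True"
| "is_jump _ = False"

lemma pc_exec: "\<not> is_jump i \<Longrightarrow> pc (exec i s) = Suc (pc s)"
  by (cases i) auto

lemma reaches_straight:
  assumes "P = pre @ js @ post" "pc s = length pre" "\<forall>i\<in>set js. \<not> is_jump i"
  shows "reaches P s (length js) (fold exec js s) \<and> pc (fold exec js s) = length (pre @ js)"
  using assms
proof (induction js arbitrary: pre s)
  case Nil
  then show ?case by (simp add: reaches_refl)
next
  case (Cons i js)
  have "reaches P s 1 (exec i s)"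
    using Cons.prems by (intro reaches_step[of _ pre]) auto
  moreover have "reaches P (exec i s) (length js) (fold exec js (exec i s)) \<and>
      pc (fold exec js (exec i s)) = length ((pre @ [i]) @ js)"
    using Cons.prems by (intro Cons.IH) (auto simp: pc_exec)
  ultimately show ?case using reaches_trans by fastforce
qed

lemma fold_accumulate:
  "(exec (Add 4 4 (v + 5)) ^^ m) s =
     s\<lparr>pc := pc s + m, reg := (reg s)(4 := reg s 4 + m * reg s (v + 5))\<rparr>"
  by (induction m arbitrary: s) (auto simp: fun_eq_iff algebra_simps)

lemma code_represents:
  assumes "represents s R M"
  shows "represents (fold exec (code b) s) (regs_after b R M) (mem_after b R M)"
  using assms by (cases b) (auto simp: represents_def fold_accumulate fun_eq_iff ac_simps)

lemma code_no_jump: "i \<in> set (code b) \<Longrightarrow> \<not> is_jump i"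
  by (cases b) auto

text \<open>Comparisons leave the truncated difference in register 3, which lies outside the image of the store.\<close>

lemma reaches_test:
  assumes "P = pre @ Sub 3 (b + 5) (a + 5) # JumpZero 3 l # post" "pc s = length pre" "represents s R M"
  shows "\<exists>s'. reaches P s 2 s' \<and> represents s' R M \<and>
           pc s' = (if R a < R b then length pre + 2 else l)"
proof -
  define s1 where "s1 = exec (Sub 3 (b + 5) (a + 5)) s"
  have s1: "reaches P s 1 s1" unfolding s1_def using assms by (intro reaches_step) auto
  have "reaches P s1 1 (exec (JumpZero 3 l) s1)"
    using assms by (intro reaches_step[of _ "pre @ [Sub 3 (b + 5) (a + 5)]"]) (auto simp: s1_def)
  with s1 have "reaches P s 2 (exec (JumpZero 3 l) s1)"
    by (metis reaches_trans one_add_one)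
  moreover have "represents (exec (JumpZero 3 l) s1) R M"
    using assms(3) by (auto simp: s1_def represents_def)
  moreover have "pc (exec (JumpZero 3 l) s1) = (if R a < R b then length pre + 2 else l)"
    using assms(2,3) by (auto simp: s1_def represents_def)
  ultimately show ?thesis by blast
qed

lemma reaches_goto:
  assumes "P = pre @ JumpZero 1 l # post" "pc s = length pre" "represents s R M"
  shows "\<exists>s'. reaches P s 1 s' \<and> represents s' R M \<and> pc s' = l"
proof -
  have "reaches P s 1 (exec (JumpZero 1 l) s)" using assms by (intro reaches_step) auto
  then show ?thesis using assms by (auto simp: represents_def)
qed

text \<open>Since jump targets refer to the whole program, the code is considered in place, between
  arbitrary \<open>pre\<close> and \<open>post\<close>; in the induction these absorb the
  neighbouring code.\<close>

lemma compile_correct: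
  assumes "ev c R M t R' M'" "P = pre @ compile (length pre) c @ post"
    "pc s = length pre" "represents s R M"
  shows "\<exists>s'. reaches P s t s' \<and> represents s' R' M' \<and> pc s' = length (pre @ compile (length pre) c)"
  using assms
proof (induction arbitrary: pre post s rule: ev.induct)
  case (Do b R M)
  then show ?case
    using reaches_straight[of P pre "code b" post s] code_no_jump code_represents by fastforce
next
  case (Seq c1 R M t1 R1 M1 c2 t2 R2 M2)
  let ?C1 = "compile (length pre) c1"
  let ?C2 = "compile (length (pre @ ?C1)) c2"
  obtain s1 where s1: "reaches P s t1 s1" "represents s1 R1 M1" "pc s1 = length (pre @ ?C1)"
    using Seq.IH(1)[of pre "?C2 @ post" s] Seq.prems by (auto simp: Let_def)
  obtain s2 where s2: "reaches P s1 t2 s2" "represents s2 R2 M2" "pc s2 = length ((pre @ ?C1) @ ?C2)"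
    using Seq.IH(2)[of "pre @ ?C1" post s1] Seq.prems s1 by (auto simp: Let_def)
  then show ?case using reaches_trans[OF s1(1) s2(1)] by (auto simp: Let_def)
next
  case (IfTrue R a b c1 M t R' M' c2)
  let ?C1 = "compile (length pre + 2) c1"
  let ?l2 = "length pre + 3 + length ?C1"
  let ?C2 = "compile ?l2 c2"
  let ?T = "[Sub 3 (b + 5) (a + 5), JumpZero 3 ?l2]"
  have l: "length (pre @ ?T) = length pre + 2" by simp
  have P: "P = (pre @ ?T) @ compile (length (pre @ ?T)) c1 @ JumpZero 1 (?l2 + length ?C2) # ?C2 @ post"
    unfolding l using IfTrue.prems(1) by (simp add: Let_def)
  obtain s1 where s1: "reaches P s 2 s1" "represents s1 R M" "pc s1 = length (pre @ ?T)"
    using reaches_test[of P pre b a ?l2 _ s R M] P IfTrue.prems(2,3) IfTrue.hyps(1) by auto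
  obtain s2 where s2: "reaches P s1 t s2" "represents s2 R' M'"
      "pc s2 = length ((pre @ ?T) @ compile (length (pre @ ?T)) c1)"
    using IfTrue.IH[OF P s1(3,2)] by blast
  obtain s3 where s3: "reaches P s2 1 s3" "represents s3 R' M'" "pc s3 = ?l2 + length ?C2"
    using reaches_goto[OF trans[OF P append_assoc[symmetric]] s2(3,2)] by blast
  have "reaches P s (2 + t + 1) s3"
    by (rule reaches_trans[OF reaches_trans[OF s1(1) s2(1)] s3(1)])
  then have "reaches P s (t + 3) s3" by (simp add: numeral_eq_Suc)
  with s3 show ?case by (auto simp: Let_def)
next
  case (IfFalse R a b c2 M t R' M' c1)
  let ?C1 = "compile (length pre + 2) c1"
  let ?l2 = "length pre + 3 + length ?C1"
  let ?C2 = "compile ?l2 c2"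
  let ?pre = "pre @ [Sub 3 (b + 5) (a + 5), JumpZero 3 ?l2] @ ?C1 @ [JumpZero 1 (?l2 + length ?C2)]"
  have l: "length ?pre = ?l2" by simp
  have P: "P = ?pre @ compile (length ?pre) c2 @ post"
    unfolding l using IfFalse.prems(1) by (simp add: Let_def)
  obtain s1 where s1: "reaches P s 2 s1" "represents s1 R M" "pc s1 = length ?pre"
    using reaches_test[of P pre b a ?l2 _ s R M] P IfFalse.prems(2,3) IfFalse.hyps(1) l by auto
  obtain s2 where s2: "reaches P s1 t s2" "represents s2 R' M'"
      "pc s2 = length (?pre @ compile (length ?pre) c2)"
    using IfFalse.IH[OF P s1(3,2)] by blast
  have "reaches P s (t + 2) s2"
    using reaches_trans[OF s1(1) s2(1)] by (simp only: add.commute)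
  with s2 show ?case unfolding l by (auto simp: Let_def)
next
  case (WhileFalse R a b c M)
  let ?C = "compile (length pre + 2) c"
  show ?case
    using reaches_test[of P pre b a "length pre + 3 + length ?C" _ s R M] WhileFalse
    by (fastforce simp: Let_def)
next
  case (WhileTrue R a b c M t1 R1 M1 t2 R2 M2)
  let ?l = "length pre + 3 + length (compile (length pre + 2) c)"
  let ?T = "[Sub 3 (b + 5) (a + 5), JumpZero 3 ?l]"
  have l: "length (pre @ ?T) = length pre + 2" by simp
  have P: "P = (pre @ ?T) @ compile (length (pre @ ?T)) c @ JumpZero 1 (length pre) # post"
    unfolding l using WhileTrue.prems(1) by (simp add: Let_def)
  obtain s1 where s1: "reaches P s 2 s1" "represents s1 R M" "pc s1 = length (pre @ ?T)"
    using reaches_test[of P pre b a ?l _ s R M] P WhileTrue.prems(2,3) WhileTrue.hyps(1) by auto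
  obtain s2 where s2: "reaches P s1 t1 s2" "represents s2 R1 M1"
      "pc s2 = length ((pre @ ?T) @ compile (length (pre @ ?T)) c)"
    using WhileTrue.IH(1)[OF P s1(3,2)] by blast
  obtain s3 where s3: "reaches P s2 1 s3" "represents s3 R1 M1" "pc s3 = length pre"
    using reaches_goto[OF trans[OF P append_assoc[symmetric]] s2(3,2)] by blast
  obtain s4 where s4: "reaches P s3 t2 s4" "represents s4 R2 M2"
      "pc s4 = length (pre @ compile (length pre) (WhileLess a b c))"
    using WhileTrue.IH(2)[OF WhileTrue.prems(1) s3(3,2)] by blast
  have "reaches P s (2 + t1 + 1 + t2) s4"
    by (rule reaches_trans[OF reaches_trans[OF reaches_trans[OF s1(1) s2(1)] s3(1)] s4(1)])
  then have "reaches P s (t1 + 3 + t2) s4" by (simp add: numeral_eq_Suc)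
  with s4 show ?case by blast
qed

text \<open>The two leading instructions load the constant 1 and copy the input length to the image
  of register 0 of the language; the last one copies the result back. They account for the 3 in
  \<open>machine_correct\<close>. Machine register 1 is 0 from the start.\<close>

definition machine :: "com \<Rightarrow> program" where
  "machine c = [Const 2 1, Add 5 0 1] @ compile 2 c @ [Add 0 5 1]"

definition initial_regs :: "nat list \<Rightarrow> store" where
  "initial_regs w = (\<lambda>r. if r = 0 then length w else 0)"

definition initial_mem :: "nat list \<Rightarrow> store" where
  "initial_mem w = (\<lambda>a. if a < length w then w ! a else 0)"

lemma machine_correct:
  assumes "ev c (initial_regs w) (initial_mem w) t R' M'"
  shows "computes_within (machine c) w (t + 3) (R' 0)"
proof -
  define pre where "pre = [Const 2 1, Add 5 0 1]"
  define s where "s = initial w"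
  define s1 where "s1 = fold exec pre s"
  have P: "machine c = [] @ pre @ compile 2 c @ [Add 0 5 1]" by (simp add: machine_def pre_def)
  have s1: "reaches (machine c) s (length pre) s1 \<and> pc s1 = length ([] @ pre)"
    unfolding s1_def using P by (intro reaches_straight) (auto simp: s_def initial_def pre_def)
  have "represents s1 (initial_regs w) (initial_mem w)"
    by (auto simp: represents_def s1_def pre_def s_def initial_def initial_regs_def initial_mem_def
        fun_eq_iff)
  then obtain s2 where s2: "reaches (machine c) s1 t s2" "represents s2 R' M'"
      "pc s2 = length (pre @ compile (length pre) c)"
    using compile_correct[OF assms, of "machine c" pre "[Add 0 5 1]" s1] s1 P
    by (auto simp: pre_def numeral_2_eq_2)
  define s3 where "s3 = exec (Add 0 5 1) s2"
  have s3: "reaches (machine c) s2 1 s3"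
    unfolding s3_def using s2 P by (intro reaches_step[of _ "pre @ compile 2 c" _ "[]"]) (auto simp: pre_def numeral_2_eq_2)
  have "reaches (machine c) s (length pre + t + 1) s3"
    by (rule reaches_trans[OF reaches_trans[OF conjunct1[OF s1] s2(1)] s3])
  then have "reaches (machine c) s (t + 3) s3" by (simp add: pre_def numeral_eq_Suc)
  moreover have "halted (machine c) s3" "reg s3 0 = R' 0"
  proof -
    show "halted (machine c) s3" using s2(3) by (simp add: halted_def s3_def P pre_def numeral_2_eq_2)
    have "reg s2 (0 + 5) = R' 0" "reg s2 1 = 0" using s2(2) unfolding represents_def by blast+
    then show "reg s3 0 = R' 0" by (simp add: s3_def)
  qed
  ultimately show ?thesis
    unfolding computes_within_def run_def reaches_def s_def by blast
qed


section \<open>Bounds on the values\<close>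

text \<open>
  Apart from the address register 4, values grow by at most 1 per step, and register 4 grows by
  at most one such value per step. Hence short running times entail small values.
\<close>

fun tame :: "nat \<Rightarrow> instr \<Rightarrow> bool" where
  "tame B (Const r c) \<longleftrightarrow> r \<noteq> 1 \<and> r \<noteq> 4 \<and> (r = 2 \<longrightarrow> c = 1) \<and> c \<le> B"
| "tame B (Add r a b) \<longleftrightarrow> r \<notin> {1, 2, 4} \<and> a \<noteq> 4 \<and> b \<in> {1, 2} \<or> r = 4 \<and> b \<noteq> 4"
| "tame B (Sub r a b) \<longleftrightarrow> r \<notin> {1, 2, 4} \<and> a \<noteq> 4"
| "tame B (Load r a) \<longleftrightarrow> r \<notin> {1, 2, 4}"
| "tame B (Store a r) \<longleftrightarrow> r \<noteq> 4"
| "tame B (JumpZero r l) \<longleftrightarrow> True"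

lemma tame_mono: "tame B i \<Longrightarrow> B \<le> B' \<Longrightarrow> tame B' i"
  by (cases i) auto

lemma tame_code: "\<exists>B. \<forall>i\<in>set (code b). tame B i"
  by (cases b) auto

lemma tame_append:
  assumes "\<exists>B. \<forall>i\<in>set P. tame B i" "\<exists>B. \<forall>i\<in>set Q. tame B i"
  shows "\<exists>B. \<forall>i\<in>set (P @ Q). tame B i"
proof -
  obtain B B' where "\<forall>i\<in>set P. tame B i" "\<forall>i\<in>set Q. tame B' i" using assms by blast
  then show ?thesis by (intro exI[of _ "max B B'"]) (auto intro: tame_mono)
qed

lemma tame_compile: "\<exists>B. \<forall>i\<in>set (compile l c). tame B i"
proof (induction c arbitrary: l)
  case (Do b)
  then show ?case by (simp add: tame_code)
next
  case (Seq c1 c2)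
  then show ?case by (simp only: compile.simps Let_def tame_append)
next
  case (IfLess a b c1 c2)
  then show ?case unfolding compile.simps Let_def by (intro tame_append) auto
next
  case (WhileLess a b c)
  then show ?case unfolding compile.simps Let_def by (intro tame_append) auto
qed

lemma tame_machine: "\<exists>B. \<forall>i\<in>set (machine c). tame B i"
  unfolding machine_def by (intro tame_append tame_compile) auto

text \<open>\<open>X\<close> bounds the input and all constants of the program; constants are only
  loaded, never accumulated. Register 4 may be accumulated, but its value is never copied to another
  register or to a cell, so its larger bound does not spread. Register 2 is still 0 before the first
  step, whence only \<open>\<le> 1\<close>.\<close>

lemma tame_run:
  assumes "\<forall>i\<in>set P. tame B i" "B + magnitude w \<le> X" "1 \<le> X"
  shows "reg (run P w t) 1 = 0 \<and> reg (run P w t) 2 \<le> 1 \<and> (\<forall>r. r \<noteq> 4 \<longrightarrow> reg (run P w t) r \<le> X + t) \<and>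
    (\<forall>a. mem (run P w t) a \<le> X + t) \<and> reg (run P w t) 4 \<le> (t + 1) * (X + t)"
proof (induction t)
  case 0
  have "w ! a \<le> X" if "a < length w" for a
  proof -
    have "w ! a \<le> Max (insert 0 (set w))" using that by (intro Max_ge) auto
    then show ?thesis using assms(2) by (simp add: magnitude_def)
  qed
  moreover have "length w \<le> X" using assms(2) by (simp add: magnitude_def)
  ultimately show ?case by (simp add: run_def initial_def)
next
  case (Suc t)
  define s where "s = run P w t"
  have s': "run P w (Suc t) = step P s" by (simp add: run_def s_def)
  have s: "reg s 1 = 0" "reg s 2 \<le> 1" "\<And>r. r \<noteq> 4 \<Longrightarrow> reg s r \<le> X + t" "\<And>a. mem s a \<le> X + t"
    "reg s 4 \<le> (t + 1) * (X + t)"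
    using Suc.IH by (auto simp: s_def)
  have grow: "(t + 1) * (X + t) + (X + t) \<le> (Suc t + 1) * (X + Suc t)" by (simp add: algebra_simps)
  have le: "\<And>r. r \<noteq> 4 \<Longrightarrow> reg s r \<le> Suc (X + t)" "\<And>a. mem s a \<le> Suc (X + t)"
    using s(3,4) le_Suc_eq by blast+
  have r4: "reg s 4 \<le> (Suc t + 1) * (X + Suc t)" using s(5) grow by linarith
  show ?case
  proof (cases "halted P s")
    case True
    then show ?thesis using s(1,2) le r4 by (simp add: s' step_def)
  next
    case False
    define i where "i = P ! pc s"
    have i: "tame B i" using False assms(1) by (simp add: i_def halted_def)
    have s'': "run P w (Suc t) = exec i s" using False by (simp add: s' step_def i_def)
    show ?thesis
    proof (cases i)
      case (Const r c)
      then show ?thesis using i s(1,2) le r4 assms(2) unfolding s'' by auto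
    next
      case (Add r a b)
      show ?thesis
      proof (cases "r = 4")
        case True
        then have b: "reg s b \<le> X + t" using i Add s(3) by auto
        have "reg s a \<le> (t + 1) * (X + t)"
          using s(3)[of a] s(5) by (cases "a = 4") auto
        with b grow have "reg s a + reg s b \<le> (Suc t + 1) * (X + Suc t)" by linarith
        then show ?thesis using s(1,2) le unfolding s'' Add True by simp
      next
        case False
        then have "a \<noteq> 4" "b = 1 \<or> b = 2" "r \<noteq> 1" "r \<noteq> 2" using i Add by auto
        moreover have "reg s b \<le> 1" using s(1,2) \<open>b = 1 \<or> b = 2\<close> by auto
        ultimately have "reg s a + reg s b \<le> Suc (X + t)" using s(3)[of a] by linarith
        then show ?thesis using False s(1,2) le r4 \<open>r \<noteq> 1\<close> \<open>r \<noteq> 2\<close> unfolding s'' Add by simp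
      qed
    next
      case (Sub r a b)
      then have "reg s a - reg s b \<le> Suc (X + t)" using i le[of a] by (simp add: le_diff_conv)
      then show ?thesis using i s(1,2) le r4 Sub unfolding s'' by simp
    next
      case (Load r a)
      then show ?thesis using i s(1,2) le r4 unfolding s'' by simp
    next
      case (Store a r)
      then show ?thesis using i s(1,2) le r4 unfolding s'' by simp
    next
      case (JumpZero r l)
      then show ?thesis using s(1,2) le r4 unfolding s'' by simp
    qed
  qed
qed

lemma run_halted:
  assumes "halted P (run P w T)" "T \<le> t"
  shows "run P w t = run P w T"
  using assms(2)
proof (induction rule: dec_induct)
  case (step m)
  then show ?case using assms(1) by (simp add: run_def step_def)
qed simp

text \<open>After halting nothing changes, so only times up to \<open>T\<close> matter. For these,
  both factors of the bound on register 4 are at most \<open>(F + B + 1) * magnitude w\<close>,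
  which explains the squares.\<close>

lemma tame_values_bounded:
  assumes "\<forall>i\<in>set P. tame B i" "computes_within P w T v" "1 \<le> magnitude w" "T \<le> F * magnitude w"
  shows "values_bounded P w ((F + B + 1)\<^sup>2 * magnitude w ^ 2)"
proof -
  let ?m = "magnitude w"
  obtain t where t: "t \<le> T" "halted P (run P w t)" using assms(2) by (auto simp: computes_within_def)
  have bound: "(t' + 1) * (B + ?m + t') \<le> (F + B + 1)\<^sup>2 * ?m ^ 2" if "t' \<le> T" for t'
  proof -
    have B: "B \<le> B * ?m" using assms(3) by simp
    have "t' + 1 \<le> (F + B + 1) * ?m" "B + ?m + t' \<le> (F + B + 1) * ?m"
      using that assms(3,4) B by (simp_all add: algebra_simps; linarith)+
    then have "(t' + 1) * (B + ?m + t') \<le> ((F + B + 1) * ?m) * ((F + B + 1) * ?m)" by (rule mult_le_mono)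
    then show ?thesis by (simp add: power2_eq_square algebra_simps)
  qed
  have "reg (run P w u) i \<le> (F + B + 1)\<^sup>2 * ?m ^ 2 \<and> mem (run P w u) i \<le> (F + B + 1)\<^sup>2 * ?m ^ 2" for u i
  proof -
    define t' where "t' = min u t"
    have eq: "run P w u = run P w t'" using run_halted[OF t(2), of u]
    by (cases "u \<le> t") (simp_all add: t'_def)
    have t'T: "t' \<le> T" using t(1) by (simp add: t'_def)
    have R: "(\<forall>r. r \<noteq> 4 \<longrightarrow> reg (run P w t') r \<le> B + ?m + t') \<and> (\<forall>a. mem (run P w t') a \<le> B + ?m + t') \<and>
        reg (run P w t') 4 \<le> (t' + 1) * (B + ?m + t')"
      using tame_run[OF assms(1), of w "B + ?m" t'] assms(3) by simp
    have one: "B + ?m + t' \<le> (t' + 1) * (B + ?m + t')" by simp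
    show ?thesis
      unfolding eq using R one bound[OF t'T] by (cases "i = 4") (metis le_trans)+
  qed
  then show ?thesis by (simp add: values_bounded_def)
qed

section \<open>Weakest preconditions with running times\<close>

text \<open>Total correctness: an execution is asserted to exist, and its step count is handed to
  the postcondition. Existence is enough, because \<open>compile_correct\<close> turns the execution
  into the run of the machine.\<close>

definition wp :: "com \<Rightarrow> (nat \<Rightarrow> store \<Rightarrow> store \<Rightarrow> bool) \<Rightarrow> store \<Rightarrow> store \<Rightarrow> bool" where
  "wp c Q R M \<longleftrightarrow> (\<exists>t R' M'. ev c R M t R' M' \<and> Q t R' M')"

lemma wp_Do [simp]: "wp (Do b) Q R M = Q (length (code b)) (regs_after b R M) (mem_after b R M)"
  by (auto simp: wp_def intro: ev.Do elim: ev_DoE)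

lemma wp_Seq [simp]:
  "wp (c1 ;; c2) Q R M = wp c1 (\<lambda>t1 R1 M1. wp c2 (\<lambda>t2 R2 M2. Q (t1 + t2) R2 M2) R1 M1) R M"
  unfolding wp_def by (fastforce intro: ev.Seq elim!: ev_SeqE)

lemma wp_If [simp]:
  "wp (IfLess a b c1 c2) Q R M =
     (if R a < R b then wp c1 (\<lambda>t. Q (t + 3)) R M else wp c2 (\<lambda>t. Q (t + 2)) R M)"
proof (cases "R a < R b")
  case True
  then show ?thesis unfolding wp_def by (auto elim!: ev_IfE) (metis ev.IfTrue)+
next
  case False
  have "ev (IfLess a b c1 c2) R M t R' M' \<longleftrightarrow> (\<exists>t'. t = t' + 2 \<and> ev c2 R M t' R' M')" for t R' M'
    using False by (auto elim!: ev_IfE simp del: add_2_eq_Suc' intro!: ev.IfFalse)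
  with False show ?thesis unfolding wp_def by auto
qed

text \<open>The potential \<open>p\<close> bounds the remaining running time.\<close>

lemma wp_while:
  assumes "I R M"
    and body: "\<And>R M. I R M \<Longrightarrow> R a < R b \<Longrightarrow>
      wp c (\<lambda>t R' M'. t + 3 + p R' M' \<le> p R M \<and> I R' M') R M"
    and exit: "\<And>R' M' t. I R' M' \<Longrightarrow> \<not> R' a < R' b \<Longrightarrow> t + p R' M' \<le> p R M + 2 \<Longrightarrow> Q t R' M'"
  shows "wp (WhileLess a b c) Q R M"
proof -
  have "\<exists>t R' M'. ev (WhileLess a b c) R M t R' M' \<and> I R' M' \<and> \<not> R' a < R' b \<and>
      t + p R' M' \<le> p R M + 2"
    using assms(1)
  proof (induction "p R M" arbitrary: R M rule: less_induct)
    case less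
    show ?case
    proof (cases "R a < R b")
      case False
      have "ev (WhileLess a b c) R M 2 R M" by (rule ev.WhileFalse) (rule False)
      then show ?thesis using less.prems False by (metis add.commute order_refl)
    next
      case True
      obtain t1 R1 M1 where 1: "ev c R M t1 R1 M1" "t1 + 3 + p R1 M1 \<le> p R M" "I R1 M1"
        using body[OF less.prems True] unfolding wp_def by blast
      obtain t2 R2 M2 where 2: "ev (WhileLess a b c) R1 M1 t2 R2 M2" "I R2 M2"
          "\<not> R2 a < R2 b" "t2 + p R2 M2 \<le> p R1 M1 + 2"
        using less.hyps[of R1 M1] 1 by auto
      have "ev (WhileLess a b c) R M (t1 + 3 + t2) R2 M2" by (rule ev.WhileTrue[OF True 1(1) 2(1)])
      moreover have "t1 + 3 + t2 + p R2 M2 \<le> p R M + 2" using 1(2) 2(4) by linarith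
      ultimately show ?thesis using 2(2,3) by blast
    qed
  qed
  then show ?thesis unfolding wp_def using exit by blast
qed

section \<open>Building blocks\<close>

text \<open>
  Register \<open>rz\<close> is never written and hence 0. The memory holds the clauses below the address in
  \<open>rwork\<close>, scratch data between \<open>rwork\<close> and \<open>rbase\<close>, and the table of occurrences from \<open>rbase\<close> on.
\<close>

abbreviation (input) "rn \<equiv> 0::nat"
abbreviation (input) "rz \<equiv> 2::nat"
abbreviation (input) "rk \<equiv> 3::nat"
abbreviation (input) "rx \<equiv> 4::nat"
abbreviation (input) "ry \<equiv> 5::nat"
abbreviation (input) "rD \<equiv> 6::nat"
abbreviation (input) "rDm \<equiv> 7::nat"
abbreviation (input) "rN \<equiv> 8::nat"
abbreviation (input) "rwork \<equiv> 9::nat"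
abbreviation (input) "rbase \<equiv> 10::nat"
abbreviation (input) "rp \<equiv> 11::nat"
abbreviation (input) "rlen \<equiv> 12::nat"
abbreviation (input) "rc \<equiv> 13::nat"
abbreviation (input) "rj \<equiv> 14::nat"
abbreviation (input) "rv \<equiv> 15::nat"
abbreviation (input) "ri \<equiv> 16::nat"
abbreviation (input) "ru \<equiv> 17::nat"
abbreviation (input) "rres \<equiv> 18::nat"
abbreviation (input) "rrd \<equiv> 19::nat"
abbreviation (input) "rg \<equiv> 20::nat"
abbreviation (input) "rq \<equiv> 21::nat"
abbreviation (input) "re \<equiv> 22::nat"
abbreviation (input) "rpp \<equiv> 23::nat"
abbreviation (input) "ra \<equiv> 24::nat"
abbreviation (input) "rsat \<equiv> 25::nat"
abbreviation (input) "rh \<equiv> 26::nat"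
abbreviation (input) "rse \<equiv> 27::nat"
abbreviation (input) "rfl \<equiv> 28::nat"
abbreviation (input) "rt \<equiv> 29::nat"
abbreviation (input) "rs \<equiv> 30::nat"
abbreviation (input) "rs2 \<equiv> 31::nat"
abbreviation (input) "rv2 \<equiv> 32::nat"

definition holds :: "store \<Rightarrow> nat \<Rightarrow> nat list \<Rightarrow> bool" where
  "holds M p xs \<longleftrightarrow> (\<forall>i<length xs. M (p + i) = xs ! i)"

lemma holds_Nil [simp]: "holds M p []"
  by (simp add: holds_def)

lemma holds_Cons [simp]: "holds M p (x # xs) \<longleftrightarrow> M p = x \<and> holds M (Suc p) xs"
  by (auto simp: holds_def nth_Cons split: nat.splits)

lemma holds_append [simp]: "holds M p (xs @ ys) \<longleftrightarrow> holds M p xs \<and> holds M (p + length xs) ys"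
  by (induction xs arbitrary: p) auto

lemma holds_cong:
  "holds M p xs \<Longrightarrow> (\<And>i. p \<le> i \<Longrightarrow> i < p + length xs \<Longrightarrow> M' i = M i) \<Longrightarrow> holds M' p xs"
  by (auto simp: holds_def)

abbreviation "encode_literals ls \<equiv> concat (map encode_literal ls)"
abbreviation "encode_clauses cs \<equiv> concat (map encode_clause cs)"

fun sign :: "literal \<Rightarrow> nat" where
  "sign (Pos x) = 1"
| "sign (Neg x) = 0"

fun negate :: "literal \<Rightarrow> literal" where
  "negate (Pos x) = Neg x"
| "negate (Neg x) = Pos x"

lemma encode_literal_eq: "encode_literal l = [sign l, var_of l]"
  by (cases l) auto

lemma eq_negate_iff: "l = negate l' \<longleftrightarrow> var_of l = var_of l' \<and> sign l \<noteq> sign l'"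
  by (cases l; cases l') auto

lemma length_encode_literals [simp]: "length (encode_literals ls) = 2 * length ls"
  by (induction ls) (auto simp: encode_literal_eq)

lemma length_encode_clause [simp]: "length (encode_clause ls) = Suc (2 * length ls)"
  by (simp add: encode_clause_def)

lemma holds_literal:
  assumes "holds M p (encode_literals ls)" "i < length ls"
  shows "M (p + 2 * i) = sign (ls ! i)" "M (Suc (p + 2 * i)) = var_of (ls ! i)"
proof -
  have "holds M p (encode_literals (take i ls @ ls ! i # drop (Suc i) ls))"
    using assms by (simp add: id_take_nth_drop[symmetric])
  then show "M (p + 2 * i) = sign (ls ! i)" "M (Suc (p + 2 * i)) = var_of (ls ! i)"
    using assms(2) by (auto simp: encode_literal_eq)
qed

text \<open>Division by repeated subtraction: the lowest digit remains in \<open>ra\<close>, the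
  quotient is counted in \<open>rq\<close>. As only strict comparisons exist,
  \<open>rD \<le> ra\<close> is tested as \<open>rDm < ra\<close>, with \<open>rDm\<close> holding
  the predecessor of \<open>rD\<close>.\<close>

definition digit :: com where
  "digit = Do (Copy ra rq) ;; Do (Put rq 0) ;;
     WhileLess rDm ra (Do (Minus ra ra rD) ;; Do (Incr rq))"

lemma wp_digit:
  assumes "R rD = Suc (R rDm)"
    and "\<And>t. t \<le> 5 * R rq + 4 \<Longrightarrow> Q t (R(ra := R rq mod R rD, rq := R rq div R rD)) M"
  shows "wp digit Q R M"
  unfolding digit_def wp_Seq wp_Do
proof (rule wp_while[where p = "\<lambda>R' M'. 5 * (R rq div R rD - R' rq)" and
      I = "\<lambda>R' M'. M' = M \<and> R' rq \<le> R rq div R rD \<and> R' ra = R rq - R' rq * R rD \<and>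
        (\<forall>i. i \<notin> {ra, rq} \<longrightarrow> R' i = R i)"], goal_cases)
  case 1
  then show ?case by simp
next
  case (2 R' M')
  have "R rD \<le> R rq - R' rq * R rD" using 2 assms(1) by simp
  then have "Suc (R' rq) * R rD \<le> R rq" using assms(1) by simp
  then have "Suc (R' rq) \<le> R rq div R rD"
    using assms(1) by (simp only: less_eq_div_iff_mult_less_eq zero_less_Suc)
  then show ?case using 2(1) by auto
next
  case (3 R' M' t)
  have "R rq - R' rq * R rD < R rD" using 3 assms(1) by simp
  then have "R rq < Suc (R' rq) * R rD" using assms(1) by simp
  then have "R rq div R rD < Suc (R' rq)" using assms(1) by (simp only: div_less_iff_less_mult zero_less_Suc)
  then have q: "R' rq = R rq div R rD" using 3(1) by simp
  have "t \<le> 5 * (R rq div R rD) + 2" using 3(3) by simp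
  then have "t \<le> 5 * R rq + 2" using div_le_dividend[of "R rq" "R rD"] by linarith
  moreover have "R' = R(ra := R rq mod R rD, rq := R rq div R rD)"
    using 3(1) q by (auto simp: fun_eq_iff minus_div_mult_eq_mod)
  ultimately show ?case using assms(2)[of "t + 2"] 3(1) by simp
qed

text \<open>Two increments per round, because a literal occupies two cells, its sign and its
  variable.\<close>

definition advance :: "nat \<Rightarrow> nat \<Rightarrow> com" where
  "advance c j = WhileLess rz j (Do (Decr j) ;; Do (Incr c) ;; Do (Incr c))"

lemma wp_advance:
  assumes "R rz = 0" "c \<noteq> j" "c \<noteq> rz" "j \<noteq> rz"
    and "\<And>t. t \<le> 6 * R j + 2 \<Longrightarrow> Q t (R(c := R c + 2 * R j, j := 0)) M"
  shows "wp (advance c j) Q R M"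
  unfolding advance_def
proof (rule wp_while[where p = "\<lambda>R' M'. 6 * R' j" and
      I = "\<lambda>R' M'. M' = M \<and> R' c + 2 * R' j = R c + 2 * R j \<and> (\<forall>i. i \<notin> {c, j} \<longrightarrow> R' i = R i)"],
    goal_cases)
  case (2 R' M')
  then obtain m where "R' j = Suc m" using assms(1,3,4) by (cases "R' j") auto
  with 2 show ?case using assms(2-4) by auto
next
  case (3 R' M' t)
  then have "R' = R(c := R c + 2 * R j, j := 0)" using assms(1-4) by (auto simp: fun_eq_iff)
  with 3 show ?case using assms(5)[of t] by simp
qed auto

definition add_to :: "nat \<Rightarrow> nat \<Rightarrow> com" where
  "add_to c j = WhileLess rz j (Do (Decr j) ;; Do (Incr c))"

lemma wp_add_to:
  assumes "R rz = 0" "c \<noteq> j" "c \<noteq> rz" "j \<noteq> rz"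
    and "\<And>t. t \<le> 5 * R j + 2 \<Longrightarrow> Q t (R(c := R c + R j, j := 0)) M"
  shows "wp (add_to c j) Q R M"
  unfolding add_to_def
proof (rule wp_while[where p = "\<lambda>R' M'. 5 * R' j" and
      I = "\<lambda>R' M'. M' = M \<and> R' c + R' j = R c + R j \<and> (\<forall>i. i \<notin> {c, j} \<longrightarrow> R' i = R i)"],
    goal_cases)
  case (2 R' M')
  then obtain m where "R' j = Suc m" using assms(1,3,4) by (cases "R' j") auto
  with 2 show ?case using assms(2-4) by auto
next
  case (3 R' M' t)
  then have "R' = R(c := R c + R j, j := 0)" using assms(1-4) by (auto simp: fun_eq_iff)
  with 3 show ?case using assms(5)[of t] by simp
qed auto

definition multiply :: "nat \<Rightarrow> nat \<Rightarrow> nat \<Rightarrow> com" where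
  "multiply r a b = Do (Put r 0) ;; Do (Copy ri a) ;;
     WhileLess rz ri (Do (Decr ri) ;; Do (Copy rj b) ;; add_to r rj)"

lemma wp_multiply:
  assumes "R rz = 0" "r \<notin> {rz, ri, rj}" "a \<notin> {r, ri, rj}" "b \<notin> {r, ri, rj}"
    and "\<And>t R'. t \<le> R a * (5 * R b + 7) + 4 \<Longrightarrow> R' r = R a * R b \<Longrightarrow>
       (\<forall>i. i \<notin> {r, ri, rj} \<longrightarrow> R' i = R i) \<Longrightarrow> Q t R' M"
  shows "wp (multiply r a b) Q R M"
  unfolding multiply_def wp_Seq wp_Do
proof (rule wp_while[where p = "\<lambda>R' M'. R' ri * (5 * R b + 7)" and
      I = "\<lambda>R' M'. M' = M \<and> R' ri \<le> R a \<and> R' r + R' ri * R b = R a * R b \<and>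
        (\<forall>i. i \<notin> {r, ri, rj} \<longrightarrow> R' i = R i)"], goal_cases)
  case 1
  then show ?case using assms(2-4) by auto
next
  case (2 R' M')
  then have R': "R' rz = 0" "R' b = R b" using assms by auto
  obtain m where m: "R' ri = Suc m" using 2(2) R' by (cases "R' ri") auto
  show ?case
    unfolding wp_Seq wp_Do
  proof (rule wp_add_to, goal_cases)
    case (5 t)
    have "R' r + R b + m * R b = R a * R b" using 2(1) m by simp
    then show ?case using 5 2(1) m R' assms(2-4) by simp
  qed (use R' assms(2) in auto)
next
  case (3 R' M' t)
  then have "R' ri = 0" using assms by auto
  then show ?case using assms(5)[of "2 + t" R'] 3 assms(2-4) by (auto simp: numeral_eq_Suc)
qed

definition copy_cell :: com where
  "copy_cell = Do (Fetch ru rpp) ;; Do (Save re ru) ;; Do (Incr rpp) ;; Do (Incr re)"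

text \<open>A clause with more than \<open>rk\<close> literals is dropped after its length alone has
  been read. It cannot belong to a minimal unsatisfiable set of at most \<open>k + 1\<close> clauses
  (\<open>min_unsat_width\<close>), and copying it would take time not bounded in terms of
  \<open>k\<close>.\<close>

definition append :: com where
  "append = Do (Fetch rlen rpp) ;;
     IfLess rk rlen (Do Skip)
       (copy_cell ;; WhileLess rz rlen (Do (Decr rlen) ;; copy_cell ;; copy_cell))"

lemma wp_append:
  assumes z: "R rz = 0" and C: "holds M (R rpp) (encode_clause C)"
    and le: "R rpp + length (encode_clause C) \<le> R re"
    and Q: "\<And>t R' M' X. t \<le> 12 * R rk + 12 \<Longrightarrow> X = (if length C \<le> R rk then [C] else []) \<Longrightarrow>
      (\<forall>i. i \<notin> {rlen, ru, rpp, re} \<longrightarrow> R' i = R i) \<Longrightarrow> R' re = R re + length (encode_clauses X) \<Longrightarrow>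
      holds M' (R re) (encode_clauses X) \<Longrightarrow>
      (\<forall>i. \<not> (R re \<le> i \<and> i < R re + length (encode_clauses X)) \<longrightarrow> M' i = M i) \<Longrightarrow> Q t R' M'"
  shows "wp append Q R M"
proof (cases "length C \<le> R rk")
  case False
  have "M (R rpp) = length C" using C by (simp add: encode_clause_def)
  then show ?thesis
    using False Q[of 4 "[]" "R(rlen := length C)" M] by (simp add: append_def)
next
  case True
  define p0 e0 where "p0 = R rpp" and "e0 = R re"
  have len: "M p0 = length C" using C by (simp add: encode_clause_def p0_def)
  show ?thesis
    unfolding append_def copy_cell_def wp_Seq wp_Do wp_If
    apply (simp add: len[unfolded p0_def] not_less[THEN iffD2, OF True])
  proof (rule wp_while[where p = "\<lambda>R' M'. 12 * R' rlen" and
      I = "\<lambda>R' M'. (\<forall>i. i \<notin> {rlen, ru, rpp, re} \<longrightarrow> R' i = R i) \<and> p0 < R' rpp \<and>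
         R' re = e0 + (R' rpp - p0) \<and> R' rpp + 2 * R' rlen = p0 + length (encode_clause C) \<and>
         (\<forall>i. M' i = (if e0 \<le> i \<and> i < R' re then M (p0 + (i - e0)) else M i))"], goal_cases)
    case 1
    then show ?case using len by (auto simp: p0_def e0_def)
  next
    case (2 R' M')
    then obtain m where m: "R' rlen = Suc m" using z by (cases "R' rlen") auto
    have p: "R' rpp + 2 + 2 * m = p0 + length (encode_clause C)" using 2(1) m by simp
    \<comment> \<open>The source ends before the destination begins, so the cells still to be copied
      have not been overwritten.\<close>
    have lt: "Suc (R' rpp) < e0" using p le by (simp add: p0_def e0_def)
    have eqs: "M' (R' rpp) = M (R' rpp)" "M' (Suc (R' rpp)) = M (Suc (R' rpp))"
      using 2(1) lt by auto
    have ge: "e0 < R' re" "p0 < R' rpp" "R' re = e0 + (R' rpp - p0)" using 2(1) by auto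
    show ?case
      using 2(1) m p lt eqs ge by (auto simp: less_Suc_eq)
  next
    case (3 R' M' t)
    then have l0: "R' rlen = 0" using z by auto
    then have re: "R' re = e0 + length (encode_clause C)" using 3(1) by auto
    have "holds M' e0 (encode_clause C)"
      using C 3(1) re unfolding holds_def p0_def[symmetric] by auto
    moreover have "\<forall>i. \<not> (e0 \<le> i \<and> i < e0 + length (encode_clause C)) \<longrightarrow> M' i = M i"
      using 3(1) unfolding re[symmetric] by (metis (no_types, lifting))
    moreover have "\<forall>i. i \<notin> {rlen, ru, rpp, re} \<longrightarrow> R' i = R i" using 3(1) by blast
    moreover have "t \<le> 12 * R rk + 2" using 3(3) True len p0_def by (simp add: p0_def)
    ultimately show ?case
      using re True by (intro Q[of _ "[C]"]) (simp_all add: e0_def)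
  qed
qed

section \<open>Testing satisfiability of a short list of clauses\<close>

text \<open>Equality of variables and inequality of signs are each expressed by two strict
  comparisons. The flag \<open>rfl\<close> is only ever cleared, so a conflict is remembered while
  the scan continues.\<close>

definition compare :: com where
  "compare = Do (Copy rt re) ;;
     WhileLess rt rse
       (Do (Fetch rs2 rt) ;; Do (Incr rt) ;; Do (Fetch rv2 rt) ;; Do (Incr rt) ;;
        IfLess rv rv2 (Do Skip) (IfLess rv2 rv (Do Skip)
          (IfLess rs rs2 (Do (Put rfl 0)) (IfLess rs2 rs (Do (Put rfl 0)) (Do Skip)))))"

lemma wp_compare:
  assumes S: "holds M (R re) (encode_literals S)" "R rse = R re + 2 * length S"
    and l: "R rs = sign l" "R rv = var_of l"
    and Q: "\<And>t R'. t \<le> 40 * length S + 3 \<Longrightarrow> (\<forall>i. i \<notin> {rt, rs2, rv2, rfl} \<longrightarrow> R' i = R i) \<Longrightarrow>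
      R' rfl = (if negate l \<in> set S then 0 else R rfl) \<Longrightarrow> Q t R' M"
  shows "wp compare Q R M"
  unfolding compare_def wp_Seq wp_Do
proof (rule wp_while[where p = "\<lambda>R' M'. 20 * (R' rse - R' rt)" and
    I = "\<lambda>R' M'. M' = M \<and> (\<forall>i. i \<notin> {rt, rs2, rv2, rfl} \<longrightarrow> R' i = R i) \<and>
      (\<exists>m \<le> length S. R' rt = R re + 2 * m \<and> R' rfl = (if negate l \<in> set (take m S) then 0 else R rfl))"],
    goal_cases)
  case 1
  then show ?case by auto
next
  case (2 R' M')
  then obtain m where m: "m \<le> length S" "R' rt = R re + 2 * m"
    "R' rfl = (if negate l \<in> set (take m S) then 0 else R rfl)" by blast
  have lt: "m < length S" using 2 m(2) S(2) by simp
  have cells: "M (R re + 2 * m) = sign (S ! m)" "M (Suc (R re + 2 * m)) = var_of (S ! m)"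
    using holds_literal[OF S(1) lt] by simp_all
  have t: "take (Suc m) S = take m S @ [S ! m]" using lt by (simp add: take_Suc_conv_app_nth)
  have neg: "negate l = S ! m \<longleftrightarrow> var_of (S ! m) = var_of l \<and> sign (S ! m) \<noteq> sign l"
    using eq_negate_iff[of "S ! m" l] by auto
  have R': "R' rs = sign l" "R' rv = var_of l" "R' rse = R re + 2 * length S" "M' = M"
    using 2(1) S(2) l by auto
  show ?case
    using 2(1) lt by (auto simp: m(2,3) cells R' t neg intro!: exI[of _ "Suc m"])
next
  case (3 R' M' t)
  then obtain m where m: "m \<le> length S" "R' rt = R re + 2 * m"
    "R' rfl = (if negate l \<in> set (take m S) then 0 else R rfl)" by blast
  then have "m = length S" using 3 S(2) by simp
  moreover have "M' = M" using 3(1) by blast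
  ultimately show ?case using 3 m S(2) Q[of "1 + t" R'] by simp
qed

text \<open>
  The digits of \<open>q\<close> in base \<open>D\<close> select one literal of each clause; \<open>S\<close> collects the selected literals.
\<close>

fun choice :: "nat \<Rightarrow> nat \<Rightarrow> literal list list \<Rightarrow> literal list \<Rightarrow> bool" where
  "choice D q [] S = True"
| "choice D q (C # \<psi>) S = (q mod D < length C \<and> negate (C ! (q mod D)) \<notin> set S \<and>
     choice D (q div D) \<psi> (S @ [C ! (q mod D)]))"

text \<open>Failure does not abort the pass: it only clears \<open>rfl\<close>, and
  \<open>rc\<close> still moves to the next clause. The selection may then go on collecting
  meaningless literals, which a cleared flag makes irrelevant.\<close>

definition clause_step :: com where
  "clause_step = digit ;; Do (Fetch rlen rc) ;; Do (Incr rc) ;;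
     IfLess ra rlen
       (Do (Copy rt rc) ;; advance rt ra ;; Do (Fetch rs rt) ;; Do (Incr rt) ;; Do (Fetch rv rt) ;;
        compare ;; Do (Save rse rs) ;; Do (Incr rse) ;; Do (Save rse rv) ;; Do (Incr rse))
       (Do (Put rfl 0)) ;;
     advance rc rlen"

abbreviation "clause_regs \<equiv> {ra, rq, rlen, rc, rt, rs, rv, rse, rfl, rs2, rv2} :: nat set"

lemma wp_clause_step:
  assumes z: "R rz = 0" and D: "R rD = Suc (R rDm)"
    and C: "holds M (R rc) (encode_clause C)" "R rc + length (encode_clause C) \<le> R re"
    and S: "holds M (R re) (encode_literals S)" "R rse = R re + 2 * length S"
    and Q: "\<And>t R' M' S'. t \<le> 5 * R rq + 12 * length C + 40 * length S + 40 \<Longrightarrow>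
      S' = (if R rq mod R rD < length C then S @ [C ! (R rq mod R rD)] else S) \<Longrightarrow>
      (\<forall>i. i \<notin> clause_regs \<longrightarrow> R' i = R i) \<Longrightarrow>
      R' rq = R rq div R rD \<Longrightarrow> R' rc = R rc + length (encode_clause C) \<Longrightarrow>
      holds M' (R re) (encode_literals S') \<Longrightarrow> R' rse = R re + 2 * length S' \<Longrightarrow>
      R' rfl = (if R rq mod R rD < length C \<and> negate (C ! (R rq mod R rD)) \<notin> set S then R rfl else 0) \<Longrightarrow>
      (\<forall>i. i \<noteq> R rse \<longrightarrow> i \<noteq> Suc (R rse) \<longrightarrow> M' i = M i) \<Longrightarrow> Q t R' M'"
  shows "wp clause_step Q R M"
proof -
  define a where "a = R rq mod R rD"
  have len: "M (R rc) = length C" and lits: "holds M (Suc (R rc)) (encode_literals C)"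
    using C(1) by (auto simp: encode_clause_def)
  show ?thesis
    unfolding clause_step_def wp_Seq
  proof (rule wp_digit, fact, goal_cases)
    case (1 t1)
    show ?case
    proof (cases "a < length C")
      case False
      show ?thesis
        using False z 1 S
        by (simp add: len a_def[symmetric]) (rule wp_advance; (intro Q[of _ S])?; simp add: a_def)
    next
      case True
      have cell: "M (Suc (R rc + 2 * a)) = sign (C ! a)" "M (Suc (Suc (R rc + 2 * a))) = var_of (C ! a)"
        using holds_literal[OF lits True] by simp_all
      show ?thesis
        apply (simp add: len a_def[symmetric] True)
      proof (rule wp_advance, goal_cases)
        case (5 t2)
        show ?case
          apply (simp add: cell)
        proof (rule wp_compare[where S = S and l = "C ! a"], goal_cases)
          case (5 t3 R3)
          let ?M' = "M(R re + 2 * length S := sign (C ! a), Suc (R re + 2 * length S) := var_of (C ! a))"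
          have lits': "holds ?M' (R re) (encode_literals (S @ [C ! a]))"
            using S by (auto simp: encode_literal_eq intro: holds_cong)
          have R3: "R3 rse = R re + 2 * length S" "R3 rs = sign (C ! a)" "R3 rv = var_of (C ! a)"
            "R3 rc = Suc (R rc)" "R3 rlen = length C" "R3 rz = 0" "R3 rq = R rq div R rD"
            using 5(2) S(2) z by auto
          show ?case
            apply (simp add: R3)
          proof (rule wp_advance, goal_cases)
            case (5 t4)
            show ?case
              using 1 True \<open>t2 \<le> _\<close> \<open>t3 \<le> _\<close> 5 \<open>\<forall>i. i \<notin> _ \<longrightarrow> R3 i = _ i\<close> \<open>R3 rfl = _\<close> R3 lits' S(2)
              by (intro Q[of _ "S @ [C ! a]"]) (simp_all add: a_def[symmetric])
          qed (use R3 in auto)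
        qed (use S in auto)
      qed (use z in auto)
    qed
  qed
qed


lemma length_le_encode_clauses: "length \<psi> \<le> length (encode_clauses \<psi>)"
  by (induction \<psi>) auto

lemma length_encode_clauses_le:
  "(\<forall>C\<in>set \<psi>. length C \<le> k) \<Longrightarrow> length (encode_clauses \<psi>) \<le> length \<psi> * (2 * k + 1)"
  by (induction \<psi>) (auto simp: algebra_simps)

text \<open>The selected literals are written directly behind the clauses, from \<open>re\<close>
  on. Success sets \<open>rsat\<close> and failure leaves it alone, so that the results accumulate
  over the loop of \<open>sat_test\<close>.\<close>

definition check :: com where
  "check = Do (Copy rq rh) ;; Do (Copy rc rwork) ;; Do (Copy rse re) ;; Do (Put rfl 1) ;;
     WhileLess rc re clause_step ;; IfLess rz rfl (Do (Put rsat 1)) (Do Skip)"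

lemma wp_check:
  assumes z: "R rz = 0" and D: "R rD = Suc (R rDm)"
    and \<psi>: "holds M (R rwork) (encode_clauses \<psi>)" "R re = R rwork + length (encode_clauses \<psi>)"
    and W: "R rh \<le> W" "length (encode_clauses \<psi>) \<le> W"
    and Q: "\<And>t R' M'. t \<le> (60 * W + 43) * W + 15 \<Longrightarrow>
      (\<forall>i. i \<notin> insert rsat clause_regs \<longrightarrow> R' i = R i) \<Longrightarrow>
      R' rsat = (if choice (R rD) (R rh) \<psi> [] then 1 else R rsat) \<Longrightarrow>
      (\<forall>i. \<not> (R re \<le> i \<and> i < R re + 2 * length \<psi>) \<longrightarrow> M' i = M i) \<Longrightarrow> Q t R' M'"
  shows "wp check Q R M"
  unfolding check_def wp_Seq wp_Do
\<comment> \<open>The invariant splits the clauses into a processed part and a rest: the original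
  choice succeeds iff the flag is still 1 and the remaining digits succeed on the rest, starting
  from the literals selected so far.\<close>
proof (rule wp_while[where p = "\<lambda>R' M'. (60 * W + 43) * (R' re - R' rc)" and
    I = "\<lambda>R' M'. (\<forall>i. i \<notin> clause_regs \<longrightarrow> R' i = R i) \<and> R' rq \<le> R rh \<and>
      (\<forall>i. \<not> (R re \<le> i \<and> i < R re + 2 * length \<psi>) \<longrightarrow> M' i = M i) \<and>
      (\<exists>\<psi>1 \<psi>2 S. \<psi> = \<psi>1 @ \<psi>2 \<and> R' rc = R rwork + length (encode_clauses \<psi>1) \<and>
        length S \<le> length \<psi>1 \<and> R' rse = R re + 2 * length S \<and> holds M' (R re) (encode_literals S) \<and>
        (R' rfl = 0 \<or> R' rfl = 1) \<and>
        (choice (R rD) (R rh) \<psi> [] \<longleftrightarrow> R' rfl = 1 \<and> choice (R rD) (R' rq) \<psi>2 S))"], goal_cases)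
  case 1
  show ?case
    by (intro conjI; (rule exI[of _ "[]"], rule exI[of _ \<psi>], rule exI[of _ "[]"])?) (use \<psi> in auto)
next
  case (2 R' M')
  then obtain \<psi>1 \<psi>2 S where I: "\<psi> = \<psi>1 @ \<psi>2" "R' rc = R rwork + length (encode_clauses \<psi>1)"
    "length S \<le> length \<psi>1" "R' rse = R re + 2 * length S" "holds M' (R re) (encode_literals S)"
    "R' rfl = 0 \<or> R' rfl = 1"
    "choice (R rD) (R rh) \<psi> [] \<longleftrightarrow> R' rfl = 1 \<and> choice (R rD) (R' rq) \<psi>2 S" by blast
  have R': "R' re = R re" "R' rz = 0" "R' rD = R rD" "R' rDm = R rDm" "R' rq \<le> R rh" using 2(1) z by auto
  have M': "\<And>i. \<not> (R re \<le> i \<and> i < R re + 2 * length \<psi>) \<Longrightarrow> M' i = M i" using 2(1) by blast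
  obtain C \<psi>3 where C: "\<psi>2 = C # \<psi>3" using 2(2) I(1,2) R'(1) \<psi>(2) by (cases \<psi>2) auto
  have holds: "holds M' (R' rc) (encode_clause C)"
    using \<psi> I(1,2) C by (auto intro!: holds_cong[of M] M' )
  have le: "R' rc + length (encode_clause C) \<le> R re" using I(1,2) C \<psi>(2) by simp
  have len: "length C \<le> W" "length S \<le> W" "length S < length \<psi>"
    using W(2) I(1,3) C length_le_encode_clauses[of \<psi>1] by auto
  show ?case
  proof (rule wp_clause_step[where S = S and C = C], goal_cases)
    case (7 t R2 M2 S2)
    have "60 * W + 43 \<ge> t + 3"
      using 7(1) len(1,2) R'(5) W(1) by linarith
    moreover have "R2 re = R re" "R2 rc = R' rc + length (encode_clause C)" using 7 R' by auto
    moreover have "Suc (R re - R2 rc) \<le> R re - R' rc" using le \<open>R2 rc = _\<close> by simp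
    then have "(60 * W + 43) * Suc (R re - R2 rc) \<le> (60 * W + 43) * (R re - R' rc)"
      by (rule mult_le_mono2)
    ultimately have t: "t + 3 + (60 * W + 43) * (R2 re - R2 rc) \<le> (60 * W + 43) * (R' re - R' rc)"
      by (simp add: R'(1))
    have frame: "\<forall>i. i \<notin> clause_regs \<longrightarrow> R2 i = R i" using 7(3) 2(1) by auto
    have mem: "\<forall>i. \<not> (R re \<le> i \<and> i < R re + 2 * length \<psi>) \<longrightarrow> M2 i = M i"
      using 7(9) M' I(4) len(3) by auto
    have q: "R2 rq \<le> R rh" using 7(4) R'(5) div_le_dividend order_trans by metis
    have "length S2 \<le> length (\<psi>1 @ [C])" using 7(2) I(3) by auto
    moreover have "choice (R rD) (R rh) \<psi> [] \<longleftrightarrow> R2 rfl = 1 \<and> choice (R rD) (R2 rq) \<psi>3 S2"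
      using I(6,7) 7(2,4,8) by (auto simp: C R'(3))
    moreover have "R2 rfl = 0 \<or> R2 rfl = 1" using I(6) 7(8) by auto
    ultimately have "\<exists>\<psi>1 \<psi>2 S. \<psi> = \<psi>1 @ \<psi>2 \<and> R2 rc = R rwork + length (encode_clauses \<psi>1) \<and>
        length S \<le> length \<psi>1 \<and> R2 rse = R re + 2 * length S \<and> holds M2 (R re) (encode_literals S) \<and>
        (R2 rfl = 0 \<or> R2 rfl = 1) \<and>
        (choice (R rD) (R rh) \<psi> [] \<longleftrightarrow> R2 rfl = 1 \<and> choice (R rD) (R2 rq) \<psi>2 S)"
      using I(1,2) C 7(5,6,7) R'(1)
      by (intro exI[of _ "\<psi>1 @ [C]"] exI[of _ \<psi>3] exI[of _ S2]) auto
    then show ?case using t frame mem q by blast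
  qed (use R' D holds le I in auto)
next
  case (3 R' M' t)
  then obtain \<psi>1 \<psi>2 S where I: "\<psi> = \<psi>1 @ \<psi>2" "R' rc = R rwork + length (encode_clauses \<psi>1)"
    "R' rfl = 0 \<or> R' rfl = 1"
    "choice (R rD) (R rh) \<psi> [] \<longleftrightarrow> R' rfl = 1 \<and> choice (R rD) (R' rq) \<psi>2 S" by blast
  have R': "R' re = R re" "R' rz = 0" "R' rsat = R rsat" using 3(1) z by auto
  have "length \<psi>2 \<le> length (encode_clauses \<psi>2)" by (rule length_le_encode_clauses)
  also have "\<dots> = 0" using 3(2) I(1,2) R'(1) \<psi>(2) by simp
  finally have "\<psi>2 = []" by simp
  then have choice: "choice (R rD) (R rh) \<psi> [] \<longleftrightarrow> R' rfl = 1" using I(4) by simp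
  have "R re - R' rc = 0" using 3(2) R'(1) by simp
  then have "t \<le> (60 * W + 43) * (R re - R rwork) + 2" using 3(3) R'(1) by simp
  also have "\<dots> \<le> (60 * W + 43) * W + 2" using \<psi>(2) W(2) by (intro add_mono mult_le_mono) auto
  finally have t: "t \<le> (60 * W + 43) * W + 2" .
  have frame: "\<forall>i. i \<notin> clause_regs \<longrightarrow> R' i = R i"
    and mem: "\<forall>i. \<not> (R re \<le> i \<and> i < R re + 2 * length \<psi>) \<longrightarrow> M' i = M i"
    using 3(1) by blast+
  show ?case
  proof (cases "R' rfl = 1")
    case True
    then show ?thesis using t choice frame mem R'(2) by (simp, intro Q) auto
  next
    case False
    then have "R' rfl = 0" using I(3) by blast
    then show ?thesis using t choice frame mem R'(2,3) by (simp, intro Q) auto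
  qed
qed

text \<open>The fixed range \<open>h < N\<close> spares computing the number of choices for each
  candidate; larger numbers merely repeat selections, as surplus digits are ignored.\<close>

definition sat_test :: com where
  "sat_test = Do (Put rsat 0) ;; Do (Copy rh rN) ;; WhileLess rz rh (Do (Decr rh) ;; check)"

abbreviation "test_regs \<equiv> {rsat, rh} \<union> clause_regs"

lemma wp_sat_test:
  assumes z: "R rz = 0" and D: "R rD = Suc (R rDm)"
    and \<psi>: "holds M (R rwork) (encode_clauses \<psi>)" "R re = R rwork + length (encode_clauses \<psi>)"
    and W: "length (encode_clauses \<psi>) \<le> R rN"
    and Q: "\<And>t R' M'. t \<le> ((60 * R rN + 43) * R rN + 19) * R rN + 4 \<Longrightarrow>
      (\<forall>i. i \<notin> test_regs \<longrightarrow> R' i = R i) \<Longrightarrow>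
      R' rsat = (if \<exists>h<R rN. choice (R rD) h \<psi> [] then 1 else 0) \<Longrightarrow>
      (\<forall>i. \<not> (R re \<le> i \<and> i < R re + 2 * length \<psi>) \<longrightarrow> M' i = M i) \<Longrightarrow> Q t R' M'"
  shows "wp sat_test Q R M"
  unfolding sat_test_def wp_Seq wp_Do
proof (rule wp_while[where p = "\<lambda>R' M'. ((60 * R rN + 43) * R rN + 19) * R' rh" and
    I = "\<lambda>R' M'. (\<forall>i. i \<notin> test_regs \<longrightarrow> R' i = R i) \<and> R' rh \<le> R rN \<and>
      R' rsat = (if \<exists>h<R rN. R' rh \<le> h \<and> choice (R rD) h \<psi> [] then 1 else 0) \<and>
      (\<forall>i. \<not> (R re \<le> i \<and> i < R re + 2 * length \<psi>) \<longrightarrow> M' i = M i)"], goal_cases)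
  case 1
  show ?case by auto
next
  case (2 R' M')
  have R': "R' rz = 0" "R' rD = R rD" "R' rDm = R rDm" "R' re = R re" "R' rwork = R rwork" using 2(1) z by auto
  obtain h where h: "R' rh = Suc h" using 2(2) R' by (cases "R' rh") auto
  have M': "\<And>i. \<not> (R re \<le> i \<and> i < R re + 2 * length \<psi>) \<Longrightarrow> M' i = M i" using 2(1) by blast
  have holds: "holds M' (R rwork) (encode_clauses \<psi>)" by (rule holds_cong[OF \<psi>(1)]) (simp add: M' \<psi>(2))
  have hN: "h < R rN" using 2(1) h by auto
  have range: "(\<exists>h'<R rN. h \<le> h' \<and> P h') \<longleftrightarrow> P h \<or> (\<exists>h'<R rN. Suc h \<le> h' \<and> P h')" for P
    using hN by (auto simp: Suc_le_eq le_less)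
  show ?case
    unfolding wp_Seq wp_Do
  proof (rule wp_check[where \<psi> = \<psi> and W = "R rN"], goal_cases)
    case (7 t R2 M2)
    have "R2 rh = h" using 7(2) h by auto
    moreover have "R2 rsat = (if \<exists>h'<R rN. h \<le> h' \<and> choice (R rD) h' \<psi> [] then 1 else 0)"
      using 7(3) h 2(1) R' by (auto simp: range)
    ultimately show ?case using 7 2(1) h R' by auto
  qed (use R' D \<psi> holds W hN h in auto)
next
  case (3 R' M' t)
  then have "R' rh = 0" using z by auto
  then show ?case using 3 Q[of "2 + t" R' M'] by auto
qed

section \<open>Enumerating clause sets\<close>

text \<open>
  The digit \<open>b\<close> selects a cell in the encoding of the clauses chosen so far; its content \<open>v\<close> is meant
  to be a variable, and \<open>a\<close> selects a clause containing \<open>v\<close> by means of the occurrence table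
  \<open>tab\<close>, whose row \<open>v\<close> starts at \<open>m * v\<close>. The value 0 marks unused entries of the table.
\<close>

definition extend ::
  "nat \<Rightarrow> nat \<Rightarrow> (nat \<Rightarrow> nat) \<Rightarrow> (nat \<Rightarrow> literal list) \<Rightarrow> nat \<Rightarrow> nat \<Rightarrow> literal list list \<Rightarrow> literal list list" where
  "extend m k tab cl b a \<psi> =
    (let E = encode_clauses \<psi>; p = tab (m * E ! b + a)
     in if b < length E \<and> p \<noteq> 0 \<and> length (cl p) \<le> k then \<psi> @ [cl p] else \<psi>)"

text \<open>Every round consumes two digits, the lower one for the cell and the upper one for the
  column, whether or not a clause is added. Idle rounds make it possible to reach smaller clause
  sets with the same number of rounds.\<close>

fun chain ::
  "nat \<Rightarrow> nat \<Rightarrow> nat \<Rightarrow> (nat \<Rightarrow> nat) \<Rightarrow> (nat \<Rightarrow> literal list) \<Rightarrow> nat \<Rightarrow> nat \<Rightarrow> literal list list \<Rightarrow> literal list list" where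
  "chain m D k tab cl 0 q \<psi> = \<psi>"
| "chain m D k tab cl (Suc r) q \<psi> =
     chain m D k tab cl r (q div D div D) (extend m k tab cl (q mod D) (q div D mod D) \<psi>)"

text \<open>\<open>V\<close> is the set of addresses of clauses. The last conjunct makes every
  lookup safe: whatever number serves as a variable, and even if the column runs into another row,
  the result is 0 or the address of a clause.\<close>

definition layout :: "store \<Rightarrow> nat \<Rightarrow> nat \<Rightarrow> (nat \<Rightarrow> nat) \<Rightarrow> (nat \<Rightarrow> literal list) \<Rightarrow> nat set \<Rightarrow> bool" where
  "layout M work base tab cl V \<longleftrightarrow> work \<le> base \<and> (\<forall>j. M (base + j) = tab j) \<and>
     (\<forall>p\<in>V. holds M p (encode_clause (cl p)) \<and> p + length (encode_clause (cl p)) \<le> work) \<and>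
     (\<forall>j. tab j \<noteq> 0 \<longrightarrow> tab j \<in> V)"

lemma layout_cong:
  assumes "layout M work base tab cl V" "\<And>i. i < work \<or> base \<le> i \<Longrightarrow> M' i = M i"
  shows "layout M' work base tab cl V"
proof -
  have "holds M' p (encode_clause (cl p))" if "p \<in> V" for p
  proof (rule holds_cong)
    show "holds M p (encode_clause (cl p))" using assms(1) that unfolding layout_def by blast
    have "p + length (encode_clause (cl p)) \<le> work" using assms(1) that unfolding layout_def by blast
    then show "M' i = M i" if "i < p + length (encode_clause (cl p))" for i
      using that by (intro assms(2)) linarith
  qed
  moreover have "M' (base + j) = M (base + j)" for j by (intro assms(2)) simp
  ultimately show ?thesis using assms(1) by (simp add: layout_def)
qed

definition extension :: "nat \<Rightarrow> com" where
  "extension m = digit ;; Do (Copy rc rwork) ;; add_to rc ra ;; digit ;;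
     IfLess rc re
       (Do (Fetch rv rc) ;; Do (FetchAt m rpp rbase rv ra) ;; IfLess rz rpp append (Do Skip))
       (Do Skip)"

abbreviation "append_regs \<equiv> {rlen, ru, rpp, re} :: nat set"
abbreviation "extension_regs \<equiv> {ra, rq, rc, rv} \<union> append_regs"

lemma wp_extension:
  assumes z: "R rz = 0" and D: "R rD = Suc (R rDm)"
    and L: "layout M (R rwork) (R rbase) tab cl V"
    and \<psi>: "holds M (R rwork) (encode_clauses \<psi>)" "R re = R rwork + length (encode_clauses \<psi>)"
    and room: "R re + (2 * R rk + 1) \<le> R rbase"
    and Q: "\<And>t R' M' \<psi>'. t \<le> 15 * R rq + 12 * R rk + m + 50 \<Longrightarrow>
      \<psi>' = extend m (R rk) tab cl (R rq mod R rD) (R rq div R rD mod R rD) \<psi> \<Longrightarrow>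
      (\<forall>i. i \<notin> extension_regs \<longrightarrow> R' i = R i) \<Longrightarrow> R' rq = R rq div R rD div R rD \<Longrightarrow>
      holds M' (R rwork) (encode_clauses \<psi>') \<Longrightarrow> R' re = R rwork + length (encode_clauses \<psi>') \<Longrightarrow>
      (\<forall>i. \<not> (R rwork \<le> i \<and> i < R rbase) \<longrightarrow> M' i = M i) \<Longrightarrow> Q t R' M'"
  shows "wp (extension m) Q R M"
proof -
  define b a where "b = R rq mod R rD" and "a = R rq div R rD mod R rD"
  define E where "E = encode_clauses \<psi>"
  have le: "b \<le> R rq" "R rq div R rD \<le> R rq" by (auto simp: b_def)
  show ?thesis
    unfolding extension_def wp_Seq
  proof (rule wp_digit, fact, simp, rule wp_add_to, goal_cases)
    case (5 t1 t2)
    show ?case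
    proof (rule wp_digit, goal_cases)
      case 1
      then show ?case using D by simp
    next
      case (2 t3)
      have t: "t1 + t2 + t3 \<le> 15 * R rq + 10"
      proof -
        have "t1 \<le> 5 * R rq + 4" "t2 \<le> 5 * b + 2" "t3 \<le> 5 * (R rq div R rD) + 4"
          using 5 2 by (simp_all add: b_def)
        then show ?thesis using le by linarith
      qed
      show ?case
      proof (cases "b < length E")
        case False
        then have "extend m (R rk) tab cl b a \<psi> = \<psi>" by (auto simp: extend_def E_def Let_def)
        then show ?thesis
          using False t \<psi>
          by (simp add: b_def[symmetric] a_def[symmetric] E_def) (rule Q, auto simp: b_def[symmetric] a_def[symmetric])
      next
        case True
        define p where "p = tab (m * E ! b + a)"
        have v: "M (R rwork + b) = E ! b" using \<psi>(1) True by (auto simp: holds_def E_def)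
        have p: "M (R rbase + m * E ! b + a) = p"
          using L by (auto simp: layout_def p_def add.assoc)
        have lt: "R rwork + b < R re" using True \<psi>(2) by (simp add: E_def)
        show ?thesis
        proof (cases "p = 0")
          case True
          then have "extend m (R rk) tab cl b a \<psi> = \<psi>" by (auto simp: extend_def E_def Let_def p_def)
          then show ?thesis
            using True t \<psi> lt
            by (simp add: b_def[symmetric] a_def[symmetric] v p) (rule Q, auto simp: b_def[symmetric] a_def[symmetric])
        next
          case False
          then have pV: "p \<in> V" using L by (auto simp: layout_def p_def)
          have C: "holds M p (encode_clause (cl p))" "p + length (encode_clause (cl p)) \<le> R rwork"
            using L pV unfolding layout_def by blast+
          show ?thesis
            using False lt z apply (simp add: b_def[symmetric] a_def[symmetric] v p)
          proof (rule wp_append[where C = "cl p"], goal_cases)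
            case (4 t4 R4 M4 X)
            have ext: "extend m (R rk) tab cl b a \<psi> = \<psi> @ X"
              using False True 4(5) by (auto simp: extend_def Let_def p_def E_def)
            have X: "length (encode_clauses X) \<le> 2 * R rk + 1" using 4(5) by auto
            have M4: "\<And>i. \<not> (R re \<le> i \<and> i < R re + length (encode_clauses X)) \<Longrightarrow> M4 i = M i"
              using 4(9) by simp
            have "holds M4 (R rwork) (encode_clauses \<psi>)"
              by (rule holds_cong[OF \<psi>(1)]) (simp add: M4 \<psi>(2))
            moreover have "\<forall>i. \<not> (R rwork \<le> i \<and> i < R rbase) \<longrightarrow> M4 i = M i"
              using M4 X room \<psi>(2) by auto
            ultimately show ?case
              using t 4 \<psi>(2) ext by (intro Q[of _ "\<psi> @ X"]) (auto simp: b_def[symmetric] a_def[symmetric])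
          qed (use C \<psi>(2) z in auto)
        qed
      qed
    qed
  qed (use z in auto)
qed

definition build :: "nat \<Rightarrow> com" where
  "build m = Do (Copy rq rg) ;; Do (Copy re rwork) ;; Do (Copy rpp rp) ;; append ;;
     Do (Copy ri rrd) ;; WhileLess rz ri (Do (Decr ri) ;; extension m)"

abbreviation "build_regs \<equiv> insert ri extension_regs"

lemma extend_bounds:
  assumes "\<forall>C\<in>set \<psi>. length C \<le> k"
  shows "(\<forall>C\<in>set (extend m k tab cl b a \<psi>). length C \<le> k) \<and> length (extend m k tab cl b a \<psi>) \<le> Suc (length \<psi>)"
  using assms by (auto simp: extend_def Let_def)

lemma chain_bounds:
  assumes "\<forall>C\<in>set \<psi>. length C \<le> k"
  shows "(\<forall>C\<in>set (chain m D k tab cl r q \<psi>). length C \<le> k) \<and> length (chain m D k tab cl r q \<psi>) \<le> length \<psi> + r"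
  using assms
proof (induction r arbitrary: q \<psi>)
  case (Suc r)
  define \<psi>1 where "\<psi>1 = extend m k tab cl (q mod D) (q div D mod D) \<psi>"
  have "\<forall>C\<in>set \<psi>1. length C \<le> k" "length \<psi>1 \<le> Suc (length \<psi>)"
    using extend_bounds[OF Suc.prems] by (simp_all add: \<psi>1_def)
  then show ?case
    using Suc.IH[of \<psi>1 "q div D div D"] by (simp add: \<psi>1_def[symmetric])
qed simp

text \<open>The space required by \<open>room\<close> is that of \<open>k + 1\<close> clauses of at
  most \<open>2 * k + 1\<close> cells: the starting clause and one clause for each of at most
  \<open>k\<close> rounds.\<close>

lemma wp_build:
  assumes z: "R rz = 0" and D: "R rD = Suc (R rDm)"
    and L: "layout M (R rwork) (R rbase) tab cl V" and p: "R rp \<in> V"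
    and room: "R rwork + (R rk + 1) * (2 * R rk + 1) \<le> R rbase" and rd: "R rrd \<le> R rk"
    and Q: "\<And>t R' M' \<psi>'. t \<le> (15 * R rg + 12 * R rk + m + 60) * (R rk + 1) \<Longrightarrow>
      \<psi>' = chain m (R rD) (R rk) tab cl (R rrd) (R rg) (if length (cl (R rp)) \<le> R rk then [cl (R rp)] else []) \<Longrightarrow>
      (\<forall>i. i \<notin> build_regs \<longrightarrow> R' i = R i) \<Longrightarrow>
      holds M' (R rwork) (encode_clauses \<psi>') \<Longrightarrow> R' re = R rwork + length (encode_clauses \<psi>') \<Longrightarrow>
      (\<forall>i. \<not> (R rwork \<le> i \<and> i < R rbase) \<longrightarrow> M' i = M i) \<Longrightarrow> Q t R' M'"
  shows "wp (build m) Q R M"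
proof -
  define T where "T = 15 * R rg + 12 * R rk + m + 54"
  define \<psi>0 where "\<psi>0 = (if length (cl (R rp)) \<le> R rk then [cl (R rp)] else [])"
  have start: "holds M (R rp) (encode_clause (cl (R rp)))" "R rp + length (encode_clause (cl (R rp))) \<le> R rwork"
    using L p unfolding layout_def by blast+
  have size: "R rwork + length (encode_clauses \<psi>) \<le> R rwork + length \<psi> * (2 * R rk + 1)"
    if "\<forall>C\<in>set \<psi>. length C \<le> R rk" for \<psi>
    using length_encode_clauses_le[OF that] by simp
  show ?thesis
    unfolding build_def wp_Seq wp_Do
  proof (simp, rule wp_append[where C = "cl (R rp)"], goal_cases)
    case (4 t0 R0 M0 X)
    have X: "X = \<psi>0" using 4(2) by (simp add: \<psi>0_def)
    have \<psi>0: "(\<forall>C\<in>set \<psi>0. length C \<le> R rk) \<and> length \<psi>0 \<le> 1" by (auto simp: \<psi>0_def)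
    have "length (encode_clauses \<psi>0) \<le> 2 * R rk + 1" by (auto simp: \<psi>0_def)
    then have M0: "\<forall>i. \<not> (R rwork \<le> i \<and> i < R rbase) \<longrightarrow> M0 i = M i"
      using 4(6) room by (auto simp: X)
    have R0: "R0 rrd = R rrd" "R0 rk = R rk" "R0 rq = R rg" "R0 re = R rwork + length (encode_clauses \<psi>0)"
      "R0 rz = 0" "R0 rwork = R rwork"
      using 4 z X by auto
    show ?case
    proof (rule wp_while[where p = "\<lambda>R' M'. T * R' ri" and
        I = "\<lambda>R' M'. (\<forall>i. i \<notin> build_regs \<longrightarrow> R' i = R i) \<and> R' rq \<le> R rg \<and>
          (\<forall>i. \<not> (R rwork \<le> i \<and> i < R rbase) \<longrightarrow> M' i = M i) \<and>
          (\<exists>\<psi>. holds M' (R rwork) (encode_clauses \<psi>) \<and> R' re = R rwork + length (encode_clauses \<psi>) \<and>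
            length \<psi> + R' ri \<le> R rk + 1 \<and> (\<forall>C\<in>set \<psi>. length C \<le> R rk) \<and>
            chain m (R rD) (R rk) tab cl (R rrd) (R rg) \<psi>0 = chain m (R rD) (R rk) tab cl (R' ri) (R' rq) \<psi>)"],
        goal_cases)
      case 1
      have "holds M0 (R rwork) (encode_clauses \<psi>0)" using 4(5) by (simp add: X)
      moreover have "\<forall>i. i \<notin> build_regs \<longrightarrow> R0 i = R i" using 4(3) by auto
      ultimately show ?case
        by - (intro conjI; (rule exI[of _ \<psi>0])?; use M0 R0 rd \<psi>0 in simp)
    next
      case (2 R' M')
      then obtain \<psi> where I: "holds M' (R rwork) (encode_clauses \<psi>)" "R' re = R rwork + length (encode_clauses \<psi>)"
        "length \<psi> + R' ri \<le> R rk + 1" "\<forall>C\<in>set \<psi>. length C \<le> R rk"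
        "chain m (R rD) (R rk) tab cl (R rrd) (R rg) \<psi>0 = chain m (R rD) (R rk) tab cl (R' ri) (R' rq) \<psi>"
        by blast
      have R': "R' rz = 0" "R' rD = R rD" "R' rDm = R rDm" "R' rk = R rk" "R' rwork = R rwork"
        "R' rbase = R rbase" "R' rq \<le> R rg" using 2(1) z by auto
      have mem: "\<And>i. \<not> (R rwork \<le> i \<and> i < R rbase) \<Longrightarrow> M' i = M i" using 2(1) by blast
      obtain r where r: "R' ri = Suc r" using 2(2) R' by (cases "R' ri") auto
      have L': "layout M' (R rwork) (R rbase) tab cl V"
        by (rule layout_cong[OF L]) (auto intro!: mem)
      have "R rwork + (length \<psi> + 1) * (2 * R rk + 1) \<le> R rwork + (R rk + 1) * (2 * R rk + 1)"
        using I(3) r by (intro add_left_mono mult_le_mono1) simp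
      then have room': "R' re + (2 * R rk + 1) \<le> R rbase"
        using size[OF I(4)] room I(2) by (simp add: algebra_simps)
      show ?case
        unfolding wp_Seq wp_Do
      proof (rule wp_extension[where \<psi> = \<psi> and tab = tab and cl = cl and V = V], goal_cases)
        case (7 t R2 M2 \<psi>')
        have frame: "\<forall>i. i \<notin> build_regs \<longrightarrow> R2 i = R i" using 7(3) 2(1) by auto
        have ri: "R2 ri = r" using 7(3) r by auto
        have q: "R2 rq \<le> R rg"
          using 7(4) R'(7) by simp (meson div_le_dividend order_trans)
        have mem2: "\<forall>i. \<not> (R rwork \<le> i \<and> i < R rbase) \<longrightarrow> M2 i = M i"
          using 7(7) mem R' by auto
        have \<psi>': "\<psi>' = extend m (R rk) tab cl (R' rq mod R rD) (R' rq div R rD mod R rD) \<psi>"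
          using 7(2) R' by simp
        have "\<exists>\<psi>. holds M2 (R rwork) (encode_clauses \<psi>) \<and> R2 re = R rwork + length (encode_clauses \<psi>) \<and>
            length \<psi> + R2 ri \<le> R rk + 1 \<and> (\<forall>C\<in>set \<psi>. length C \<le> R rk) \<and>
            chain m (R rD) (R rk) tab cl (R rrd) (R rg) \<psi>0 = chain m (R rD) (R rk) tab cl (R2 ri) (R2 rq) \<psi>"
        proof (rule exI[of _ \<psi>'], intro conjI)
          show "length \<psi>' + R2 ri \<le> R rk + 1" "\<forall>C\<in>set \<psi>'. length C \<le> R rk"
            using extend_bounds[OF I(4), of m tab cl "R' rq mod R rD" "R' rq div R rD mod R rD"] I(3) r ri
            unfolding \<psi>' by simp_all
        qed (use 7(4-6) R' I(5) r ri \<psi>' in auto)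
        moreover have "t + 4 \<le> T" using 7(1) R' by (simp add: T_def)
        then have "length (code (Decr ri)) + t + 3 + T * R2 ri \<le> T * R' ri" using r ri by simp
        ultimately show ?case using frame q mem2 by blast
      qed (use R' D L' I room' in auto)
    next
      case (3 R' M' t)
      then obtain \<psi> where I: "holds M' (R rwork) (encode_clauses \<psi>)" "R' re = R rwork + length (encode_clauses \<psi>)"
        "chain m (R rD) (R rk) tab cl (R rrd) (R rg) \<psi>0 = chain m (R rD) (R rk) tab cl (R' ri) (R' rq) \<psi>"
        by blast
      have "R' ri = 0" using 3(1,2) z by auto
      then have \<psi>: "\<psi> = chain m (R rD) (R rk) tab cl (R rrd) (R rg) \<psi>0" using I(3) by simp
      have "t \<le> T * R rrd + 2" using 3(3) \<open>R' ri = 0\<close> R0 by simp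
      also have "\<dots> \<le> T * R rk + 2" using rd by simp
      finally have "t0 + t + 4 \<le> T * R rk + 12 * R rk + 18" using 4(1) by simp
      also have "\<dots> \<le> (T + 6) * (R rk + 1)" by (simp add: T_def algebra_simps)
      also have "T + 6 = 15 * R rg + 12 * R rk + m + 60" by (simp add: T_def)
      finally have "t0 + t + 4 \<le> (15 * R rg + 12 * R rk + m + 60) * (R rk + 1)" .
      then show ?case
        using 3(1) I(1,2) \<psi> by (intro Q) (auto simp: \<psi>0_def numeral_eq_Suc)
    qed
  qed (use z start in auto)
qed

definition candidate ::
  "nat \<Rightarrow> nat \<Rightarrow> nat \<Rightarrow> (nat \<Rightarrow> nat) \<Rightarrow> (nat \<Rightarrow> literal list) \<Rightarrow> nat \<Rightarrow> nat \<Rightarrow> nat \<Rightarrow> literal list list" where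
  "candidate m D k tab cl r p g = chain m D k tab cl r g (if length (cl p) \<le> k then [cl p] else [])"

text \<open>This is what the machine tests. It coincides with unsatisfiability once \<open>D\<close>
  bounds the clause lengths and \<open>N\<close> bounds the number of choices, see
  \<open>refuted_iff\<close>.\<close>

definition refuted :: "nat \<Rightarrow> nat \<Rightarrow> literal list list \<Rightarrow> bool" where
  "refuted D N \<psi> \<longleftrightarrow> (\<forall>h<N. \<not> choice D h \<psi> [])"

definition attempt :: "nat \<Rightarrow> com" where
  "attempt m = build m ;; sat_test ;; IfLess rz rsat (Do Skip) (Do (Put rres 1))"

abbreviation "attempt_regs \<equiv> insert rres (build_regs \<union> test_regs)"

text \<open>\<open>(k + 1) * (2 * k + 3)\<close> is
  \<open>(k + 1) * (2 * k + 1) + 2 * (k + 1)\<close>: the \<open>N\<close> scratch cells have to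
  hold the clauses of a candidate and, behind them, one selected literal of two cells for each
  clause.\<close>

lemma wp_attempt:
  assumes z: "R rz = 0" and D: "R rD = Suc (R rDm)"
    and L: "layout M (R rwork) (R rbase) tab cl V" and p: "R rp \<in> V"
    and N: "(R rk + 1) * (2 * R rk + 3) \<le> R rN" and base: "R rbase = R rwork + R rN"
    and rd: "R rrd \<le> R rk" and g: "R rg < R rN"
    and Q: "\<And>t R' M'. t \<le> (m + 220) * R rN ^ 3 \<Longrightarrow>
      (\<forall>i. i \<notin> attempt_regs \<longrightarrow> R' i = R i) \<Longrightarrow>
      R' rres = (if refuted (R rD) (R rN) (candidate m (R rD) (R rk) tab cl (R rrd) (R rp) (R rg)) then 1 else R rres) \<Longrightarrow>
      (\<forall>i. \<not> (R rwork \<le> i \<and> i < R rbase) \<longrightarrow> M' i = M i) \<Longrightarrow> Q t R' M'"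
  shows "wp (attempt m) Q R M"
proof -
  define N k where "N = R rN" and "k = R rk"
  define \<psi>0 where "\<psi>0 = (if length (cl (R rp)) \<le> k then [cl (R rp)] else [])"
  have kN: "(k + 1) * (2 * k + 1) + 2 * (k + 1) \<le> N" using N by (simp add: N_def k_def algebra_simps)
  then have k1: "k + 1 \<le> N" by simp
  show ?thesis
    unfolding attempt_def wp_Seq
  proof (rule wp_build[OF z D L p], goal_cases)
    case (3 t1 R1 M1 \<psi>)
    have \<psi>: "\<psi> = candidate m (R rD) (R rk) tab cl (R rrd) (R rp) (R rg)"
      using 3(2) by (simp add: candidate_def)
    have "(\<forall>C\<in>set \<psi>. length C \<le> k) \<and> length \<psi> \<le> length \<psi>0 + R rrd"
      unfolding 3(2) \<psi>0_def k_def by (rule chain_bounds) auto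
    moreover have "length \<psi>0 \<le> 1" by (simp add: \<psi>0_def)
    ultimately have b: "\<forall>C\<in>set \<psi>. length C \<le> k" "length \<psi> \<le> k + 1" using rd by (auto simp: k_def)
    have "length (encode_clauses \<psi>) \<le> length \<psi> * (2 * k + 1)" by (rule length_encode_clauses_le[OF b(1)])
    also have "\<dots> \<le> (k + 1) * (2 * k + 1)" using b(2) by (rule mult_le_mono1)
    finally have "length (encode_clauses \<psi>) + 2 * length \<psi> \<le> (k + 1) * (2 * k + 1) + 2 * (k + 1)"
      using b(2) by (intro add_mono mult_le_mono2)
    then have size: "length (encode_clauses \<psi>) + 2 * length \<psi> \<le> N" using kN by (rule order_trans)
    have R1: "R1 rz = 0" "R1 rD = R rD" "R1 rDm = R rDm" "R1 rwork = R rwork" "R1 rN = N" "R1 rres = R rres"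
      using 3(3) z by (auto simp: N_def)
    have "15 * R rg + 12 * k + m + 60 \<le> 15 * N + 12 * N + m * N + 60 * N"
      using g k1 by (intro add_mono) (auto simp: N_def)
    also have "\<dots> = (m + 87) * N" by (simp add: algebra_simps)
    finally have "(15 * R rg + 12 * k + m + 60) * (k + 1) \<le> ((m + 87) * N) * N"
      using k1 by (rule mult_le_mono)
    with 3(1) have "t1 \<le> ((m + 87) * N) * N" unfolding k_def by (rule order_trans)
    also have "\<dots> \<le> (m + 87) * N ^ 3" using k1 by (simp add: power3_eq_cube)
    finally have t1: "t1 \<le> (m + 87) * N ^ 3" .
    show ?case
    proof (rule wp_sat_test[where \<psi> = \<psi>], goal_cases)
      case (6 t2 R2 M2)
      have "((60 * N + 43) * N + 19) * N + 4 = 60 * N ^ 3 + 43 * N\<^sup>2 + 19 * N + 4"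
        by (simp add: power3_eq_cube power2_eq_square algebra_simps)
      also have "\<dots> \<le> 60 * N ^ 3 + 43 * N ^ 3 + 19 * N ^ 3 + 4 * N ^ 3"
        using k1 by (intro add_mono mult_le_mono2) (auto intro: power_increasing self_le_power)
      finally have t2: "t2 \<le> 126 * N ^ 3" using 6(1) R1 by simp
      have one: "1 \<le> N ^ 3" using k1 by simp
      have "t1 + t2 + 7 \<le> (m + 87) * N ^ 3 + 126 * N ^ 3 + 7 * N ^ 3"
        using t1 t2 one by linarith
      then have t: "t1 + t2 + 7 \<le> (m + 220) * R rN ^ 3" by (simp add: N_def algebra_simps)
      have frame: "\<forall>i. i \<notin> attempt_regs \<longrightarrow> R2 i = R i" using 6(2) 3(3) by auto
      have z2: "R2 rz = 0" "R2 rres = R rres" using 6(2) R1 by auto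
      have mem: "\<forall>i. \<not> (R rwork \<le> i \<and> i < R rbase) \<longrightarrow> M2 i = M i"
        using 6(4) 3(5,6) size base by (auto simp: N_def)
      have sat: "R2 rsat = (if refuted (R rD) (R rN) \<psi> then 0 else 1)"
        using 6(3) R1 by (auto simp: refuted_def N_def)
      show ?case
      proof (cases "refuted (R rD) (R rN) \<psi>")
        case True
        then show ?thesis using t frame z2 mem sat
          by (simp, intro Q) (auto simp: \<psi>)
      next
        case False
        then show ?thesis using t frame z2 mem sat
          by (simp, intro Q) (auto simp: \<psi>)
      qed
    qed (use 3 R1 D size in auto)
  qed (use kN base rd in \<open>auto simp: N_def k_def\<close>)
qed

text \<open>
  The positions 0 and \<open>n\<close> are those of the added unit clauses (every clause of the formula lies strictly
  between 2 and \<open>n\<close>); only these do not count towards the \<open>k\<close> clauses of a backbone witness.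
\<close>

definition rounds :: "nat \<Rightarrow> nat \<Rightarrow> nat \<Rightarrow> nat" where
  "rounds k n p = (if 2 < p \<and> p < n then k - 1 else k)"

definition explore :: "nat \<Rightarrow> com" where
  "explore m = Do (Copy rrd rk) ;; Do (Put rt 2) ;;
     IfLess rt rp (IfLess rp rn (Do (Decr rrd)) (Do Skip)) (Do Skip) ;;
     Do (Copy rg rN) ;; WhileLess rz rg (Do (Decr rg) ;; attempt m)"

abbreviation "explore_regs \<equiv> {rrd, rg} \<union> attempt_regs"

lemma wp_explore_loop:
  assumes z: "R rz = 0" and D: "R rD = Suc (R rDm)"
    and L: "layout M (R rwork) (R rbase) tab cl V" and p: "R rp \<in> V"
    and N: "(R rk + 1) * (2 * R rk + 3) \<le> R rN" and base: "R rbase = R rwork + R rN"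
    and rd: "R rrd \<le> R rk" and g: "R rg = R rN"
    and Q: "\<And>t R' M'. t \<le> (m + 230) * R rN ^ 4 \<Longrightarrow>
      (\<forall>i. i \<notin> explore_regs \<longrightarrow> R' i = R i) \<Longrightarrow>
      R' rres = (if \<exists>g<R rN. refuted (R rD) (R rN) (candidate m (R rD) (R rk) tab cl (R rrd) (R rp) g) then 1 else R rres) \<Longrightarrow>
      (\<forall>i. \<not> (R rwork \<le> i \<and> i < R rbase) \<longrightarrow> M' i = M i) \<Longrightarrow> Q t R' M'"
  shows "wp (WhileLess rz rg (Do (Decr rg) ;; attempt m)) Q R M"
proof (rule wp_while[where p = "\<lambda>R' M'. ((m + 220) * R rN ^ 3 + 4) * R' rg" and
    I = "\<lambda>R' M'. (\<forall>i. i \<notin> insert rg attempt_regs \<longrightarrow> R' i = R i) \<and> R' rg \<le> R rN \<and>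
      R' rres = (if \<exists>g<R rN. R' rg \<le> g \<and> refuted (R rD) (R rN) (candidate m (R rD) (R rk) tab cl (R rrd) (R rp) g)
        then 1 else R rres) \<and>
      (\<forall>i. \<not> (R rwork \<le> i \<and> i < R rbase) \<longrightarrow> M' i = M i)"], goal_cases)
  case 1
  show ?case using g by auto
next
  case (2 R' M')
  have R': "R' rz = 0" "R' rD = R rD" "R' rDm = R rDm" "R' rwork = R rwork" "R' rbase = R rbase" "R' rp = R rp"
    "R' rN = R rN" "R' rk = R rk" "R' rrd = R rrd"
    using 2(1) z by auto
  obtain g where g: "R' rg = Suc g" using 2(2) R' by (cases "R' rg") auto
  have gN: "g < R rN" using 2(1) g by auto
  have mem: "\<And>i. \<not> (R rwork \<le> i \<and> i < R rbase) \<Longrightarrow> M' i = M i" using 2(1) by blast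
  have L': "layout M' (R rwork) (R rbase) tab cl V"
    by (rule layout_cong[OF L]) (auto intro!: mem)
  have range: "(\<exists>g'<R rN. g \<le> g' \<and> P g') \<longleftrightarrow> P g \<or> (\<exists>g'<R rN. Suc g \<le> g' \<and> P g')" for P
    using gN by (auto simp: Suc_le_eq le_less)
  show ?case
    unfolding wp_Seq wp_Do
  proof (rule wp_attempt[where tab = tab and cl = cl and V = V and m = m], goal_cases)
    case (9 t R2 M2)
    have "R2 rg = g" using 9(2) g by auto
    moreover have "R2 rres = (if \<exists>g'<R rN. g \<le> g' \<and> refuted (R rD) (R rN) (candidate m (R rD) (R rk) tab cl (R rrd) (R rp) g')
        then 1 else R rres)"
      using 9(3) g 2(1) R' by (auto simp: range)
    moreover have "\<forall>i. i \<notin> insert rg attempt_regs \<longrightarrow> R2 i = R i" using 9(2) 2(1) by auto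
    moreover have "\<forall>i. \<not> (R rwork \<le> i \<and> i < R rbase) \<longrightarrow> M2 i = M i" using 9(4) mem R' by auto
    ultimately show ?case using 9(1) gN g R' by auto
  qed (use R' D L' p N base rd gN g in auto)
next
  case (3 R' M' t)
  have g0: "R' rg = 0" using 3(1,2) z by auto
  have N1: "1 \<le> R rN" using N by (cases "R rN") auto
  have "t \<le> ((m + 220) * R rN ^ 3 + 4) * R rN + 2" using 3(3) g0 g by simp
  also have "\<dots> = (m + 220) * R rN ^ 4 + 4 * R rN + 2" by (simp add: eval_nat_numeral algebra_simps)
  also have "\<dots> \<le> (m + 220) * R rN ^ 4 + 4 * R rN ^ 4 + 2 * R rN ^ 4"
    using N1 by (intro add_mono mult_le_mono2) (auto intro: self_le_power)
  also have "\<dots> \<le> (m + 230) * R rN ^ 4" by (simp add: algebra_simps)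
  finally show ?case using 3(1) g0 by (intro Q) auto
qed

lemma wp_explore:
  assumes z: "R rz = 0" and D: "R rD = Suc (R rDm)"
    and L: "layout M (R rwork) (R rbase) tab cl V" and p: "R rp \<in> V"
    and N: "(R rk + 1) * (2 * R rk + 3) \<le> R rN" and base: "R rbase = R rwork + R rN"
    and Q: "\<And>t R' M'. t \<le> (m + 245) * R rN ^ 4 \<Longrightarrow>
      (\<forall>i. i \<notin> explore_regs \<longrightarrow> R' i = R i) \<Longrightarrow>
      R' rres = (if \<exists>g<R rN. refuted (R rD) (R rN)
        (candidate m (R rD) (R rk) tab cl (rounds (R rk) (R rn) (R rp)) (R rp) g) then 1 else R rres) \<Longrightarrow>
      (\<forall>i. \<not> (R rwork \<le> i \<and> i < R rbase) \<longrightarrow> M' i = M i) \<Longrightarrow> Q t R' M'"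
  shows "wp (explore m) Q R M"
proof -
  have "1 \<le> R rN" using N by (cases "R rN") auto
  then have one: "1 \<le> R rN ^ 4" by simp
  have T: "t + 15 \<le> (m + 245) * R rN ^ 4" if "t \<le> (m + 230) * R rN ^ 4" for t
  proof -
    have "t + 15 \<le> (m + 230) * R rN ^ 4 + 15 * R rN ^ 4" using that one by linarith
    then show ?thesis by (simp add: algebra_simps)
  qed
  let ?r = "rounds (R rk) (R rn) (R rp)"
  \<comment> \<open>The nested conditionals reach the loop along three branches with different
    auxiliary registers; a statement about any \<open>R1\<close> with the right \<open>rrd\<close>
    and \<open>rg\<close> serves all of them.\<close>
  have loop: "wp (WhileLess rz rg (Do (Decr rg) ;; attempt m)) Q' R1 M"
    if R1: "R1 rrd = ?r" "R1 rg = R rN" "\<forall>i. i \<notin> explore_regs \<longrightarrow> R1 i = R i" "R1 rres = R rres"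
      and Q': "\<And>t R' M'. t + 15 \<le> (m + 245) * R rN ^ 4 \<Longrightarrow>
        (\<forall>i. i \<notin> explore_regs \<longrightarrow> R' i = R i) \<Longrightarrow>
        R' rres = (if \<exists>g<R rN. refuted (R rD) (R rN) (candidate m (R rD) (R rk) tab cl ?r (R rp) g)
          then 1 else R rres) \<Longrightarrow>
        (\<forall>i. \<not> (R rwork \<le> i \<and> i < R rbase) \<longrightarrow> M' i = M i) \<Longrightarrow> Q' t R' M'" for Q' R1
  proof (rule wp_explore_loop[where tab = tab and cl = cl and V = V and m = m], goal_cases)
    case (9 t R' M')
    show ?case
    proof (rule Q')
      show "t + 15 \<le> (m + 245) * R rN ^ 4" using 9(1) R1(3) by (intro T) simp
    qed (use 9 R1 in auto)
  qed (use assms R1 in \<open>auto simp: rounds_def\<close>)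
  show ?thesis
    unfolding explore_def
    by (simp, intro conjI impI; rule loop; (rule Q)?; simp add: rounds_def)
qed

section \<open>Search from all starting clauses\<close>

definition starts :: "literal list list \<Rightarrow> nat set" where
  "starts Cs = {length (encode_clauses C1) | C1 C C2. Cs = C1 @ C # C2}"

definition search :: "nat \<Rightarrow> com" where
  "search m = Do (Put rres 0) ;; Do (Put rp 0) ;;
     WhileLess rp rwork (explore m ;; Do (Fetch rlen rp) ;; Do (Incr rp) ;; advance rp rlen)"

abbreviation "search_regs \<equiv> insert rp explore_regs"

lemma starts_append: "starts (C1 @ C2) = starts C1 \<union> (\<lambda>p. length (encode_clauses C1) + p) ` starts C2"
proof (intro equalityI subsetI)
  fix p assume "p \<in> starts (C1 @ C2)"
  then obtain A C B where "C1 @ C2 = A @ C # B" "p = length (encode_clauses A)" by (auto simp: starts_def)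
  then show "p \<in> starts C1 \<union> (\<lambda>p. length (encode_clauses C1) + p) ` starts C2"
    by (fastforce simp: starts_def append_eq_append_conv2 append_eq_Cons_conv image_iff)
next
  fix p assume "p \<in> starts C1 \<union> (\<lambda>p. length (encode_clauses C1) + p) ` starts C2"
  then show "p \<in> starts (C1 @ C2)"
  proof
    assume "p \<in> (\<lambda>p. length (encode_clauses C1) + p) ` starts C2"
    then obtain A C B where "C2 = A @ C # B" "p = length (encode_clauses (C1 @ A))" by (auto simp: starts_def)
    then show ?thesis unfolding starts_def by (auto intro!: exI[of _ "C1 @ A"])
  qed (fastforce simp: starts_def)
qed

lemma starts_single: "starts [C] = {0}"
  by (auto simp: starts_def Cons_eq_append_conv intro!: exI[of _ "[]"])

text \<open>Each exploration costs \<open>O(N ^ 4)\<close>, and a clause occupies at least one cell,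
  for its length. Charging exploration and skipping of a clause to the cells of its encoding makes
  the total linear in \<open>rwork\<close>.\<close>

lemma wp_search:
  assumes z: "R rz = 0" and D: "R rD = Suc (R rDm)"
    and L: "layout M (R rwork) (R rbase) tab cl (starts Cs)"
    and Cs: "holds M 0 (encode_clauses Cs)" "R rwork = length (encode_clauses Cs)"
    and N: "(R rk + 1) * (2 * R rk + 3) \<le> R rN" and base: "R rbase = R rwork + R rN"
    and Q: "\<And>t R' M'. t \<le> ((m + 245) * R rN ^ 4 + 10) * R rwork + 4 \<Longrightarrow>
      R' rres = (if \<exists>p\<in>starts Cs. \<exists>g<R rN. refuted (R rD) (R rN)
        (candidate m (R rD) (R rk) tab cl (rounds (R rk) (R rn) p) p g) then 1 else 0) \<Longrightarrow> Q t R' M'"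
  shows "wp (search m) Q R M"
proof -
  define good where "good p \<longleftrightarrow> (\<exists>g<R rN. refuted (R rD) (R rN)
        (candidate m (R rD) (R rk) tab cl (rounds (R rk) (R rn) p) p g))" for p
  define res where "res Ds = (if \<exists>p\<in>starts Ds. good p then 1 else 0 :: nat)" for Ds
  show ?thesis
    unfolding search_def wp_Seq wp_Do
  proof (rule wp_while[where p = "\<lambda>R' M'. ((m + 245) * R rN ^ 4 + 10) * (R rwork - R' rp)" and
    I = "\<lambda>R' M'. (\<forall>i. i \<notin> search_regs \<longrightarrow> R' i = R i) \<and>
      (\<forall>i. \<not> (R rwork \<le> i \<and> i < R rbase) \<longrightarrow> M' i = M i) \<and>
      (\<exists>C1 C2. Cs = C1 @ C2 \<and> R' rp = length (encode_clauses C1) \<and>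
        R' rres = res C1)"], goal_cases)
    case 1
    show ?case
      by (intro conjI; (rule exI[of _ "[]"], rule exI[of _ Cs])?) (auto simp: starts_def res_def)
  next
    case (2 R' M')
    then obtain C1 C2 where I: "Cs = C1 @ C2" "R' rp = length (encode_clauses C1)"
      "R' rres = res C1" by blast
    have R': "R' rz = 0" "R' rD = R rD" "R' rDm = R rDm" "R' rwork = R rwork" "R' rbase = R rbase"
      "R' rN = R rN" "R' rk = R rk" "R' rn = R rn"
      using 2(1) z by auto
    have mem: "\<And>i. \<not> (R rwork \<le> i \<and> i < R rbase) \<Longrightarrow> M' i = M i" using 2(1) by blast
    obtain C C3 where C: "C2 = C # C3" using 2(2) I(1,2) R' Cs(2) by (cases C2) auto
    have L': "layout M' (R rwork) (R rbase) tab cl (starts Cs)"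
      by (rule layout_cong[OF L]) (auto intro!: mem)
    have pV: "R' rp \<in> starts Cs" using I(1,2) C by (auto simp: starts_def)
    have len: "M (R' rp) = length C" using Cs(1) I(1,2) C by (simp add: encode_clause_def)
    have lt: "R' rp + length (encode_clause C) \<le> R rwork" using Cs(2) I(1,2) C by simp
    show ?case
      unfolding wp_Seq wp_Do
    proof (rule wp_explore[where tab = tab and cl = cl and V = "starts Cs" and m = m], goal_cases)
      case (7 t R2 M2)
      have R2: "R2 rp = R' rp" "R2 rz = 0" using 7(2) R' by auto
      have mem2: "\<forall>i. \<not> (R rwork \<le> i \<and> i < R rbase) \<longrightarrow> M2 i = M i" using 7(4) R' mem by auto
      then have len2: "M2 (R' rp) = length C" using len lt by simp
      have res: "R2 rres = res (C1 @ [C])"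
        using 7(3) R' I(2,3) by (auto simp: res_def good_def starts_append starts_single)
      show ?case
      proof (simp add: R2 len2, rule wp_advance, goal_cases)
        case (5 t2)
        have frame: "\<forall>i. i \<notin> search_regs \<longrightarrow> R2 i = R i" using 7(2) 2(1) by auto
        define X where "X = (m + 245) * R rN ^ 4 + 10"
        have t: "t \<le> X - 10" using 7(1) R' by (simp add: X_def)
        have "X \<ge> 10" by (simp add: X_def)
        have "R rwork - (R' rp + length (encode_clause C)) + length (encode_clause C) = R rwork - R' rp"
          using lt by linarith
        then have "X * (R rwork - (R' rp + length (encode_clause C))) + X * length (encode_clause C) = X * (R rwork - R' rp)"
          by (simp only: distrib_left[symmetric])
        moreover have "t + t2 + 7 \<le> X * length (encode_clause C)"
        proof -
          have "t + t2 + 7 \<le> X + 6 * length C" using t 5 \<open>X \<ge> 10\<close> by simp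
          also have "\<dots> \<le> X + X * (2 * length C)" using \<open>X \<ge> 10\<close> by (intro add_left_mono) auto
          finally show ?thesis by simp
        qed
        ultimately have le: "t + t2 + 7 + X * (R rwork - (R' rp + length (encode_clause C))) \<le> X * (R rwork - R' rp)"
          by linarith
        have "\<exists>D1 D2. Cs = D1 @ D2 \<and> R' rp + length (encode_clause C) = length (encode_clauses D1) \<and>
            R2 rres = res D1"
          using I(1,2) C res by (intro exI[of _ "C1 @ [C]"] exI[of _ C3]) simp
        then show ?case using le frame mem2 by (simp add: X_def)
      qed (use R2 in auto)
    qed (use R' D L' N base pV in auto)
  next
    case (3 R' M' t)
    then obtain C1 C2 where I: "Cs = C1 @ C2" "R' rp = length (encode_clauses C1)"
      "R' rres = res C1" by blast
    have "R' rwork = R rwork" using 3(1) by auto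
    then have "C2 = []" using 3(2) I(1,2) Cs(2) by (cases C2) auto
    then have "C1 = Cs" using I(1) by simp
    have "R rwork - R' rp = 0" using 3(2) \<open>R' rwork = _\<close> by simp
    then have "t \<le> ((m + 245) * R rN ^ 4 + 10) * R rwork + 2" using 3(3) by simp
    then show ?case using I(3) \<open>C1 = Cs\<close> by (intro Q) (auto simp: res_def good_def)
  qed
qed

section \<open>The table of occurrences\<close>

definition row :: "(nat \<times> nat) list \<Rightarrow> nat \<Rightarrow> nat list" where
  "row T v = map snd (filter (\<lambda>(u, p). u = v) T)"

text \<open>\<open>T\<close> lists the pairs of variable and clause position in order of insertion.
  Rows have the fixed width \<open>m\<close>, and entries beyond the end of a row are 0, so no row
  lengths need to be stored.\<close>

definition indexed :: "store \<Rightarrow> nat \<Rightarrow> nat \<Rightarrow> (nat \<times> nat) list \<Rightarrow> bool" where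
  "indexed M base m T \<longleftrightarrow>
     (\<forall>v i. i < m \<longrightarrow> M (base + m * v + i) = (if i < length (row T v) then row T v ! i else 0))"

definition insert_entry :: "nat \<Rightarrow> com" where
  "insert_entry m = Do (Put ri 0) ;; Do (FetchAt m ru rbase rv ri) ;;
     WhileLess rz ru (Do (Incr ri) ;; Do (FetchAt m ru rbase rv ri)) ;;
     Do (SaveAt m rbase rv ri rp)"

lemma row_snoc: "row (T @ [(u, p)]) v = (if u = v then row T v @ [p] else row T v)"
  by (auto simp: row_def)

text \<open>Stored positions are nonzero and the row is not full, so the scan for a 0 stops exactly
  at the end of the row. The write disturbs no other entry, since \<open>m * v + i\<close> with
  \<open>i < m\<close> determines \<open>v\<close> and \<open>i\<close>.\<close>

lemma wp_insert_entry:
  assumes z: "R rz = 0" and T: "indexed M (R rbase) m T" "0 \<notin> snd ` set T" "length (row T (R rv)) < m"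
    and Q: "\<And>t R' M'. t \<le> (m + 6) * m + 2 * m + 10 \<Longrightarrow> (\<forall>i. i \<notin> {ri, ru} \<longrightarrow> R' i = R i) \<Longrightarrow>
      indexed M' (R rbase) m (T @ [(R rv, R rp)]) \<Longrightarrow> (\<forall>i. i < R rbase \<longrightarrow> M' i = M i) \<Longrightarrow> Q t R' M'"
  shows "wp (insert_entry m) Q R M"
proof -
  define l where "l = length (row T (R rv))"
  have cell: "M (R rbase + m * R rv + i) = (if i < l then row T (R rv) ! i else 0)" if "i \<le> l" for i
    using T(1,3) that by (auto simp: indexed_def l_def)
  have nz: "row T (R rv) ! i \<noteq> 0" if "i < l" for i
  proof -
    have "row T (R rv) ! i \<in> set (row T (R rv))" using that by (auto simp: l_def)
    also have "\<dots> \<subseteq> snd ` set T" by (auto simp: row_def)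
    finally show ?thesis using T(2) by metis
  qed
  show ?thesis
    unfolding insert_entry_def wp_Seq wp_Do
  proof (rule wp_while[where p = "\<lambda>R' M'. (m + 6) * (l - R' ri)" and
      I = "\<lambda>R' M'. M' = M \<and> (\<forall>i. i \<notin> {ri, ru} \<longrightarrow> R' i = R i) \<and> R' ri \<le> l \<and>
        R' ru = M (R rbase + m * R rv + R' ri)"], goal_cases)
    case 1
    show ?case by auto
  next
    case (2 R' M')
    have "R' ri < l" using 2 z cell[of "R' ri"] by (auto split: if_splits)
    then obtain s where s: "l = R' ri + Suc s" by (metis less_iff_Suc_add add_Suc_right)
    show ?case using 2(1) by (auto simp: s add.assoc)
  next
    case (3 R' M' t)
    have "R' ri = l" using 3 z cell[of "R' ri"] nz[of "R' ri"] by (cases "R' ri < l") auto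
    moreover have "t \<le> (m + 6) * l + 2" using 3(3) \<open>R' ri = l\<close> by simp
    moreover have "(m + 6) * l \<le> (m + 6) * m" using T(3) by (intro mult_le_mono2) (simp add: l_def)
    ultimately have t: "R' ri = l" "t \<le> (m + 6) * m + 2" by linarith+
    have inj: "m * v + i = m * R rv + l \<longleftrightarrow> v = R rv \<and> i = l" if "i < m" for v i
    proof
      assume eq: "m * v + i = m * R rv + l"
      have "(m * v + i) div m = v" "(m * v + i) mod m = i" using that by auto
      moreover have "(m * R rv + l) div m = R rv" "(m * R rv + l) mod m = l" using T(3) by (auto simp: l_def)
      ultimately show "v = R rv \<and> i = l" using eq by metis
    qed simp
    have "indexed (M(R rbase + m * R rv + l := R rp)) (R rbase) m (T @ [(R rv, R rp)])"
      unfolding indexed_def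
    proof (intro allI impI)
      fix v i assume i: "i < m"
      have "R rbase + m * v + i = R rbase + m * R rv + l \<longleftrightarrow> v = R rv \<and> i = l"
        using inj[OF i, of v] by linarith
      then show "(M(R rbase + m * R rv + l := R rp)) (R rbase + m * v + i) =
          (if i < length (row (T @ [(R rv, R rp)]) v) then row (T @ [(R rv, R rp)]) v ! i else 0)"
        using T(1) i by (auto simp: indexed_def row_snoc nth_append l_def)
    qed
    then show ?case
      using 3(1) t by (simp, intro Q) auto
  qed
qed


section \<open>Filling the table clause by clause\<close>

definition clause_entries :: "nat \<Rightarrow> literal list \<Rightarrow> (nat \<times> nat) list" where
  "clause_entries p C = map (\<lambda>l. (var_of l, p)) C"

fun entries :: "nat \<Rightarrow> literal list list \<Rightarrow> (nat \<times> nat) list" where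
  "entries p [] = []"
| "entries p (C # Cs) = clause_entries p C @ entries (p + length (encode_clause C)) Cs"

lemma entries_append: "entries p (C1 @ C2) = entries p C1 @ entries (p + length (encode_clauses C1)) C2"
  by (induction C1 arbitrary: p) (auto simp: add.assoc)

lemma row_append: "row (S @ T) v = row S v @ row T v"
  by (simp add: row_def)

lemma entries_ge: "e \<in> set (entries p Cs) \<Longrightarrow> p \<le> snd e"
  by (induction Cs arbitrary: p) (fastforce simp: clause_entries_def)+

definition index_clause :: "nat \<Rightarrow> com" where
  "index_clause m = WhileLess rz rlen
     (Do (Decr rlen) ;; Do (Incr rc) ;; Do (Incr rc) ;; Do (Fetch rv rc) ;; insert_entry m)"

abbreviation "index_regs \<equiv> {rlen, rc, rv, ri, ru} :: nat set"

definition insert_time :: "nat \<Rightarrow> nat" where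
  "insert_time m = (m + 6) * m + 2 * m + 20"

lemma wp_index_clause:
  assumes z: "R rz = 0" and C: "holds M (Suc (R rc)) (encode_literals C)" "R rlen = length C"
    and c: "R rc + 2 * length C < R rbase" and p: "0 < R rp"
    and T: "indexed M (R rbase) m T" "0 \<notin> snd ` set T"
    and len: "\<And>v. length (row (T @ clause_entries (R rp) C) v) \<le> m"
    and Q: "\<And>t R' M'. t \<le> insert_time m * length C + 2 \<Longrightarrow> (\<forall>i. i \<notin> index_regs \<longrightarrow> R' i = R i) \<Longrightarrow>
      R' rc = R rc + 2 * length C \<Longrightarrow> indexed M' (R rbase) m (T @ clause_entries (R rp) C) \<Longrightarrow>
      (\<forall>i. i < R rbase \<longrightarrow> M' i = M i) \<Longrightarrow> Q t R' M'"
  shows "wp (index_clause m) Q R M"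
  unfolding index_clause_def
proof (rule wp_while[where p = "\<lambda>R' M'. insert_time m * R' rlen" and
    I = "\<lambda>R' M'. (\<forall>i. i \<notin> index_regs \<longrightarrow> R' i = R i) \<and> (\<forall>i. i < R rbase \<longrightarrow> M' i = M i) \<and>
      (\<exists>j \<le> length C. R' rlen = length C - j \<and> R' rc = R rc + 2 * j \<and>
        indexed M' (R rbase) m (T @ clause_entries (R rp) (take j C)))"], goal_cases)
  case 1
  show ?case
    by (intro conjI; (rule exI[of _ 0])?) (use C T in \<open>auto simp: clause_entries_def\<close>)
next
  case (2 R' M')
  then obtain j where j: "j \<le> length C" "R' rlen = length C - j" "R' rc = R rc + 2 * j"
    "indexed M' (R rbase) m (T @ clause_entries (R rp) (take j C))" by blast
  have R': "R' rz = 0" "R' rbase = R rbase" "R' rp = R rp" using 2(1) z by auto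
  have lt: "j < length C" using 2(2) R' j by simp
  have mem: "\<And>i. i < R rbase \<Longrightarrow> M' i = M i" using 2(1) by blast
  have "Suc (Suc (R rc + 2 * j)) < R rbase" using c lt by simp
  then have v: "M' (Suc (Suc (R rc + 2 * j))) = var_of (C ! j)"
    using holds_literal(2)[OF C(1) lt] mem by simp
  have snoc: "clause_entries (R rp) (take j C) @ [(var_of (C ! j), R rp)] = clause_entries (R rp) (take (Suc j) C)"
    using lt by (simp add: clause_entries_def take_Suc_conv_app_nth)
  have split: "clause_entries (R rp) C =
      clause_entries (R rp) (take j C) @ (var_of (C ! j), R rp) # clause_entries (R rp) (drop (Suc j) C)"
    using lt by (subst id_take_nth_drop[OF lt]) (simp add: clause_entries_def)
  \<comment> \<open>The pair about to be inserted is counted in the final row but not yet present,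
    so the bound on final rows leaves a free cell now.\<close>
  have "length (row (T @ clause_entries (R rp) (take j C)) (var_of (C ! j))) <
      length (row (T @ clause_entries (R rp) C) (var_of (C ! j)))"
    by (simp add: split row_def)
  then have room: "length (row (T @ clause_entries (R rp) (take j C)) (var_of (C ! j))) < m"
    using len order_less_le_trans by blast
  obtain s where s: "length C - j = Suc s" using lt by (metis Suc_diff_Suc)
  show ?case
    unfolding wp_Seq wp_Do
  proof (rule wp_insert_entry[where T = "T @ clause_entries (R rp) (take j C)"], goal_cases)
    case (5 t R2 M2)
    have rl: "R2 rlen = length C - Suc j" "R2 rc = R rc + 2 * Suc j" using 5(2) j by auto
    have frame: "\<forall>i. i \<notin> index_regs \<longrightarrow> R2 i = R i" using 5(2) 2(1) by auto
    have mem2: "\<forall>i. i < R rbase \<longrightarrow> M2 i = M i" using 5(4) mem R' by auto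
    have "t + 7 \<le> insert_time m" using 5(1) by (simp add: insert_time_def)
    then have t: "t + 7 + insert_time m * R2 rlen \<le> insert_time m * R' rlen"
      using rl(1) j(2) Suc_diff_Suc[OF lt] by (metis add_mono_thms_linordered_semiring(3) mult_Suc_right)
    have "indexed M2 (R rbase) m (T @ clause_entries (R rp) (take (Suc j) C))"
      using 5(3) R' v j(3) by (simp add: snoc)
    then have "\<exists>j \<le> length C. R2 rlen = length C - j \<and> R2 rc = R rc + 2 * j \<and>
        indexed M2 (R rbase) m (T @ clause_entries (R rp) (take j C))"
      using rl lt by (intro exI[of _ "Suc j"]) simp
    with frame mem2 t show ?case by (simp only: code.simps) simp
  qed (use R' j v room T p in \<open>auto simp: clause_entries_def\<close>)
next
  case (3 R' M' t)
  then obtain j where j: "j \<le> length C" "R' rlen = length C - j" "R' rc = R rc + 2 * j"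
    "indexed M' (R rbase) m (T @ clause_entries (R rp) (take j C))" by blast
  have "R' rz = 0" using 3(1) z by auto
  then have "j = length C" using 3(2) j by simp
  then show ?case using 3 j C(2) by (intro Q) auto
qed

text \<open>The pass covers the cells from 3 up to \<open>rn\<close> only, so the two unit clauses
  at 0 and \<open>rn\<close> are not indexed: a unit clause added for \<open>x\<close> enters a
  candidate only as its starting clause. It also makes all stored positions nonzero.\<close>

definition index :: "nat \<Rightarrow> com" where
  "index m = Do (Put rp 3) ;; WhileLess rp rn
     (Do (Fetch rlen rp) ;; Do (Copy rc rp) ;; index_clause m ;; Do (Incr rc) ;; Do (Copy rp rc))"

lemma wp_index:
  assumes z: "R rz = 0" and cs: "holds M 3 (encode_clauses cs)" "R rn = 3 + length (encode_clauses cs)"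
    and base: "R rn \<le> R rbase" "\<And>i. R rbase \<le> i \<Longrightarrow> M i = 0"
    and len: "\<And>v. length (row (entries 3 cs) v) \<le> m"
    and Q: "\<And>t R' M'. t \<le> (insert_time m + 10) * R rn + 4 \<Longrightarrow>
      (\<forall>i. i \<notin> insert rp index_regs \<longrightarrow> R' i = R i) \<Longrightarrow>
      indexed M' (R rbase) m (entries 3 cs) \<Longrightarrow> (\<forall>i. i < R rbase \<longrightarrow> M' i = M i) \<Longrightarrow> Q t R' M'"
  shows "wp (index m) Q R M"
  unfolding index_def wp_Seq wp_Do
proof (rule wp_while[where p = "\<lambda>R' M'. (insert_time m + 10) * (R rn - R' rp)" and
    I = "\<lambda>R' M'. (\<forall>i. i \<notin> insert rp index_regs \<longrightarrow> R' i = R i) \<and> (\<forall>i. i < R rbase \<longrightarrow> M' i = M i) \<and>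
      (\<exists>C1 C2. cs = C1 @ C2 \<and> R' rp = 3 + length (encode_clauses C1) \<and>
        indexed M' (R rbase) m (entries 3 C1))"], goal_cases)
  case 1
  show ?case
    by (intro conjI; (rule exI[of _ "[]"], rule exI[of _ cs])?)
       (use base in \<open>auto simp: indexed_def row_def\<close>)
next
  case (2 R' M')
  then obtain C1 C2 where I: "cs = C1 @ C2" "R' rp = 3 + length (encode_clauses C1)"
    "indexed M' (R rbase) m (entries 3 C1)" by blast
  have R': "R' rz = 0" "R' rn = R rn" "R' rbase = R rbase" using 2(1) z by auto
  obtain C C3 where C: "C2 = C # C3" using 2(2) I(1,2) R' cs(2) by (cases C2) auto
  have mem: "\<And>i. i < R rbase \<Longrightarrow> M' i = M i" using 2(1) by blast
  have le: "R' rp + length (encode_clause C) \<le> R rn" using I(1,2) C cs(2) by simp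
  have "holds M (R' rp) (encode_clause C)" using cs(1) I(1,2) C by simp
  then have enc: "holds M' (R' rp) (encode_clause C)"
    by (rule holds_cong) (use le base(1) mem in auto)
  have T: "entries 3 C1 @ clause_entries (R' rp) C = entries 3 (C1 @ [C])"
    by (simp add: entries_append I(2))
  have "length (row (entries 3 (C1 @ [C])) v) \<le> length (row (entries 3 cs) v)" for v
    by (simp add: I(1) C entries_append row_append)
  then have rows: "length (row (entries 3 (C1 @ [C])) v) \<le> m" for v using len order_trans by blast
  have nz: "0 \<notin> snd ` set (entries 3 C1)" using entries_ge by fastforce
  show ?case
    unfolding wp_Seq wp_Do
  proof (rule wp_index_clause[where T = "entries 3 C1" and C = C], goal_cases)
    case (9 t R2 M2)
    define X where "X = insert_time m + 10"
    have frame: "\<forall>i. i \<notin> insert rp index_regs \<longrightarrow> R2 i = R i" using 9(2) 2(1) by auto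
    have mem2: "\<forall>i. i < R rbase \<longrightarrow> M2 i = M i" using 9(5) mem R' by auto
    have rc: "R2 rc = R' rp + 2 * length C" using 9(3) by simp
    have "R rn - (R' rp + length (encode_clause C)) + length (encode_clause C) = R rn - R' rp"
      using le by linarith
    then have "X * (R rn - (R' rp + length (encode_clause C))) + X * length (encode_clause C) = X * (R rn - R' rp)"
      by (simp only: distrib_left[symmetric])
    moreover have "t + 7 \<le> X * length (encode_clause C)"
      using 9(1) by (simp add: X_def algebra_simps)
    ultimately have t: "t + 7 + X * (R rn - (R' rp + length (encode_clause C))) \<le> X * (R rn - R' rp)" by linarith
    have "indexed M2 (R rbase) m (entries 3 (C1 @ [C]))" using 9(4) R' T by simp
    then have "\<exists>D1 D2. cs = D1 @ D2 \<and> Suc (R2 rc) = 3 + length (encode_clauses D1) \<and>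
        indexed M2 (R rbase) m (entries 3 D1)"
      using I(1,2) C rc by (intro exI[of _ "C1 @ [C]"] exI[of _ C3]) simp
    then show ?case using t frame mem2 rc by (simp add: X_def)
  qed (use R' le base enc I rows[folded T] nz in \<open>auto simp: encode_clause_def\<close>)
next
  case (3 R' M' t)
  then obtain C1 C2 where I: "cs = C1 @ C2" "R' rp = 3 + length (encode_clauses C1)"
    "indexed M' (R rbase) m (entries 3 C1)" by blast
  have "R' rn = R rn" using 3(1) by auto
  then have "C2 = []" using 3(2) I(1,2) cs(2) by (cases C2) auto
  then have ix: "indexed M' (R rbase) m (entries 3 cs)" using I(1,3) by simp
  have "R rn - R' rp = 0" using 3(2) \<open>R' rn = _\<close> by simp
  then have "t \<le> (insert_time m + 10) * (R rn - 3) + 2" using 3(3) by simp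
  also have "\<dots> \<le> (insert_time m + 10) * R rn + 2" by (intro add_mono mult_le_mono2) simp_all
  finally have t: "t \<le> (insert_time m + 10) * R rn + 2" .
  have "\<forall>i. i \<notin> insert rp index_regs \<longrightarrow> R' i = R i" "\<forall>i. i < R rbase \<longrightarrow> M' i = M i"
    using 3(1) by blast+
  then show ?case using ix t by (intro Q) simp_all
qed

section \<open>The complete algorithm\<close>

text \<open>A square is easy to compute and large enough: it exceeds
  \<open>(k + 1) * (2 * k + 1)\<close>, the longest encoding of a candidate, and is at least
  \<open>m\<close>, \<open>k\<close> and the scratch space
  \<open>(k + 1) * (2 * k + 3)\<close>.\<close>

definition search_base :: "nat \<Rightarrow> nat \<Rightarrow> nat" where
  "search_base m k = (2 * k + m + 2)\<^sup>2"

text \<open>The exponent covers both enumerations: two digits for each of at most \<open>k\<close>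
  rounds, and one digit for each of at most \<open>k + 1\<close> clauses. It is the number whose
  square is the base, so that \<open>ry\<close> serves for both.\<close>

definition search_size :: "nat \<Rightarrow> nat \<Rightarrow> nat" where
  "search_size m k = search_base m k ^ (2 * k + m + 2)"

definition bounds :: "nat \<Rightarrow> com" where
  "bounds m = Do (Put ry (m + 2)) ;; Do (Copy rt rk) ;; advance ry rt ;; multiply rD ry ry ;;
     Do (Copy rDm rD) ;; Do (Decr rDm) ;; Do (Put rN 1) ;; Do (Copy rt ry) ;;
     WhileLess rz rt (Do (Decr rt) ;; multiply rc rN rD ;; Do (Copy rN rc))"

abbreviation "bounds_regs \<equiv> {ry, rt, rD, rDm, rN, ri, rj, rc} :: nat set"

lemma search_base_le_size: "2 * k + m + 2 \<le> search_base m k" "search_base m k \<le> search_size m k"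
proof -
  show "2 * k + m + 2 \<le> search_base m k" by (simp add: search_base_def power2_eq_square)
  then show "search_base m k \<le> search_size m k" by (simp add: search_size_def self_le_power)
qed

text \<open>Multiplying by repeated increments costs time proportional to the product. The powers of
  the base never exceed \<open>N\<close>, and their number is at most \<open>N\<close>, whence the
  quadratic bound.\<close>

lemma wp_bounds:
  assumes z: "R rz = 0"
    and Q: "\<And>t R'. t \<le> 60 * (search_size m (R rk))\<^sup>2 \<Longrightarrow> (\<forall>i. i \<notin> bounds_regs \<longrightarrow> R' i = R i) \<Longrightarrow>
      R' rD = search_base m (R rk) \<Longrightarrow> R' rDm = R' rD - 1 \<Longrightarrow> R' rN = search_size m (R rk) \<Longrightarrow> Q t R' M"
  shows "wp (bounds m) Q R M"
proof -
  define k y D N where "k = R rk" and "y = 2 * k + m + 2" and "D = search_base m k" and "N = search_size m k"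
  have D: "D = y * y" by (simp add: D_def search_base_def y_def power2_eq_square)
  have N: "N = D ^ y" by (simp add: N_def D_def search_size_def y_def)
  have le: "y \<le> D" "D \<le> N" "2 \<le> y" using search_base_le_size(1)[of k m] search_base_le_size(2)[of m k]
    by (simp_all add: y_def D_def N_def)
  show ?thesis
    unfolding bounds_def wp_Seq wp_Do
  proof (simp, rule wp_advance, goal_cases)
    case (5 t1)
    show ?case
    proof (rule wp_multiply, goal_cases)
      case (5 t2 R2)
      have ry: "R2 ry = y" using 5(3) by (simp add: y_def k_def)
      have R2: "R2 rz = 0" "R2 rD = D" "\<forall>i. i \<notin> bounds_regs \<longrightarrow> R2 i = R i"
        using 5 z by (auto simp: D y_def k_def algebra_simps)
      show ?case
      proof (rule wp_while[where p = "\<lambda>R' M'. (12 * N + 20) * R' rt" and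
          I = "\<lambda>R' M'. M' = M \<and> (\<forall>i. i \<notin> bounds_regs \<longrightarrow> R' i = R i) \<and> R' rD = D \<and> R' rDm = D - 1 \<and>
            R' rt \<le> y \<and> R' rN = D ^ (y - R' rt)"], goal_cases)
        case 1
        show ?case using R2 ry by auto
      next
        case (2 R' M')
        have R': "R' rz = 0" using 2(1) z by auto
        obtain j where j: "R' rt = Suc j" using 2(2) R' by (cases "R' rt") auto
        have e: "D ^ (y - Suc j) * D = D ^ (y - j)"
          using 2(1) j by (simp add: Suc_diff_Suc[symmetric] mult.commute)
        show ?case
          unfolding wp_Seq wp_Do
        proof (rule wp_multiply, goal_cases)
          case (5 t3 R3)
          have rc: "R3 rc = D ^ (y - j)" using 5(2) 2(1) j e by simp
          have "D ^ (y - j) \<le> D ^ y" using le by (intro power_increasing) auto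
          then have "D ^ (y - Suc j) * D \<le> N" by (simp add: e N)
          then have "12 * (D ^ (y - Suc j) * D) \<le> 12 * N" by (rule mult_le_mono2)
          moreover have "D ^ (y - Suc j) * (5 * D + 7) \<le> D ^ (y - Suc j) * (12 * D)"
            using le by (intro mult_le_mono2) simp
          moreover have "D ^ (y - Suc j) * (12 * D) = 12 * (D ^ (y - Suc j) * D)" by simp
          ultimately have "D ^ (y - Suc j) * (5 * D + 7) \<le> 12 * N" by linarith
          then have "t3 \<le> 12 * N + 4" using 5(1) 2(1) j by simp
          moreover have "R3 rt = j" using 5(3) j by auto
          ultimately show ?case using 5(3) 2(1) rc j by auto
        qed (use R' in auto)
      next
        case (3 R' M' t)
        have "R' rt = 0" using 3(1,2) z by auto
        moreover have "t1 \<le> 6 * y" "t2 \<le> y * (5 * y + 7) + 4"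
          using \<open>t1 \<le> _\<close> \<open>t2 \<le> _\<close> by (simp_all add: y_def k_def ac_simps)
        moreover have "y * (5 * y + 7) \<le> 12 * N\<^sup>2"
        proof -
          have "y * (5 * y + 7) \<le> N * (5 * N + 7 * N)" using le by (intro mult_le_mono add_mono) auto
          then show ?thesis by (simp add: power2_eq_square)
        qed
        moreover have "(12 * N + 20) * y \<le> 32 * N\<^sup>2"
        proof -
          have "(12 * N + 20) * y \<le> (12 * N + 20 * N) * N" using le by (intro mult_le_mono add_mono) auto
          then show ?thesis by (simp add: power2_eq_square)
        qed
        moreover have "6 * y \<le> 6 * N\<^sup>2" "2 \<le> N"
          using le self_le_power[of N 2] by auto
        moreover have "4 \<le> N\<^sup>2" using power_mono[of 2 N 2] le by simp
        moreover have "t \<le> (12 * N + 20) * y + 2" using 3(3) \<open>R' rt = 0\<close> ry by simp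
        ultimately have "t1 + t2 + t + 10 \<le> 60 * N\<^sup>2" by linarith
        moreover have "R' rN = N" using 3(1) \<open>R' rt = 0\<close> N by (metis diff_zero)
        ultimately show ?case
          using 3(1) by (simp, intro Q) (auto simp: N_def D_def k_def)
      qed
    qed (use z in auto)
  qed (use z in auto)
qed

definition emit :: "nat \<Rightarrow> com" where
  "emit r = Do (Save rwork r) ;; Do (Incr rwork)"

lemma wp_emit: "Q 2 (R(rwork := Suc (R rwork))) (M(R rwork := R r)) \<Longrightarrow> wp (emit r) Q R M"
  by (simp add: emit_def numeral_2_eq_2)

definition store_front :: com where
  "store_front = Do (Put rt 1) ;; Do (Save rz rt) ;; Do (Save rt rz) ;; Do (Put rt 2) ;; Do (Save rt rx)"

lemma wp_store_front:
  "R rz = 0 \<Longrightarrow> Q 5 (R(rt := 2)) (M(0 := 1, 1 := 0, 2 := R rx)) \<Longrightarrow> wp store_front Q R M"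
  by (simp add: store_front_def numeral_eq_Suc)

text \<open>
  The three leading input cells are turned into the encoding of the clause \<open>{Neg x}\<close>, and the clause
  \<open>{Pos x}\<close> is appended to the input, so that all clauses lie in one contiguous encoding.
\<close>

definition store_units :: com where
  "store_units = store_front ;; Do (Copy rwork rn) ;; Do (Put rt 1) ;; emit rt ;; emit rt ;; emit rx"

lemma wp_store_units:
  assumes "R rz = 0"
    and "Q 13 (R(rt := 1, rwork := R rn + 3)) (M(0 := 1, 1 := 0, 2 := R rx, R rn := 1,
      Suc (R rn) := 1, Suc (Suc (R rn)) := R rx))"
  shows "wp store_units Q R M"
  unfolding store_units_def wp_Seq
  apply (rule wp_store_front, fact, simp)
  apply (rule wp_emit, simp)
  apply (rule wp_emit, simp)
  apply (rule wp_emit, simp)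
  using assms(2) by (simp add: numeral_3_eq_3)

text \<open>\<open>k\<close> and \<open>x\<close> have to be fetched before
  \<open>store_units\<close> overwrites the leading cells. Adding \<open>N\<close> to the end of the
  clauses reserves the scratch area in front of the table.\<close>

definition header :: "nat \<Rightarrow> com" where
  "header m = Do (Fetch rk rz) ;; Do (Put rt 1) ;; Do (Fetch rx rt) ;; bounds m ;; store_units ;;
     Do (Copy rbase rwork) ;; Do (Copy rt rN) ;; add_to rbase rt"

lemma wp_header:
  assumes w: "w = [k, x, length cs] @ encode_clauses cs"
    and Q: "\<And>t R' M'. t \<le> 90 * (search_size m k)\<^sup>2 \<Longrightarrow> R' rn = length w \<Longrightarrow> R' rz = 0 \<Longrightarrow> R' rk = k \<Longrightarrow>
      R' rD = search_base m k \<Longrightarrow> R' rDm = R' rD - 1 \<Longrightarrow> R' rN = search_size m k \<Longrightarrow>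
      R' rwork = length w + 3 \<Longrightarrow> R' rbase = R' rwork + R' rN \<Longrightarrow>
      holds M' 0 (encode_clauses ([Neg x] # cs @ [[Pos x]])) \<Longrightarrow> (\<forall>i \<ge> length w + 3. M' i = 0) \<Longrightarrow> Q t R' M'"
  shows "wp (header m) Q (initial_regs w) (initial_mem w)"
proof -
  have cells: "initial_mem w 0 = k" "initial_mem w (Suc 0) = x" by (simp_all add: initial_mem_def w)
  have body: "holds (initial_mem w) 3 (encode_clauses cs)"
    by (auto simp: holds_def initial_mem_def w nth_append numeral_3_eq_3)
  have len: "length w = 3 + length (encode_clauses cs)" by (simp add: w)
  define N where "N = search_size m k"
  have "2 \<le> N" using search_base_le_size(1)[of k m] search_base_le_size(2)[of m k] by (simp add: N_def)
  then have N: "N \<le> N\<^sup>2" "4 \<le> N\<^sup>2" using self_le_power[of N 2] power_mono[of 2 N 2] by auto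
  show ?thesis
    unfolding header_def wp_Seq wp_Do
  proof (rule wp_bounds, goal_cases)
    case 1
    show ?case by (simp add: initial_regs_def)
  next
    case (2 t1 R1)
    have R1: "R1 rn = length w" "R1 rz = 0" "R1 rk = k" "R1 rx = x" "R1 rD = search_base m k"
      "R1 rDm = search_base m k - 1" "R1 rN = N" "t1 \<le> 60 * N\<^sup>2"
      using 2 by (auto simp: initial_regs_def cells N_def)
    let ?M = "(initial_mem w)(0 := 1, 1 := 0, 2 := x, length w := 1, Suc (length w) := 1, Suc (Suc (length w)) := x)"
    have "holds ?M 3 (encode_clauses cs)"
      by (rule holds_cong[OF body]) (auto simp: len)
    then have M: "holds ?M 0 (encode_clauses ([Neg x] # cs @ [[Pos x]]))"
      by (simp add: encode_clause_def len numeral_3_eq_3)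
    have zero: "\<forall>i \<ge> length w + 3. ?M i = 0" by (auto simp: initial_mem_def)
    show ?case
    proof (rule wp_store_units, goal_cases)
      case 2
      show ?case
      proof (simp add: R1, rule wp_add_to, goal_cases)
        case (5 t2)
        have "t2 \<le> 5 * N + 2" using 5 R1(7) by simp
        then have t: "t1 + t2 + 30 \<le> 90 * N\<^sup>2" using R1(8) N by linarith
        show ?case
          using t M zero R1(1-7) by (intro Q) (simp_all add: N_def)
      qed (use R1 in auto)
    qed (use R1 in auto)
  qed
qed

definition main :: "nat \<Rightarrow> com" where
  "main m = header m ;; index m ;; search m ;; Do (Copy rn rres)"


section \<open>Table entries as clause positions, and the run of the whole program\<close>

lemma in_entries:
  "(v, p) \<in> set (entries q cs) \<longleftrightarrow>
     (\<exists>C1 C C2. cs = C1 @ C # C2 \<and> p = q + length (encode_clauses C1) \<and> v \<in> var_of ` set C)"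
proof (induction cs arbitrary: q)
  case (Cons C cs)
  have "(v, p) \<in> set (entries q (C # cs)) \<longleftrightarrow> p = q \<and> v \<in> var_of ` set C \<or>
      (\<exists>C1 C' C2. cs = C1 @ C' # C2 \<and> p = q + length (encode_clauses (C # C1)) \<and> v \<in> var_of ` set C')"
  proof -
    have 1: "(v, p) \<in> set (clause_entries q C) \<longleftrightarrow> p = q \<and> v \<in> var_of ` set C"
      by (auto simp: clause_entries_def)
    have 2: "p = q + length (encode_clause C) + length (encode_clauses C1) \<longleftrightarrow>
        p = q + length (encode_clauses (C # C1))" for C1 by (simp add: add.assoc)
    show ?thesis by (simp only: entries.simps set_append Un_iff 1 2 Cons.IH)
  qed
  also have "\<dots> \<longleftrightarrow> (\<exists>C1 C' C2. C # cs = C1 @ C' # C2 \<and> p = q + length (encode_clauses C1) \<and> v \<in> var_of ` set C')"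
    (is "?L \<longleftrightarrow> ?R")
  proof
    assume ?L
    then show ?R
    proof (elim disjE exE conjE)
      fix C1 C' C2
      assume "cs = C1 @ C' # C2" "p = q + length (encode_clauses (C # C1))" "v \<in> var_of ` set C'"
      then show ?R by (intro exI[of _ "C # C1"] exI[of _ C'] exI[of _ C2]) simp
    next
      assume "p = q" "v \<in> var_of ` set C"
      then show ?R by (intro exI[of _ "[]"] exI[of _ C] exI[of _ cs]) simp
    qed
  next
    assume ?R
    then obtain C1 C' C2 where 1: "C # cs = C1 @ C' # C2" "p = q + length (encode_clauses C1)"
      "v \<in> var_of ` set C'" by blast
    show ?L
    proof (cases C1)
      case Nil
      then show ?thesis using 1 by simp
    next
      case (Cons a list)
      then show ?thesis using 1 by auto
    qed
  qed
  finally show ?case .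
qed simp

lemma row_set: "p \<in> set (row T v) \<longleftrightarrow> (v, p) \<in> set T"
  by (force simp: row_def)

definition padded :: "nat \<Rightarrow> literal list list \<Rightarrow> literal list list" where
  "padded x cs = [Neg x] # cs @ [[Pos x]]"

lemma entries_starts:
  assumes "(v, p) \<in> set (entries 3 cs)"
  shows "p \<in> starts (padded x cs)"
proof -
  obtain C1 C C2 where C: "cs = C1 @ C # C2" "p = 3 + length (encode_clauses C1)"
    using assms in_entries by blast
  then have "padded x cs = ([Neg x] # C1) @ C # (C2 @ [[Pos x]])" "p = length (encode_clauses ([Neg x] # C1))"
    by (simp_all add: padded_def)
  then show ?thesis unfolding starts_def by blast
qed

text \<open>The counterpart of \<open>indexed\<close> for offsets from the start of the table. For
  positive \<open>m\<close> all offsets are of the form \<open>m * v + i\<close> with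
  \<open>i < m\<close>, so \<open>T\<close> determines \<open>tab\<close> completely.\<close>

definition represents_occurrences :: "nat \<Rightarrow> (nat \<Rightarrow> nat) \<Rightarrow> (nat \<times> nat) list \<Rightarrow> bool" where
  "represents_occurrences m tab T \<longleftrightarrow>
     (\<forall>v i. i < m \<longrightarrow> tab (m * v + i) = (if i < length (row T v) then row T v ! i else 0))"

text \<open>The verdict of the program, stated without reference to machine or memory;
  \<open>accepts_iff\<close> compares it with backbones by purely combinatorial means.\<close>

definition accepts :: "nat \<Rightarrow> nat \<Rightarrow> nat \<Rightarrow> literal list list \<Rightarrow> (nat \<Rightarrow> nat) \<Rightarrow> (nat \<Rightarrow> literal list) \<Rightarrow> bool" where
  "accepts m k x cs tab cl \<longleftrightarrow> (\<exists>p \<in> starts (padded x cs). \<exists>g < search_size m k.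
     refuted (search_base m k) (search_size m k)
       (candidate m (search_base m k) k tab cl (rounds k (3 + length (encode_clauses cs)) p) p g))"

definition time_factor :: "nat \<Rightarrow> nat" where
  "time_factor m = insert_time m + 2 * m + 700"

lemma main_correct:
  assumes w: "w = [k, x, length cs] @ encode_clauses cs" and m: "0 < m"
    and len: "\<And>v. length (row (entries 3 cs) v) \<le> m"
    and cl: "\<And>C1 C C2. padded x cs = C1 @ C # C2 \<Longrightarrow> cl (length (encode_clauses C1)) = C"
  shows "\<exists>tab t R' M'. represents_occurrences m tab (entries 3 cs) \<and>
    ev (main m) (initial_regs w) (initial_mem w) t R' M' \<and>
    t + 3 \<le> time_factor m * search_size m k ^ 4 * length w \<and>
    R' 0 = (if accepts m k x cs tab cl then 1 else 0)"
proof -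
  define N D where "N = search_size m k" and "D = search_base m k"
  have lw: "length w = 3 + length (encode_clauses cs)" by (simp add: w)
  have "(k + 1) * (2 * k + 3) \<le> D" by (simp add: D_def search_base_def power2_eq_square algebra_simps)
  then have N: "(k + 1) * (2 * k + 3) \<le> N" using search_base_le_size(2)[of m k] unfolding D_def N_def by linarith
  have D0: "0 < D" using search_base_le_size(1)[of k m] by (simp add: D_def)
  have "wp (main m) (\<lambda>t R' M'. \<exists>tab. represents_occurrences m tab (entries 3 cs) \<and>
      t + 3 \<le> time_factor m * N ^ 4 * length w \<and> R' 0 = (if accepts m k x cs tab cl then 1 else 0))
      (initial_regs w) (initial_mem w)"
    unfolding main_def wp_Seq
  proof (rule wp_header[OF w], goal_cases)
    case (1 t1 R1 M1)
    have holds1: "holds M1 3 (encode_clauses cs)" using 1(10) by (simp add: encode_clause_def numeral_3_eq_3)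
    show ?case
    proof (rule wp_index[where cs = cs], goal_cases)
      case (7 t2 R2 M2)
      \<comment> \<open>The table is whatever the memory contains from \<open>rbase\<close> on after
        indexing; the search writes below \<open>rbase\<close> only.\<close>
      define tab where "tab j = M2 (R1 rbase + j)" for j
      have tab: "represents_occurrences m tab (entries 3 cs)"
        using 7(3) by (auto simp: indexed_def represents_occurrences_def tab_def add.assoc)
      have R2: "R2 rz = 0" "R2 rn = length w" "R2 rk = k" "R2 rD = D" "R2 rDm = D - 1" "R2 rN = N"
        "R2 rwork = length w + 3" "R2 rbase = R1 rbase" "R2 rbase = R2 rwork + N"
        using 7(2) 1 by (auto simp: N_def D_def)
      have lenp: "length (encode_clauses (padded x cs)) = length w + 3" by (simp add: padded_def lw)
      have base: "R1 rbase = length w + 3 + N" using 1 by (simp add: N_def)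
      have holds2: "holds M2 0 (encode_clauses (padded x cs))"
      proof (rule holds_cong)
        show "holds M1 0 (encode_clauses (padded x cs))" using 1(10) by (simp add: padded_def)
        show "M2 i = M1 i" if "i < 0 + length (encode_clauses (padded x cs))" for i
          using that 7(4) by (simp add: lenp base)
      qed
      have layout: "layout M2 (R2 rwork) (R2 rbase) tab cl (starts (padded x cs))"
        unfolding layout_def
      proof (intro conjI ballI allI impI)
        show "R2 rwork \<le> R2 rbase" using R2 by simp
        show "M2 (R2 rbase + j) = tab j" for j using R2 by (simp add: tab_def)
        fix p assume "p \<in> starts (padded x cs)"
        then obtain C1 C C2 where C: "padded x cs = C1 @ C # C2" "p = length (encode_clauses C1)"
          by (auto simp: starts_def)
        then have "cl p = C" using cl by simp
        then show "holds M2 p (encode_clause (cl p))" using holds2 C by simp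
        show "p + length (encode_clause (cl p)) \<le> R2 rwork"
          using lenp C \<open>cl p = C\<close> R2(7) by simp
      next
        fix j assume j: "tab j \<noteq> 0"
        \<comment> \<open>Division with remainder assigns every offset to a row, so each nonzero
          cell stems from a listed occurrence.\<close>
        have "tab (m * (j div m) + j mod m) =
            (if j mod m < length (row (entries 3 cs) (j div m)) then row (entries 3 cs) (j div m) ! (j mod m) else 0)"
          using tab m unfolding represents_occurrences_def by (meson mod_less_divisor)
        then have "tab j \<in> set (row (entries 3 cs) (j div m))" using j by (auto split: if_splits)
        then show "tab j \<in> starts (padded x cs)" using entries_starts row_set by blast
      qed
      show ?case
      proof (rule wp_search[where Cs = "padded x cs" and tab = tab and cl = cl], goal_cases)
        case (8 t3 R3 M3)
        have res: "R3 rres = (if accepts m k x cs tab cl then 1 else 0)"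
          using 8(2) R2 lw by (simp add: accepts_def D_def N_def)
        define n where "n = length w"
        define P where "P = N ^ 4 * n"
        have "2 \<le> N" "3 \<le> n" using search_base_le_size(1)[of k m] search_base_le_size(2)[of m k] lw
          by (simp_all add: N_def n_def)
        then have pos: "1 \<le> N ^ 4" "N\<^sup>2 \<le> N ^ 4" "1 \<le> n" by (auto intro: power_increasing)
        have P: "N\<^sup>2 \<le> P" "n \<le> P" "1 \<le> P"
          using mult_le_mono[OF pos(2,3)] mult_le_mono[OF pos(1) order_refl[of n]] mult_le_mono[OF pos(1,3)]
          by (simp_all add: P_def)
        have t1: "t1 \<le> 90 * P" using 1(1) P(1) by (simp add: N_def)
        have "t2 \<le> (insert_time m + 10) * n + 4" using 7(1) 1 by (simp add: n_def)
        also have "\<dots> \<le> (insert_time m + 10) * P + 4 * P"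
          using P by (intro add_mono mult_le_mono2) auto
        finally have t2: "t2 \<le> (insert_time m + 14) * P" by (simp add: algebra_simps)
        have "t3 \<le> ((m + 245) * N ^ 4 + 10) * (n + 3) + 4" using 8(1) R2 by (simp add: n_def)
        \<comment> \<open>The three leading words of the input give
          \<open>n + 3 \<le> 2 * n\<close>.\<close>
        also have "\<dots> \<le> ((m + 245) * N ^ 4 + 10 * N ^ 4) * (2 * n) + 4 * P"
          using pos P \<open>3 \<le> n\<close> by (intro add_mono mult_le_mono) auto
        also have "\<dots> = (2 * m + 514) * P" by (simp add: P_def algebra_simps)
        finally have t3: "t3 \<le> (2 * m + 514) * P" .
        have "t1 + t2 + t3 + 4 \<le> 90 * P + (insert_time m + 14) * P + (2 * m + 514) * P + 4 * P"
          using t1 t2 t3 P by linarith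
        also have "\<dots> \<le> time_factor m * P" by (simp add: time_factor_def algebra_simps)
        finally have "t1 + t2 + t3 + 4 \<le> time_factor m * N ^ 4 * length w" by (simp add: P_def n_def)
        then show ?case using tab res by auto
      qed (use R2 D0 layout holds2 N lenp in auto)
    qed (use 1 holds1 lw len in auto)
  qed
  then show ?thesis unfolding wp_def N_def by blast
qed

section \<open>Computability of the parameter bound\<close>

text \<open>A machine for the bound itself is required, with no limit on its running time, so the
  potential of the loop only has to yield termination. The exponent 8 arises from the factor
  \<open>N ^ 4\<close> in the running time, which gets squared in the bound on the values.\<close>

definition bound_program :: "nat \<Rightarrow> nat \<Rightarrow> com" where
  "bound_program m A = Do (Fetch rk rz) ;; bounds m ;; Do (Put rp A) ;; Do (Put rt 8) ;;
     WhileLess rz rt (Do (Decr rt) ;; multiply rc rp rN ;; Do (Copy rp rc)) ;; Do (Copy rn rp)"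

lemma computable_bound: "computable (\<lambda>k. A * search_size m k ^ 8)"
  unfolding computable_def
proof (intro exI[of _ "machine (bound_program m A)"] allI)
  fix k
  define N where "N = search_size m k"
  have "wp (bound_program m A) (\<lambda>t R' M'. R' 0 = A * N ^ 8) (initial_regs [k]) (initial_mem [k])"
    unfolding bound_program_def wp_Seq wp_Do
  proof (rule wp_bounds, goal_cases)
    case 1
    then show ?case by (simp add: initial_regs_def)
  next
    case (2 t R)
    have R: "R rz = 0" "R rN = N" using 2 by (auto simp: initial_regs_def initial_mem_def N_def)
    show ?case
    proof (rule wp_while[where p = "\<lambda>R' M'. R' rt * ((A * N ^ 8) * (5 * N + 7) + 10)" and
        I = "\<lambda>R' M'. R' rz = 0 \<and> R' rN = N \<and> R' rt \<le> 8 \<and> R' rp = A * N ^ (8 - R' rt)"], goal_cases)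
      case 1
      then show ?case using R by simp
    next
      case (2 R' M')
      obtain j where j: "R' rt = Suc j" using 2 by (cases "R' rt") auto
      have N1: "1 \<le> N" using search_base_le_size(1)[of k m] search_base_le_size(2)[of m k] by (simp add: N_def)
      have e: "N ^ (8 - Suc j) * N = N ^ (8 - j)" using 2(1) j by (simp add: Suc_diff_Suc[symmetric] mult.commute)
      show ?case
        unfolding wp_Seq wp_Do
      proof (rule wp_multiply, goal_cases)
        case (5 t R3)
        have "A * N ^ (8 - Suc j) \<le> A * N ^ 8" using N1 by (intro mult_le_mono2 power_increasing) auto
        then have "A * N ^ (8 - Suc j) * (5 * N + 7) \<le> A * N ^ 8 * (5 * N + 7)" by (rule mult_le_mono1)
        moreover have "t \<le> R' rp * (5 * R' rN + 7) + 4" using 5(1) by simp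
        moreover have "R' rp = A * N ^ (8 - Suc j)" "R' rN = N" using 2(1) unfolding j by blast+
        ultimately have "t \<le> A * N ^ 8 * (5 * N + 7) + 4" by (metis add_le_mono1 le_trans)
        moreover have "R3 rt = j" "R3 rN = N" "R3 rz = 0" using 5(3) 2(1) j by auto
        moreover have "R3 rc = A * N ^ (8 - j)" using 5(2) 2(1) j e by simp
        ultimately show ?case using 2(1) j by simp
      qed (use 2 in auto)
    next
      case (3 R' M' t)
      then show ?case by simp
    qed
  qed
  then obtain t R' M' where "ev (bound_program m A) (initial_regs [k]) (initial_mem [k]) t R' M'" "R' 0 = A * N ^ 8"
    unfolding wp_def by blast
  then have "computes_within (machine (bound_program m A)) [k] (t + 3) (A * N ^ 8)"
    using machine_correct by metis
  then show "\<exists>T. computes_within (machine (bound_program m A)) [k] T (A * search_size m k ^ 8)"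
    unfolding N_def by blast
qed

section \<open>Minimal unsatisfiable formulas\<close>

definition satisfiable :: "cnf \<Rightarrow> bool" where
  "satisfiable U \<longleftrightarrow> (\<exists>\<tau>. satisfies \<tau> U)"

definition min_unsat :: "cnf \<Rightarrow> bool" where
  "min_unsat U \<longleftrightarrow> \<not> satisfiable U \<and> (\<forall>U'. U' \<subset> U \<longrightarrow> satisfiable U')"

lemma satisfies_literal_cong: "\<tau> (var_of l) = \<tau>' (var_of l) \<Longrightarrow> satisfies_literal \<tau> l = satisfies_literal \<tau>' l"
  by (cases l) auto

lemma negate_negate [simp]: "negate (negate l) = l"
  by (cases l) auto

lemma negate_neq [simp]: "negate l \<noteq> l"
  by (cases l) auto

lemma satisfies_negate [simp]: "satisfies_literal \<tau> (negate l) \<longleftrightarrow> \<not> satisfies_literal \<tau> l"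
  by (cases l) auto

lemma ex_min_unsat:
  assumes "finite U" "\<not> satisfiable U"
  shows "\<exists>U' \<subseteq> U. min_unsat U'"
  using assms
proof (induction U rule: finite_psubset_induct)
  case (psubset U)
  show ?case
  proof (cases "min_unsat U")
    case False
    then obtain U' where "U' \<subset> U" "\<not> satisfiable U'" using psubset.prems by (auto simp: min_unsat_def)
    then show ?thesis using psubset.IH[of U'] by blast
  qed blast
qed

text \<open>Otherwise satisfying assignments of the two parts could be glued together.\<close>

lemma min_unsat_connected:
  assumes U: "min_unsat U" and A: "A \<subset> U" "A \<noteq> {}"
  shows "\<exists>K \<in> U - A. \<exists>L \<in> A. var_of ` K \<inter> var_of ` L \<noteq> {}"
proof (rule ccontr)
  assume sep: "\<not> ?thesis"
  have "satisfiable A" "satisfiable (U - A)" using U A unfolding min_unsat_def by blast+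
  then obtain \<tau>1 \<tau>2 where 1: "satisfies \<tau>1 A" and 2: "satisfies \<tau>2 (U - A)" by (auto simp: satisfiable_def)
  define \<tau> where "\<tau> v = (if v \<in> vars A then \<tau>1 v else \<tau>2 v)" for v
  have "\<exists>l\<in>K. satisfies_literal \<tau> l" if K: "K \<in> U" for K
  proof (cases "K \<in> A")
    case True
    then obtain l where l: "l \<in> K" "satisfies_literal \<tau>1 l" using 1 by (auto simp: satisfies_def)
    then have "var_of l \<in> vars A" using True by (auto simp: vars_def)
    then show ?thesis using l satisfies_literal_cong[of \<tau> l \<tau>1] by (auto simp: \<tau>_def)
  next
    case False
    then obtain l where l: "l \<in> K" "satisfies_literal \<tau>2 l" using 2 K by (auto simp: satisfies_def)
    then have "var_of l \<notin> vars A" using sep K False unfolding vars_def by blast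
    then show ?thesis using l satisfies_literal_cong[of \<tau> l \<tau>2] by (auto simp: \<tau>_def)
  qed
  then have "satisfiable U" by (auto simp: satisfiable_def satisfies_def)
  then show False using U by (simp add: min_unsat_def)
qed

lemma inj_on_var_of: "is_clause K \<Longrightarrow> inj_on var_of K"
  unfolding inj_on_def is_clause_def by (metis literal.exhaust_sel literal.sel)

text \<open>
  An assignment satisfying the other clauses needs at most one literal in each of them, so it can
  be changed on a variable of \<open>K\<close> if \<open>K\<close> has as many variables as there are clauses.
\<close>

lemma min_unsat_width:
  assumes U: "min_unsat U" "finite U" and K: "K \<in> U" "is_clause K"
  shows "card K < card U"
proof (rule ccontr)
  assume large: "\<not> ?thesis"
  have "satisfiable (U - {K})" using U K unfolding min_unsat_def by blast
  then obtain \<tau> where "satisfies \<tau> (U - {K})" by (auto simp: satisfiable_def)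
  then have "\<forall>L \<in> U - {K}. \<exists>l. l \<in> L \<and> satisfies_literal \<tau> l" by (auto simp: satisfies_def)
  then obtain f where f: "\<And>L. L \<in> U - {K} \<Longrightarrow> f L \<in> L \<and> satisfies_literal \<tau> (f L)" by metis
  define V where "V = var_of ` f ` (U - {K})"
  have "card V \<le> card (f ` (U - {K}))" unfolding V_def using U by (intro card_image_le) auto
  also have "\<dots> \<le> card (U - {K})" using U by (intro card_image_le) auto
  also have "\<dots> < card U" using U K by (intro psubset_card_mono) auto
  finally have "card V < card K" using large by linarith
  then have "card V < card (var_of ` K)" using inj_on_var_of[OF K(2)] by (simp add: card_image)
  then have "\<not> var_of ` K \<subseteq> V" using card_mono[of V "var_of ` K"] U by (auto simp: V_def)
  then obtain l where l: "l \<in> K" "var_of l \<notin> V" by blast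
  define \<tau>' where "\<tau>' = \<tau>(var_of l := (l = Pos (var_of l)))"
  have "satisfies_literal \<tau>' l" by (cases l) (auto simp: \<tau>'_def)
  moreover have "satisfies_literal \<tau>' (f L)" if "L \<in> U - {K}" for L
  proof -
    have "var_of (f L) \<in> V" using that by (auto simp: V_def)
    then have "var_of (f L) \<noteq> var_of l" using l(2) by auto
    then show ?thesis using f[OF that] satisfies_literal_cong[of \<tau>' "f L" \<tau>] by (simp add: \<tau>'_def)
  qed
  ultimately have "satisfies \<tau>' U" using l(1) f unfolding satisfies_def by (metis Diff_iff singletonD)
  then show False using U by (auto simp: min_unsat_def satisfiable_def)
qed

section \<open>Correctness of the search\<close>

abbreviation "formula \<psi> \<equiv> set (map set \<psi>)"

section \<open>Literal choices and satisfiability\<close>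

text \<open>Every new literal is compared with all earlier ones, so the set of all selected literals
  is consistent, and it meets every clause by construction.\<close>

lemma choice_sound:
  assumes "choice D q \<psi> S" "\<forall>l \<in> set S. negate l \<notin> set S"
  shows "\<exists>T. set S \<subseteq> T \<and> (\<forall>l \<in> T. negate l \<notin> T) \<and> (\<forall>C \<in> set \<psi>. set C \<inter> T \<noteq> {})"
  using assms
proof (induction D q \<psi> S rule: choice.induct)
  case (2 D q C \<psi> S)
  define l where "l = C ! (q mod D)"
  have l: "l \<in> set C" "negate l \<notin> set S" "choice D (q div D) \<psi> (S @ [l])"
    using 2(2) by (auto simp: l_def)
  have "\<forall>l' \<in> set (S @ [l]). negate l' \<notin> set (S @ [l])"
    using 2(3) l(2) by auto
  then obtain T where "set (S @ [l]) \<subseteq> T" "\<forall>l \<in> T. negate l \<notin> T" "\<forall>C \<in> set \<psi>. set C \<inter> T \<noteq> {}"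
    using 2(1) l(3) unfolding l_def by blast
  then show ?case using l(1) by (intro exI[of _ T]) auto
qed auto

text \<open>A satisfying assignment marks a true literal in each clause, and true literals never
  conflict. Their indices are the digits of \<open>q\<close>, with that of the first clause in the
  lowest place.\<close>

lemma choice_complete:
  assumes "\<forall>C \<in> set \<psi>. \<exists>l \<in> set C. satisfies_literal \<tau> l" "\<forall>l \<in> set S. satisfies_literal \<tau> l"
    "\<forall>C \<in> set \<psi>. length C \<le> D" "0 < D"
  shows "\<exists>q < D ^ length \<psi>. choice D q \<psi> S"
  using assms
proof (induction \<psi> arbitrary: S)
  case (Cons C \<psi>)
  then obtain a where a: "a < length C" "satisfies_literal \<tau> (C ! a)" by (auto simp: in_set_conv_nth)
  obtain q where q: "q < D ^ length \<psi>" "choice D q \<psi> (S @ [C ! a])"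
    using Cons.IH[of "S @ [C ! a]"] Cons.prems a by auto
  have aD: "a < D" using a(1) Cons.prems by auto
  have "D * q + a < D * Suc q" using aD by simp
  also have "\<dots> \<le> D * D ^ length \<psi>" using q(1) by (intro mult_le_mono2) simp
  finally have "D * q + a < D ^ length (C # \<psi>)" by simp
  moreover have "negate (C ! a) \<notin> set S" using Cons.prems(2) a(2) by auto
  then have "choice D (D * q + a) (C # \<psi>) S" using a(1) aD q(2) by simp
  ultimately show ?case by blast
qed auto

lemma refuted_iff:
  assumes "\<forall>C \<in> set \<psi>. length C \<le> D" "0 < D" "D ^ length \<psi> \<le> N"
  shows "refuted D N \<psi> \<longleftrightarrow> \<not> satisfiable (formula \<psi>)"
proof
  assume r: "refuted D N \<psi>"
  show "\<not> satisfiable (formula \<psi>)"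
  proof
    assume "satisfiable (formula \<psi>)"
    then obtain \<tau> where "\<forall>C \<in> set \<psi>. \<exists>l \<in> set C. satisfies_literal \<tau> l"
      by (auto simp: satisfiable_def satisfies_def)
    then obtain q where "q < D ^ length \<psi>" "choice D q \<psi> []"
      using choice_complete[of \<psi> \<tau> "[]" D] assms by auto
    then show False using r assms(3) by (auto simp: refuted_def)
  qed
next
  assume u: "\<not> satisfiable (formula \<psi>)"
  have False if c: "choice D h \<psi> []" for h
  proof -
    obtain T where T: "\<forall>l \<in> T. negate l \<notin> T" "\<forall>C \<in> set \<psi>. set C \<inter> T \<noteq> {}"
      using choice_sound[OF c] by auto
    \<comment> \<open>The consistent set \<open>T\<close> is read as an assignment; variables not
      occurring in \<open>T\<close> become false.\<close>
    have "satisfies_literal (\<lambda>v. Pos v \<in> T) l" if "l \<in> T" for l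
      using T(1) that by (cases l) force+
    then have "satisfies (\<lambda>v. Pos v \<in> T) (formula \<psi>)" using T(2) unfolding satisfies_def by fastforce
    then show False using u by (auto simp: satisfiable_def)
  qed
  then show "refuted D N \<psi>" by (auto simp: refuted_def)
qed

section \<open>Reaching clause sets by extension\<close>

text \<open>Nothing is assumed about the digits: whatever they select, a round adds at most one
  clause, and this clause comes from a nonzero table entry.\<close>

lemma chain_sound:
  "\<exists>\<nu>. chain m D k tab cl r q \<psi> = \<psi> @ \<nu> \<and> length \<nu> \<le> r \<and> set \<nu> \<subseteq> cl ` (range tab - {0})"
proof (induction r arbitrary: q \<psi>)
  case (Suc r)
  define \<psi>1 where "\<psi>1 = extend m k tab cl (q mod D) (q div D mod D) \<psi>"
  have "\<psi>1 = \<psi> \<or> (\<exists>j. tab j \<noteq> 0 \<and> \<psi>1 = \<psi> @ [cl (tab j)])"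
    unfolding \<psi>1_def extend_def Let_def by (simp split: if_split) blast
  then obtain \<nu>1 where 1: "\<psi>1 = \<psi> @ \<nu>1" "length \<nu>1 \<le> 1" "set \<nu>1 \<subseteq> cl ` (range tab - {0})"
  proof (elim disjE exE conjE, goal_cases)
    case 1
    then show ?case by (intro 1(1)[of "[]"]) auto
  next
    case (2 j)
    then show ?case by (intro 2(1)[of "[cl (tab j)]"]) auto
  qed
  obtain \<nu>2 where 2: "chain m D k tab cl r (q div D div D) \<psi>1 = \<psi>1 @ \<nu>2" "length \<nu>2 \<le> r"
      "set \<nu>2 \<subseteq> cl ` (range tab - {0})"
    using Suc.IH by blast
  show ?case using 1 2 by (intro exI[of _ "\<nu>1 @ \<nu>2"]) (auto simp: \<psi>1_def[symmetric])
qed auto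

lemma in_encode_literals: "l \<in> set C \<Longrightarrow> var_of l \<in> set (encode_literals C)"
  by (force simp: encode_literal_eq)

text \<open>By \<open>min_unsat_connected\<close>, as long as clauses of \<open>U\<close> are
  missing, one of them shares a variable with the list. That variable stands in some cell of the
  encoding, which gives one digit, and the table column of the missing clause gives the
  other.\<close>

lemma chain_complete:
  assumes U: "min_unsat U" "finite U"
    and D: "(k + 1) * (2 * k + 1) < D" "m \<le> D"
    and \<psi>: "formula \<psi> \<subseteq> U" "\<psi> \<noteq> []" "\<forall>C\<in>set \<psi>. length C \<le> k" "length \<psi> + r \<le> k + 1"
    and r: "card (U - formula \<psi>) \<le> r"
    and next_clause: "\<And>K v. K \<in> U - formula \<psi> \<Longrightarrow> v \<in> var_of ` K \<Longrightarrow>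
      \<exists>a<m. tab (m * v + a) \<noteq> 0 \<and> set (cl (tab (m * v + a))) = K \<and> length (cl (tab (m * v + a))) \<le> k"
  shows "\<exists>q < D ^ (2 * r). formula (chain m D k tab cl r q \<psi>) = U"
  using \<psi> r next_clause
proof (induction r arbitrary: \<psi>)
  case 0
  then have "U - formula \<psi> = {}" using U(2) by simp
  then have "formula \<psi> = U" using 0(1) by blast
  then show ?case by simp
next
  case (Suc r)
  have "length (encode_clauses \<psi>) \<le> length \<psi> * (2 * k + 1)" using Suc.prems(3) by (rule length_encode_clauses_le)
  also have "\<dots> \<le> (k + 1) * (2 * k + 1)" using Suc.prems(4) by (intro mult_le_mono1) simp
  finally have E: "length (encode_clauses \<psi>) < D" using D(1) by linarith
  \<comment> \<open>The digits \<open>b\<close> and \<open>a\<close> of this round are put below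
    those of the number \<open>q\<close> for the remaining rounds.\<close>
  have code: "\<exists>q' < D ^ (2 * Suc r). formula (chain m D k tab cl (Suc r) q' \<psi>) = U"
    if "b < D" "a < D" "q < D ^ (2 * r)" "formula (chain m D k tab cl r q (extend m k tab cl b a \<psi>)) = U" for a b q
  proof (intro exI[of _ "D * (D * q + a) + b"] conjI)
    have "D * q + a < D * Suc q" using that by simp
    also have "\<dots> \<le> D * D ^ (2 * r)" using that(3) by (intro mult_le_mono2) simp
    finally have "Suc (D * q + a) \<le> D * D ^ (2 * r)" by simp
    have "D * (D * q + a) + b < D * Suc (D * q + a)" using that by simp
    also have "\<dots> \<le> D * (D * D ^ (2 * r))" using \<open>Suc (D * q + a) \<le> _\<close> by (intro mult_le_mono2)
    finally show "D * (D * q + a) + b < D ^ (2 * Suc r)" by (simp add: mult.assoc)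
  qed (use that in simp)
  show ?case
  proof (cases "formula \<psi> = U")
    case True
    then have "\<exists>q < D ^ (2 * r). formula (chain m D k tab cl r q \<psi>) = U"
      using Suc.prems by (intro Suc.IH) auto
    \<comment> \<open>An idle round: this cell digit points just past the encoding. It is still a
      digit because the first bound on \<open>D\<close> is strict.\<close>
    moreover have "extend m k tab cl (length (encode_clauses \<psi>)) 0 \<psi> = \<psi>" by (simp add: extend_def)
    ultimately show ?thesis using code[of "length (encode_clauses \<psi>)" 0] E by auto
  next
    case False
    have sub: "formula \<psi> \<subset> U" "formula \<psi> \<noteq> {}" using False Suc.prems(1,2) by auto
    obtain K L where K: "K \<in> U - formula \<psi>" and L: "L \<in> formula \<psi>" and "var_of ` K \<inter> var_of ` L \<noteq> {}"
      using min_unsat_connected[OF U(1) sub] by blast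
    then obtain u where u: "u \<in> var_of ` K" "u \<in> var_of ` L" by (meson disjoint_iff)
    from u(2) obtain l where "l \<in> L" "u = var_of l" by (elim imageE)
    with u(1) have l: "l \<in> L" "var_of l \<in> var_of ` K" by simp_all
    obtain C where C: "C \<in> set \<psi>" "set C = L" using L by auto
    have "var_of l \<in> set (encode_clauses \<psi>)"
      using C l(1) in_encode_literals[of l C] by (auto simp: encode_clause_def)
    then obtain b where b: "b < length (encode_clauses \<psi>)" "encode_clauses \<psi> ! b = var_of l"
      by (auto simp only: in_set_conv_nth)
    define v where "v = var_of l"
    obtain a where a: "a < m" "tab (m * v + a) \<noteq> 0" "set (cl (tab (m * v + a))) = K"
        "length (cl (tab (m * v + a))) \<le> k"
      using Suc.prems(6)[OF K l(2)] by (auto simp: v_def)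
    define C' where "C' = cl (tab (m * v + a))"
    have ext: "extend m k tab cl b a \<psi> = \<psi> @ [C']"
      using a b by (simp add: extend_def Let_def v_def C'_def)
    have K': "set C' = K" using a(3) by (simp add: C'_def)
    have "card (U - insert K (formula \<psi>)) < card (U - formula \<psi>)"
      using K U(2) by (intro psubset_card_mono) auto
    then have "\<exists>q < D ^ (2 * r). formula (chain m D k tab cl r q (\<psi> @ [C'])) = U"
      using Suc.prems a(4) K unfolding C'_def[symmetric]
      by (intro Suc.IH) (auto simp: K')
    then show ?thesis using code[of b a] ext b(1) E a(1) D(2) by auto
  qed
qed

section \<open>Bounded occurrences and positions of clauses\<close>

lemma length_row_entries:
  "length (row (entries q cs) v) = sum_list (map (\<lambda>C. length (filter (\<lambda>l. var_of l = v) C)) cs)"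
proof (induction cs arbitrary: q)
  case (Cons C cs)
  have "length (row (clause_entries q C) v) = length (filter (\<lambda>l. var_of l = v) C)"
    by (simp add: row_def clause_entries_def filter_map comp_def)
  then show ?case by (simp add: row_append Cons.IH)
qed (simp add: row_def)

text \<open>A clause contains no complementary pair and its listing has no repetition, so it
  contributes at most one entry to the row of \<open>v\<close>. As the listed clauses are distinct,
  the row is no longer than the number of clauses containing \<open>v\<close>; it is empty for
  variables outside the formula.\<close>

lemma length_row_le:
  assumes \<phi>: "\<phi> \<in> VO d" and cs: "clause_listing \<phi> cs"
  shows "length (row (entries q cs) v) \<le> nat d"
proof -
  have clause: "is_clause (set C)" "distinct C" if "C \<in> set cs" for C
    using that \<phi> cs by (auto simp: VO_def is_cnf_def clause_listing_def)
  have one: "length (filter (\<lambda>l. var_of l = v) C) \<le> (if v \<in> var_of ` set C then 1 else 0)" if "C \<in> set cs" for C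
  proof -
    have "length (filter (\<lambda>l. var_of l = v) C) = card {l \<in> set C. var_of l = v}"
      using clause[OF that] by (simp add: distinct_length_filter Int_def conj_commute)
    also have "\<dots> = card (var_of ` {l \<in> set C. var_of l = v})"
      using inj_on_var_of[OF clause(1)[OF that]] by (subst card_image) (auto simp: inj_on_def)
    also have "var_of ` {l \<in> set C. var_of l = v} = (if v \<in> var_of ` set C then {v} else {})" by auto
    finally show ?thesis by (simp split: if_splits)
  qed
  have "length (row (entries q cs) v) \<le> sum_list (map (\<lambda>C. if v \<in> var_of ` set C then 1 else 0) cs)"
    unfolding length_row_entries by (intro sum_list_mono one)
  also have "\<dots> = length (filter (\<lambda>C. v \<in> var_of ` set C) cs)"
    by (induction cs) auto
  also have "\<dots> = length (filter (\<lambda>K. v \<in> var_of ` K) (map set cs))"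
    by (simp add: filter_map comp_def)
  also have "\<dots> = card ({K. v \<in> var_of ` K} \<inter> set (map set cs))"
    using cs by (intro distinct_length_filter) (simp add: clause_listing_def)
  also have "\<dots> = card {K \<in> \<phi>. v \<in> var_of ` K}"
    using cs by (auto simp: clause_listing_def intro!: arg_cong[of _ _ card])
  also have "\<dots> \<le> nat d"
  proof (cases "v \<in> vars \<phi>")
    case True
    then have "int (card {K \<in> \<phi>. v \<in> var_of ` K}) \<le> d" using \<phi> by (auto simp: VO_def)
    then show ?thesis by linarith
  next
    case False
    then have "{K \<in> \<phi>. v \<in> var_of ` K} = {}" by (auto simp: vars_def)
    then show ?thesis by (simp only: card.empty le0)
  qed
  finally show ?thesis .
qed

definition clause_at :: "literal list list \<Rightarrow> nat \<Rightarrow> literal list" where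
  "clause_at Cs p = (SOME C. \<exists>C1 C2. Cs = C1 @ C # C2 \<and> p = length (encode_clauses C1))"

text \<open>Even an empty clause occupies one cell, for its length, so different places in the list
  have different positions.\<close>

lemma clause_position_unique:
  assumes "C1 @ C # C2 = D1 @ E # D2" "length (encode_clauses C1) = length (encode_clauses D1)"
  shows "C = E"
proof -
  have nil: "us = []" if "length (encode_clauses us) = 0" for us
    using length_le_encode_clauses[of us] unfolding that by simp
  obtain us where "C1 = D1 @ us \<and> us @ C # C2 = E # D2 \<or> C1 @ us = D1 \<and> C # C2 = us @ E # D2"
    using assms(1) unfolding append_eq_append_conv2 by blast
  then show ?thesis
  proof
    assume us: "C1 = D1 @ us \<and> us @ C # C2 = E # D2"
    then have "us = []" using assms(2) by (intro nil) simp
    then show ?thesis using us by simp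
  next
    assume us: "C1 @ us = D1 \<and> C # C2 = us @ E # D2"
    then have "length (encode_clauses us) = 0" using assms(2) by (metis add_eq_self_zero concat_append length_append map_append)
    then have "us = []" by (rule nil)
    then show ?thesis using us by simp
  qed
qed

lemma clause_at_eq: "clause_at (C1 @ C # C2) (length (encode_clauses C1)) = C"
proof -
  let ?P = "\<lambda>E. \<exists>D1 D2. C1 @ C # C2 = D1 @ E # D2 \<and> length (encode_clauses C1) = length (encode_clauses D1)"
  have "?P (SOME E. ?P E)" by (rule someI[of ?P C]) blast
  then have "?P (clause_at (C1 @ C # C2) (length (encode_clauses C1)))" by (simp only: clause_at_def)
  then show ?thesis using clause_position_unique[symmetric] by blast
qed

lemma entails_unit:
  "entails U {{Pos x}} \<longleftrightarrow> \<not> satisfiable (insert {Neg x} U)"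
  "entails U {{Neg x}} \<longleftrightarrow> \<not> satisfiable (insert {Pos x} U)"
proof -
  have "satisfies \<tau> {{l}} \<longleftrightarrow> satisfies_literal \<tau> l"
    "satisfies \<tau> (insert {l} U) \<longleftrightarrow> satisfies_literal \<tau> l \<and> satisfies \<tau> U" for \<tau> l
    by (simp_all add: satisfies_def)
  then show "entails U {{Pos x}} \<longleftrightarrow> \<not> satisfiable (insert {Neg x} U)"
    "entails U {{Neg x}} \<longleftrightarrow> \<not> satisfiable (insert {Pos x} U)"
    by (auto simp: entails_def satisfiable_def)
qed

lemma is_backbone_iff:
  "is_backbone k \<phi> x \<longleftrightarrow>
    (\<exists>\<phi>' \<subseteq> \<phi>. card \<phi>' \<le> k \<and> (\<exists>l \<in> {Neg x, Pos x}. \<not> satisfiable (insert {l} \<phi>')))"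
  by (simp add: is_backbone_def entails_unit)

lemma satisfiable_subset: "satisfiable U \<Longrightarrow> V \<subseteq> U \<Longrightarrow> satisfiable V"
  unfolding satisfiable_def satisfies_def by blast

lemma starts_padded:
  "starts (padded x cs) = {0, 3 + length (encode_clauses cs)} \<union> (\<lambda>p. 3 + p) ` starts cs"
proof -
  have "padded x cs = [[Neg x]] @ cs @ [[Pos x]]" by (simp add: padded_def)
  moreover have "length (encode_clauses [[l]]) = 3" for l by (simp add: encode_clause_def encode_literal_eq)
  ultimately show ?thesis
    by (simp only: starts_append starts_single image_Un image_insert image_empty image_image) auto
qed

section \<open>The search decides local backbones\<close>

lemma accepts_iff:
  assumes \<phi>: "\<phi> \<in> VO d" and cs: "clause_listing \<phi> cs" and k: "1 \<le> k" and m: "m = nat d" "0 < m"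
    and tab: "represents_occurrences m tab (entries 3 cs)"
  shows "accepts m k x cs tab (clause_at (padded x cs)) \<longleftrightarrow> is_backbone k \<phi> x"
proof -
  define cl where "cl = clause_at (padded x cs)"
  define n where "n = 3 + length (encode_clauses cs)"
  define D N where "D = search_base m k" and "N = search_size m k"
  have listing: "\<phi> = formula cs" "\<And>C. C \<in> set cs \<Longrightarrow> distinct C" using cs by (auto simp: clause_listing_def)
  have clauses: "\<And>K. K \<in> \<phi> \<Longrightarrow> is_clause K" "finite \<phi>" using \<phi> by (auto simp: VO_def is_cnf_def)
  have D: "(k + 1) * (2 * k + 1) < D" "m \<le> D" "k \<le> D" "0 < D"
    by (simp_all add: D_def search_base_def power2_eq_square algebra_simps)
  have N: "D ^ i \<le> N" if "i \<le> 2 * k + m + 2" for i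
    unfolding N_def search_size_def D_def[symmetric] using that D(4) by (intro power_increasing) auto
  have cl_front: "cl 0 = [Neg x]"
    using clause_at_eq[of "[]" "[Neg x]" "cs @ [[Pos x]]"] by (simp add: cl_def padded_def)
  have cl_back: "cl n = [Pos x]"
    using clause_at_eq[of "[Neg x] # cs" "[Pos x]" "[]"] by (simp add: cl_def padded_def n_def)
  have cl_mid: "cl (3 + length (encode_clauses C1)) = C" if "cs = C1 @ C # C2" for C1 C C2
    using clause_at_eq[of "[Neg x] # C1" C "C2 @ [[Pos x]]"] that by (simp add: cl_def padded_def)
  have len: "length (row (entries 3 cs) v) \<le> m" for v using length_row_le[OF \<phi> cs] m by simp
  have cl_tab: "cl (tab j) \<in> set cs" if "tab j \<noteq> 0" for j
  proof -
    have "tab (m * (j div m) + j mod m) =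
        (if j mod m < length (row (entries 3 cs) (j div m)) then row (entries 3 cs) (j div m) ! (j mod m) else 0)"
      using tab m(2) unfolding represents_occurrences_def by (meson mod_less_divisor)
    then have "tab j \<in> set (row (entries 3 cs) (j div m))" using that by (auto split: if_splits)
    then obtain C1 C C2 where "cs = C1 @ C # C2" "tab j = 3 + length (encode_clauses C1)"
      unfolding row_set in_entries by blast
    then show ?thesis using cl_mid by simp
  qed
  have occurrence: "\<exists>a<m. tab (m * v + a) \<noteq> 0 \<and> set (cl (tab (m * v + a))) = K \<and> length (cl (tab (m * v + a))) = card K"
    if K: "K \<in> \<phi>" and v: "v \<in> var_of ` K" for K v
  proof -
    obtain C where C: "C \<in> set cs" "set C = K" using K listing by auto
    then obtain C1 C2 where split: "cs = C1 @ C # C2" by (meson split_list)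
    define p where "p = 3 + length (encode_clauses C1)"
    have "(v, p) \<in> set (entries 3 cs)" unfolding in_entries using split p_def v C(2) by blast
    then have "p \<in> set (row (entries 3 cs) v)" by (simp add: row_set)
    then obtain a where a: "a < length (row (entries 3 cs) v)" "row (entries 3 cs) v ! a = p"
      by (auto simp only: in_set_conv_nth)
    then have "a < m" using len order_less_le_trans by blast
    then have "tab (m * v + a) = p" using tab a by (simp add: represents_occurrences_def)
    moreover have "cl p = C" using cl_mid[OF split] by (simp add: p_def)
    moreover have "length C = card K" using C listing(2) by (metis distinct_card)
    ultimately show ?thesis using \<open>a < m\<close> C(2) by (intro exI[of _ a]) (simp add: p_def)
  qed
  have rounds_le: "rounds k n p \<le> k" for p by (simp add: rounds_def)
  have refuted: "refuted D N (candidate m D k tab cl (rounds k n p) p g) \<longleftrightarrow>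
      \<not> satisfiable (formula (candidate m D k tab cl (rounds k n p) p g))" for p g
  proof (rule refuted_iff)
    define \<psi>0 where "\<psi>0 = (if length (cl p) \<le> k then [cl p] else [])"
    have "(\<forall>C\<in>set (candidate m D k tab cl (rounds k n p) p g). length C \<le> k) \<and>
        length (candidate m D k tab cl (rounds k n p) p g) \<le> length \<psi>0 + rounds k n p"
      unfolding candidate_def \<psi>0_def by (rule chain_bounds) auto
    moreover have "length \<psi>0 \<le> 1" by (simp add: \<psi>0_def)
    ultimately have b: "\<forall>C\<in>set (candidate m D k tab cl (rounds k n p) p g). length C \<le> k"
        "length (candidate m D k tab cl (rounds k n p) p g) \<le> k + 1"
      using rounds_le[of p] by auto
    then show "\<forall>C\<in>set (candidate m D k tab cl (rounds k n p) p g). length C \<le> D"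
      using D(3) le_trans by blast
    show "D ^ length (candidate m D k tab cl (rounds k n p) p g) \<le> N" using b(2) by (intro N) simp
  qed (rule D)
  have accepts: "accepts m k x cs tab cl \<longleftrightarrow> (\<exists>p \<in> starts (padded x cs). \<exists>g < N.
      \<not> satisfiable (formula (candidate m D k tab cl (rounds k n p) p g)))"
    unfolding accepts_def D_def[symmetric] N_def[symmetric] n_def[symmetric] refuted ..
  have "is_backbone k \<phi> x" if acc: "accepts m k x cs tab cl"
  proof -
    obtain p g where p: "p \<in> starts (padded x cs)"
      and unsat: "\<not> satisfiable (formula (candidate m D k tab cl (rounds k n p) p g))"
      using acc unfolding accepts by blast
    define \<psi>0 where "\<psi>0 = (if length (cl p) \<le> k then [cl p] else [])"
    obtain \<nu> where \<nu>: "candidate m D k tab cl (rounds k n p) p g = \<psi>0 @ \<nu>" "length \<nu> \<le> rounds k n p"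
        "set \<nu> \<subseteq> cl ` (range tab - {0})"
      using chain_sound[of m D k tab cl "rounds k n p" g \<psi>0] unfolding candidate_def \<psi>0_def by blast
    have "set \<nu> \<subseteq> set cs" using \<nu>(3) cl_tab by auto
    then have sub: "formula \<nu> \<subseteq> \<phi>" using listing by auto
    have card\<nu>: "card (formula \<nu>) \<le> rounds k n p"
      using \<nu>(2) card_length[of "map set \<nu>"] by simp
    have "p = 0 \<or> p = n \<or> (\<exists>q \<in> starts cs. p = 3 + q)" using p unfolding starts_padded n_def by auto
    then show ?thesis
    proof (elim disjE bexE)
      assume "p = 0"
      \<comment> \<open>Here \<open>1 \<le> k\<close> matters: a unit clause has to pass the length
        filter.\<close>
      then have "formula (\<psi>0 @ \<nu>) = insert {Neg x} (formula \<nu>)" using k by (simp add: \<psi>0_def cl_front)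
      then show ?thesis
        using unsat sub card\<nu> \<nu>(1) rounds_le[of p] unfolding is_backbone_iff by (metis insertI1 le_trans)
    next
      assume "p = n"
      then have "formula (\<psi>0 @ \<nu>) = insert {Pos x} (formula \<nu>)" using k by (simp add: \<psi>0_def cl_back)
      then show ?thesis
        using unsat sub card\<nu> \<nu>(1) rounds_le[of p] unfolding is_backbone_iff
        by (metis insertI1 insertI2 le_trans)
    next
      fix q assume q: "q \<in> starts cs" "p = 3 + q"
      then obtain C1 C C2 where C: "cs = C1 @ C # C2" "q = length (encode_clauses C1)" by (auto simp: starts_def)
      then have "cl p = C" using cl_mid q(2) by simp
      then have "formula \<psi>0 \<subseteq> \<phi>" using C(1) listing by (auto simp: \<psi>0_def)
      then have sub': "formula (\<psi>0 @ \<nu>) \<subseteq> \<phi>" using sub by auto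
      have "p < n" using C q(2) by (simp add: n_def)
      then have "rounds k n p = k - 1" using q(2) by (simp add: rounds_def)
      moreover have "card (formula (\<psi>0 @ \<nu>)) \<le> length (\<psi>0 @ \<nu>)" using card_length[of "map set (\<psi>0 @ \<nu>)"] by simp
      moreover have "length \<psi>0 \<le> 1" by (simp add: \<psi>0_def)
      ultimately have "card (formula (\<psi>0 @ \<nu>)) \<le> k" using \<nu>(2) k by simp
      \<comment> \<open>The candidate is unsatisfiable without any unit clause and hence entails
        both literals; \<open>Neg x\<close> is an arbitrary choice.\<close>
      moreover have "\<not> satisfiable (insert {Neg x} (formula (\<psi>0 @ \<nu>)))"
        using unsat \<nu>(1) satisfiable_subset by (metis subset_insertI)
      ultimately show ?thesis using sub' unfolding is_backbone_iff by blast
    qed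
  qed
  moreover have "accepts m k x cs tab cl" if bb: "is_backbone k \<phi> x"
  proof -
    obtain \<phi>' l where \<phi>': "\<phi>' \<subseteq> \<phi>" "card \<phi>' \<le> k" and l: "l = Neg x \<or> l = Pos x"
      and "\<not> satisfiable (insert {l} \<phi>')" using bb unfolding is_backbone_iff by blast
    have fin: "finite \<phi>'" using \<phi>'(1) clauses(2) finite_subset by blast
    then obtain U where U: "U \<subseteq> insert {l} \<phi>'" "min_unsat U"
      using ex_min_unsat[of "insert {l} \<phi>'"] \<open>\<not> satisfiable _\<close> by auto
    have finU: "finite U" using U(1) fin finite_subset by blast
    have "card U \<le> card (insert {l} \<phi>')" using U(1) fin by (intro card_mono) auto
    also have "\<dots> \<le> Suc (card \<phi>')" by (rule card_insert_le_m1) (use fin in auto)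
    finally have cardU: "card U \<le> k + 1" using \<phi>'(2) by simp
    \<comment> \<open>A clause of \<open>U\<close> has fewer literals than \<open>U\<close> has
      clauses, so the length filter rejects no clause that is needed.\<close>
    have width: "card K \<le> k" if "K \<in> U" for K
    proof -
      have "is_clause K" using that U(1) \<phi>'(1) clauses(1) by (auto simp: is_clause_def)
      then show ?thesis using min_unsat_width[OF U(2) finU that] cardU by simp
    qed
    \<comment> \<open>Completeness for any starting clause in \<open>U\<close> whose number of
      rounds suffices for the rest. The case distinction below only chooses \<open>p\<close>: the
      unit clause if it lies in \<open>U\<close>, and any clause of \<open>U\<close>
      otherwise.\<close>
    have start: ?thesis
      if p: "p \<in> starts (padded x cs)" "set (cl p) \<in> U" "length (cl p) \<le> k"
        "card (U - {set (cl p)}) \<le> rounds k n p" "U - {set (cl p)} \<subseteq> \<phi>" for p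
    proof -
      have "\<exists>q < D ^ (2 * rounds k n p). formula (chain m D k tab cl (rounds k n p) q [cl p]) = U"
      proof (rule chain_complete[OF U(2) finU D(1,2)], goal_cases)
        case (6 K v)
        then have "K \<in> U" "K \<in> \<phi>" using p(5) by auto
        then show ?case using occurrence[of K v] 6(2) width[of K] by metis
      qed (use p rounds_le[of p] in auto)
      then obtain q where q: "q < D ^ (2 * rounds k n p)"
        "formula (candidate m D k tab cl (rounds k n p) p q) = U" using p(3) by (auto simp: candidate_def)
      have "D ^ (2 * rounds k n p) \<le> N" using rounds_le[of p] by (intro N) simp
      then show ?thesis
        using q U(2) p(1) unfolding accepts min_unsat_def by (metis order_less_le_trans)
    qed
    show ?thesis
    proof (cases "{l} \<in> U")
      case True
      have "card (U - {{l}}) \<le> card \<phi>'" using U(1) fin by (intro card_mono) auto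
      then have c: "card (U - {{l}}) \<le> k" "U - {{l}} \<subseteq> \<phi>" using \<phi>' U(1) by auto
      show ?thesis
        using l
      proof
        assume "l = Neg x"
        then show ?thesis using True c k cl_front
          by (intro start[of 0]) (auto simp: starts_padded rounds_def)
      next
        assume "l = Pos x"
        then show ?thesis using True c k cl_back
          by (intro start[of n]) (auto simp: starts_padded rounds_def n_def)
      qed
    next
      case False
      then have sub: "U \<subseteq> \<phi>'" using U(1) by auto
      have "satisfiable {}" by (simp add: satisfiable_def satisfies_def)
      then have "U \<noteq> {}" using U(2) by (auto simp: min_unsat_def)
      then obtain K where K: "K \<in> U" by blast
      then obtain C where C: "C \<in> set cs" "set C = K" using sub \<phi>'(1) listing by auto
      then obtain C1 C2 where split: "cs = C1 @ C # C2" by (meson split_list)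
      define p where "p = 3 + length (encode_clauses C1)"
      have clp: "cl p = C" using cl_mid[OF split] by (simp add: p_def)
      have "p < n" by (simp add: p_def n_def split)
      then have r: "rounds k n p = k - 1" by (simp add: rounds_def p_def)
      have "card U \<le> card \<phi>'" using sub fin by (rule card_mono[rotated])
      then have "card (U - {K}) \<le> k - 1" using K \<phi>'(2) by (simp add: card_Diff_singleton)
      moreover have "length C = card K" using C listing(2) by (metis distinct_card)
      moreover have "length (encode_clauses C1) \<in> starts cs" using split by (auto simp: starts_def)
      then have "p \<in> starts (padded x cs)" unfolding starts_padded p_def by blast
      ultimately show ?thesis using K C sub \<phi>'(1) width r clp by (intro start[of p]) auto
    qed
  qed
  ultimately show ?thesis unfolding cl_def by blast
qed

theorem theorem4:
  fixes d :: int
  shows "fixed_parameter_linear (Local_Backbone (VO d))"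
proof -
  define m where "m = nat d"
  obtain B where B: "\<forall>i\<in>set (machine (main m)). tame B i" using tame_machine by blast
  \<comment> \<open>One function has to bound both time and values, and the values dominate:
    \<open>tame_values_bounded\<close> asks for the square of
    \<open>time_factor m * N ^ 4 + B + 1\<close>, which is at most \<open>A * N ^ 8\<close>.
    \<open>B\<close> bounds the constants in the program.\<close>
  define A where "A = (time_factor m + B + 1)\<^sup>2"
  define f where "f k = A * search_size m k ^ 8" for k
  have f: "computable f" unfolding f_def by (rule computable_bound)
  have key: "computes_within (machine (main m)) w (f k * length w) (if is_backbone k \<phi> x then 1 else 0) \<and>
      values_bounded (machine (main m)) w (f k * magnitude w ^ 2)"
    if I: "\<phi> \<in> VO d" "x \<in> vars \<phi>" "1 \<le> k" and cs: "clause_listing \<phi> cs"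
      and w: "w = [k, x, length cs] @ encode_clauses cs" for \<phi> x k cs w
  proof -
    define N where "N = search_size m k"
    define F where "F = time_factor m * N ^ 4"
    \<comment> \<open>The variable \<open>x\<close> of the instance occurs in some clause, which
      forces \<open>d\<close> to be positive; for \<open>d \<le> 0\<close> there are no
      instances.\<close>
    obtain K where "K \<in> {C \<in> \<phi>. x \<in> var_of ` C}" using I(2) by (auto simp: vars_def)
    moreover have "finite \<phi>" using I(1) by (simp add: VO_def is_cnf_def)
    ultimately have "0 < card {C \<in> \<phi>. x \<in> var_of ` C}" by (auto simp: card_gt_0_iff)
    moreover have "int (card {C \<in> \<phi>. x \<in> var_of ` C}) \<le> d" using I(1,2) by (auto simp: VO_def)
    ultimately have m0: "0 < m" by (simp add: m_def)
    have "length (row (entries 3 cs) v) \<le> m" for v using length_row_le[OF I(1) cs] by (simp add: m_def)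
    then obtain tab t R' M' where tab: "represents_occurrences m tab (entries 3 cs)"
      and ev: "ev (main m) (initial_regs w) (initial_mem w) t R' M'" "t + 3 \<le> F * length w"
      and R': "R' 0 = (if accepts m k x cs tab (clause_at (padded x cs)) then 1 else 0)"
      using main_correct[OF w m0, of "clause_at (padded x cs)"] clause_at_eq unfolding F_def N_def by metis
    have "R' 0 = (if is_backbone k \<phi> x then 1 else 0)"
      using R' accepts_iff[OF I(1) cs I(3) m_def m0 tab] by simp
    then have C: "computes_within (machine (main m)) w (t + 3) (if is_backbone k \<phi> x then 1 else 0)"
      using machine_correct[OF ev(1)] by simp
    have "2 \<le> N" using search_base_le_size(1)[of k m] search_base_le_size(2)[of m k] by (simp add: N_def)
    then have "1 \<le> N ^ 4" by simp
    then have "F + B + 1 \<le> time_factor m * N ^ 4 + B * N ^ 4 + 1 * N ^ 4"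
      unfolding F_def by (intro add_mono) auto
    also have "\<dots> = (time_factor m + B + 1) * N ^ 4" by (simp add: algebra_simps)
    finally have "(F + B + 1)\<^sup>2 \<le> ((time_factor m + B + 1) * N ^ 4)\<^sup>2" by (rule power_mono) simp
    also have "\<dots> = f k" by (simp only: f_def A_def N_def[symmetric] power_mult_distrib power_mult[symmetric]) simp
    finally have Ff: "(F + B + 1)\<^sup>2 \<le> f k" .
    have "F \<le> (F + B + 1)\<^sup>2" by (simp add: power2_eq_square)
    then have "F \<le> f k" using Ff by linarith
    then have "t + 3 \<le> f k * length w" using ev(2) by (meson le_trans mult_le_mono1)
    then have "computes_within (machine (main m)) w (f k * length w) (if is_backbone k \<phi> x then 1 else 0)"
      using C unfolding computes_within_def by (meson le_trans)
    moreover have "values_bounded (machine (main m)) w ((F + B + 1)\<^sup>2 * magnitude w ^ 2)"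
    proof (rule tame_values_bounded[OF B C])
      show "1 \<le> magnitude w" by (simp add: magnitude_def w)
      have "F * length w \<le> F * magnitude w" by (simp add: magnitude_def)
      then show "t + 3 \<le> F * magnitude w" using ev(2) by linarith
    qed
    then have "values_bounded (machine (main m)) w (f k * magnitude w ^ 2)"
      unfolding values_bounded_def using mult_le_mono1[OF Ff] by (meson le_trans)
    ultimately show ?thesis by blast
  qed
  show ?thesis
    unfolding fixed_parameter_linear_def
  proof (intro exI[of _ "machine (main m)"] exI[of _ f] exI[of _ 2] conjI[OF f] ballI)
    fix I w
    assume I: "I \<in> instances (Local_Backbone (VO d))" and w: "w \<in> encodings (Local_Backbone (VO d)) I"
    obtain \<phi> x k where I_eq: "I = (\<phi>, x, k)" by (cases I)
    obtain cs where "clause_listing \<phi> cs" "w = [k, x, length cs] @ encode_clauses cs"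
      using w by (auto simp: Local_Backbone_def I_eq)
    moreover have "\<phi> \<in> VO d" "x \<in> vars \<phi>" "1 \<le> k" using I by (simp_all add: Local_Backbone_def I_eq)
    ultimately have "computes_within (machine (main m)) w (f k * length w) (if is_backbone k \<phi> x then 1 else 0) \<and>
        values_bounded (machine (main m)) w (f k * magnitude w ^ 2)"
      by (intro key)
    then show "computes_within (machine (main m)) w (f (parameter (Local_Backbone (VO d)) I) * length w)
          (if yes (Local_Backbone (VO d)) I then 1 else 0) \<and>
        values_bounded (machine (main m)) w (f (parameter (Local_Backbone (VO d)) I) * magnitude w ^ 2)"
      by (simp add: Local_Backbone_def I_eq)
  qed
qed

end
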